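(* Let $\Lambda$ be a finite-dimensional algebra over a field $K$, and let $\mathcal X$ be a finite set of (isomorphism classes of) indecomposable $\Lambda$-modules which contains the indecomposable projective modules. Suppose that the algebra $\operatorname{End}_\Lambda\big(\bigoplus_{R\in\mathcal X}R\big)^{op}$ has finite global dimension. Then the dim-hom invariant relative to $\mathcal X$, i.e. $q:K_0^{split}(\Lambda)\to\mathbb Z^{|\mathcal X|}$, $[M]\mapsto(\dim_K\operatorname{Hom}_\Lambda(R,M))_{R\in\mathcal X}$, and the homological invariant relative to $\mathcal X$, i.e. the quotient map $p:K_0^{split}(\Lambda)\to K_0(\Lambda,\mathcal X)$, $[M]\mapsto[M]_{\mathcal X}$, are equivalent; that is, $\ker p=\ker q$.
   Context: Standing assumptions: $\Lambda$ is basic and every simple $\Lambda$-module is one-dimensional over $K$. Modules are finitely generated right modules, forming the category $\mathrm{mod}\,\Lambda$; modules are identified with their isomorphism classes. $K_0^{split}(\Lambda)$ is the free abelian group on isomorphism classes $[M]$, $M\in\mathrm{mod}\,\Lambda$, modulo $[M\oplus N]=[M]+[N]$ (it is free abelian on the indecomposables). An invariant is a surjective group homomorphism $K_0^{split}(\Lambda)\to\mathbb Z^n$ for some $n$; two invariants $p,q$ are equivalent if $\ker p=\ker q$. $\mathcal E_{\mathcal X}$ is the class of short exact sequences $0\to M\to N\xrightarrow{g}L\to0$ in $\mathrm{mod}\,\Lambda$ such that $\operatorname{Hom}_\Lambda(R,g)$ is surjective for every $R\in\mathcal X$. The relative Grothendieck group $K_0(\Lambda,\mathcal X)$ is the free abelian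 group on isomorphism classes $[M]$, $M\in\mathrm{mod}\,\Lambda$, modulo the subgroup generated by all $[M]-[N]+[L]$ for $0\to M\to N\to L\to 0$ in $\mathcal E_{\mathcal X}$; $[M]_{\mathcal X}$ denotes the class of $M$. $\mathrm{add}(\mathcal X)$ is the full subcategory of finite direct sums of modules in $\mathcal X$ (including $0$). An $\mathcal X$-approximation of $M$ is a morphism $f:R\to M$ with $R\in\mathrm{add}(\mathcal X)$ through which every morphism $R'\to M$ with $R'\in\mathrm{add}(\mathcal X)$ factors; it is minimal if every $g:R\to R$ with $fg=f$ is an isomorphism. A (minimal) $\mathcal X$-resolution of $M$ is an exact sequence $\cdots\to R_1\to R_0\to M\to0$ obtained by iteratively taking (minimal) $\mathcal X$-approximations of $M$ and of the successive kernels. The $\mathcal X$-dimension of $M$ is $\min(\{j\mid R_{j+1}=0\}\cup\{\infty\})$ for a minimal $\mathcal X$-resolution $R_\bullet$; the $\mathcal X$-dimension of $\Lambda$ is properly infinite if some $M\in\mathrm{mod}\,\Lambda$ has infinite $\mathcal X$-dimension. An invariant is a dim-hom invariant relative to $\mathcal X$ if it is equivalent to $[M]\mapsto(\dim_K\operatorname{Hom}_\Lambda(R,M))_{R\in\mathcal X}$. An invariant is homological relative to $\mathcal X$ if $\mathcal X$ contains all indecomposable projectives, the $\mathcal X$-dimension of $\Lambda$ is not properly infinite, and the invariant is equivalent to the quotient map $K_0^{split}(\Lambda)\to K_0(\Lambda,\mathcal X)\simeq\mathbb Z^{|\mathcal X|}$. *)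

theory Defs
  imports
    "HOL-Algebra.Module"
    "HOL-Algebra.Coset"
    "HOL-Algebra.Product_Groups"
    "HOL-Algebra.Free_Abelian_Groups"
    "HOL-Library.Extended_Nat"
begin

section \<open>Vector spaces and finite-dimensional algebras\<close>

definition lin_span :: "('k, 'z) ring_scheme \<Rightarrow> ('k, 'v) module \<Rightarrow> 'v set \<Rightarrow> 'v set" where
  "lin_span K V B =
    {finsum V (\<lambda>b. c b \<odot>\<^bsub>V\<^esub> b) F | c F. finite F \<and> F \<subseteq> B \<and> c \<in> F \<rightarrow> carrier K}"

definition lin_indep :: "('k, 'z) ring_scheme \<Rightarrow> ('k, 'v) module \<Rightarrow> 'v set \<Rightarrow> bool" where
  "lin_indep K V B \<longleftrightarrow>
    (\<forall>F c. finite F \<and> F \<subseteq> B \<and> c \<in> F \<rightarrow> carrier K \<and>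
       finsum V (\<lambda>b. c b \<odot>\<^bsub>V\<^esub> b) F = \<zero>\<^bsub>V\<^esub> \<longrightarrow> (\<forall>b\<in>F. c b = \<zero>\<^bsub>K\<^esub>))"

definition lin_basis :: "('k, 'z) ring_scheme \<Rightarrow> ('k, 'v) module \<Rightarrow> 'v set \<Rightarrow> bool" where
  "lin_basis K V B \<longleftrightarrow> B \<subseteq> carrier V \<and> lin_indep K V B \<and> lin_span K V B = carrier V"

text \<open>Infinite-dimensional spaces get the value 0; it is only used for finite-dimensional ones.\<close>

definition vdim :: "('k, 'z) ring_scheme \<Rightarrow> ('k, 'v) module \<Rightarrow> nat" where
  "vdim K V = card (SOME B. lin_basis K V B)"

text \<open>The locale \<open>algebra\<close> of HOL-Algebra requires a commutative multiplication, hence this one.\<close>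

locale fd_algebra = K?: field K + V?: Module.module K A + A?: ring A
  for K (structure) and A :: "('k, 'a) module" (structure) +
  assumes smult_mult_left:
    "\<lbrakk>c \<in> carrier K; x \<in> carrier A; y \<in> carrier A\<rbrakk> \<Longrightarrow>
      (c \<odot>\<^bsub>A\<^esub> x) \<otimes>\<^bsub>A\<^esub> y = c \<odot>\<^bsub>A\<^esub> (x \<otimes>\<^bsub>A\<^esub> y)"
  and smult_mult_right:
    "\<lbrakk>c \<in> carrier K; x \<in> carrier A; y \<in> carrier A\<rbrakk> \<Longrightarrow>
      x \<otimes>\<^bsub>A\<^esub> (c \<odot>\<^bsub>A\<^esub> y) = c \<odot>\<^bsub>A\<^esub> (x \<otimes>\<^bsub>A\<^esub> y)"
  and finite_dim: "\<exists>B. finite B \<and> B \<subseteq> carrier A \<and> lin_span K A B = carrier A"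

section \<open>Right modules and their homomorphisms\<close>

text \<open>
  Right modules reuse the record type of HOL-Algebra modules (whose ring multiplication
  and unit fields are ignored): \<open>a \<odot>\<^bsub>M\<^esub> x\<close> stands for the right action \<open>x a\<close>, so that
  \<open>(x a) b = x (a b)\<close> reads as in \<open>act_assoc\<close>.
\<close>

locale right_module = R?: ring R + M?: abelian_group M
  for R (structure) and M :: "('a, 'm) module" (structure) +
  assumes act_closed:
    "\<lbrakk>a \<in> carrier R; x \<in> carrier M\<rbrakk> \<Longrightarrow> a \<odot>\<^bsub>M\<^esub> x \<in> carrier M"
  and act_add_ring:
    "\<lbrakk>a \<in> carrier R; b \<in> carrier R; x \<in> carrier M\<rbrakk> \<Longrightarrow>
      (a \<oplus>\<^bsub>R\<^esub> b) \<odot>\<^bsub>M\<^esub> x = a \<odot>\<^bsub>M\<^esub> x \<oplus>\<^bsub>M\<^esub> b \<odot>\<^bsub>M\<^esub> x"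
  and act_add:
    "\<lbrakk>a \<in> carrier R; x \<in> carrier M; y \<in> carrier M\<rbrakk> \<Longrightarrow>
      a \<odot>\<^bsub>M\<^esub> (x \<oplus>\<^bsub>M\<^esub> y) = a \<odot>\<^bsub>M\<^esub> x \<oplus>\<^bsub>M\<^esub> a \<odot>\<^bsub>M\<^esub> y"
  and act_assoc:
    "\<lbrakk>a \<in> carrier R; b \<in> carrier R; x \<in> carrier M\<rbrakk> \<Longrightarrow>
      b \<odot>\<^bsub>M\<^esub> (a \<odot>\<^bsub>M\<^esub> x) = (a \<otimes>\<^bsub>R\<^esub> b) \<odot>\<^bsub>M\<^esub> x"
  and act_one: "x \<in> carrier M \<Longrightarrow> \<one>\<^bsub>R\<^esub> \<odot>\<^bsub>M\<^esub> x = x"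

definition fin_gen :: "('a, 'r) ring_scheme \<Rightarrow> ('a, 'm) module \<Rightarrow> bool" where
  "fin_gen R M \<longleftrightarrow>
    (\<exists>S. finite S \<and> S \<subseteq> carrier M \<and>
      carrier M = {finsum M (\<lambda>s. c s \<odot>\<^bsub>M\<^esub> s) S | c. c \<in> S \<rightarrow> carrier R})"

text \<open>
  Homomorphisms are extensional (\<open>undefined\<close> off the carrier), so that equality of
  functions is equality of morphisms.
\<close>

definition Hom :: "('a, 'r) ring_scheme \<Rightarrow> ('a, 'm) module \<Rightarrow> ('a, 'n) module \<Rightarrow> ('m \<Rightarrow> 'n) set" where
  "Hom R M N =
    {f \<in> carrier M \<rightarrow>\<^sub>E carrier N.
      (\<forall>x\<in>carrier M. \<forall>y\<in>carrier M. f (x \<oplus>\<^bsub>M\<^esub> y) = f x \<oplus>\<^bsub>N\<^esub> f y) \<and>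
      (\<forall>a\<in>carrier R. \<forall>x\<in>carrier M. f (a \<odot>\<^bsub>M\<^esub> x) = a \<odot>\<^bsub>N\<^esub> f x)}"

definition isomorphic :: "('a, 'r) ring_scheme \<Rightarrow> ('a, 'm) module \<Rightarrow> ('a, 'n) module \<Rightarrow> bool" where
  "isomorphic R M N \<longleftrightarrow> (\<exists>f\<in>Hom R M N. bij_betw f (carrier M) (carrier N))"

definition mker :: "('a, 'm) module \<Rightarrow> ('a, 'n) module \<Rightarrow> ('m \<Rightarrow> 'n) \<Rightarrow> 'm set" where
  "mker M N f = {x \<in> carrier M. f x = \<zero>\<^bsub>N\<^esub>}"

abbreviation zero_module :: "('a, 'm) module \<Rightarrow> bool" where
  "zero_module M \<equiv> carrier M = {\<zero>\<^bsub>M\<^esub>}"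

definition dsum :: "('a, 'm) module \<Rightarrow> ('a, 'n) module \<Rightarrow> ('a, 'm \<times> 'n) module" where
  "dsum M N =
    \<lparr>carrier = carrier M \<times> carrier N, mult = undefined, one = undefined,
     ring.zero = (\<zero>\<^bsub>M\<^esub>, \<zero>\<^bsub>N\<^esub>),
     add = (\<lambda>(x, y) (x', y'). (x \<oplus>\<^bsub>M\<^esub> x', y \<oplus>\<^bsub>N\<^esub> y')),
     smult = (\<lambda>a (x, y). (a \<odot>\<^bsub>M\<^esub> x, a \<odot>\<^bsub>N\<^esub> y))\<rparr>"

text \<open>Direct sum of a family over \<open>I\<close>, which is only used for finite \<open>I\<close>.\<close>

definition dsum_fam :: "'i set \<Rightarrow> ('i \<Rightarrow> ('a, 'm) module) \<Rightarrow> ('a, 'i \<Rightarrow> 'm) module" where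
  "dsum_fam I M =
    \<lparr>carrier = (\<Pi>\<^sub>E i\<in>I. carrier (M i)), mult = undefined, one = undefined,
     ring.zero = (\<lambda>i\<in>I. \<zero>\<^bsub>M i\<^esub>),
     add = (\<lambda>x y. \<lambda>i\<in>I. x i \<oplus>\<^bsub>M i\<^esub> y i),
     smult = (\<lambda>a x. \<lambda>i\<in>I. a \<odot>\<^bsub>M i\<^esub> x i)\<rparr>"

section \<open>Scalars\<close>

text \<open>
  A right module over a \<open>K\<close>-algebra \<open>A\<close> is a \<open>K\<close>-vector space through \<open>K \<rightarrow> A\<close>, \<open>c \<mapsto> c 1\<close>.
\<close>

definition underlying_space :: "('k, 'a) module \<Rightarrow> ('a, 'm) module \<Rightarrow> ('k, 'm) module" where
  "underlying_space A M =
    \<lparr>carrier = carrier M, mult = undefined, one = undefined,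
     ring.zero = \<zero>\<^bsub>M\<^esub>, add = (\<oplus>\<^bsub>M\<^esub>),
     smult = (\<lambda>c x. (c \<odot>\<^bsub>A\<^esub> \<one>\<^bsub>A\<^esub>) \<odot>\<^bsub>M\<^esub> x)\<rparr>"

definition hom_space ::
    "('k, 'a) module \<Rightarrow> ('a, 'm) module \<Rightarrow> ('a, 'n) module \<Rightarrow> ('k, 'm \<Rightarrow> 'n) module" where
  "hom_space A M N =
    \<lparr>carrier = Hom A M N, mult = undefined, one = undefined,
     ring.zero = (\<lambda>x\<in>carrier M. \<zero>\<^bsub>N\<^esub>),
     add = (\<lambda>f g. \<lambda>x\<in>carrier M. f x \<oplus>\<^bsub>N\<^esub> g x),
     smult = (\<lambda>c f. \<lambda>x\<in>carrier M. (c \<odot>\<^bsub>A\<^esub> \<one>\<^bsub>A\<^esub>) \<odot>\<^bsub>N\<^esub> f x)\<rparr>"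

text \<open>The product \<open>f g\<close> in the endomorphism algebra is \<open>f \<circ> g\<close>.\<close>

definition End_algebra :: "('k, 'a) module \<Rightarrow> ('a, 'm) module \<Rightarrow> ('k, 'm \<Rightarrow> 'm) module" where
  "End_algebra A M =
    (hom_space A M M)\<lparr>mult := compose (carrier M), one := (\<lambda>x\<in>carrier M. x)\<rparr>"

definition op_algebra :: "('k, 'a) module \<Rightarrow> ('k, 'a) module" where
  "op_algebra A = A\<lparr>mult := (\<lambda>x y. y \<otimes>\<^bsub>A\<^esub> x)\<rparr>"

definition regular_module :: "('k, 'a) module \<Rightarrow> ('a, 'a) module" where
  "regular_module A =
    \<lparr>carrier = carrier A, mult = undefined, one = undefined,
     ring.zero = \<zero>\<^bsub>A\<^esub>, add = (\<oplus>\<^bsub>A\<^esub>), smult = (\<lambda>a x. x \<otimes>\<^bsub>A\<^esub> a)\<rparr>"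

section \<open>The category of finitely generated right modules\<close>

text \<open>
  Finitely generated modules over a finite-dimensional \<open>K\<close>-algebra are finite-dimensional
  over \<open>K\<close>, so each one is isomorphic to a module whose carrier is a set of functions
  \<open>nat \<Rightarrow> 'k\<close>. The objects of \<open>mod A\<close> are all module structures, with arbitrary operations,
  on arbitrary subsets of that type.
\<close>

type_synonym ('k, 'a) rmod = "('a, nat \<Rightarrow> 'k) module"

definition fg_modules :: "('k, 'a) module \<Rightarrow> ('k, 'a) rmod set" where
  "fg_modules A = {M. right_module A M \<and> fin_gen A M}"

definition simple_module :: "('k, 'a) module \<Rightarrow> ('k, 'a) rmod \<Rightarrow> bool" where
  "simple_module A M \<longleftrightarrow> M \<in> fg_modules A \<and> \<not> zero_module M \<and>
    (\<forall>N. subgroup N (add_monoid M) \<and> (\<forall>a\<in>carrier A. \<forall>x\<in>N. a \<odot>\<^bsub>M\<^esub> x \<in> N) \<longrightarrow>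
       N = {\<zero>\<^bsub>M\<^esub>} \<or> N = carrier M)"

definition indecomposable :: "('k, 'a) module \<Rightarrow> ('k, 'a) rmod \<Rightarrow> bool" where
  "indecomposable A M \<longleftrightarrow> M \<in> fg_modules A \<and> \<not> zero_module M \<and>
    (\<forall>N\<in>fg_modules A. \<forall>L\<in>fg_modules A.
       isomorphic A M (dsum N L) \<longrightarrow> zero_module N \<or> zero_module L)"

definition projective :: "('k, 'a) module \<Rightarrow> ('k, 'a) rmod \<Rightarrow> bool" where
  "projective A P \<longleftrightarrow> P \<in> fg_modules A \<and>
    (\<forall>N\<in>fg_modules A. \<forall>L\<in>fg_modules A. \<forall>g\<in>Hom A N L. g ` carrier N = carrier L \<longrightarrow>
       (\<forall>h\<in>Hom A P L. \<exists>h'\<in>Hom A P N. compose (carrier P) g h' = h))"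

definition pairwise_nonisomorphic :: "('k, 'a) module \<Rightarrow> ('k, 'a) rmod set \<Rightarrow> bool" where
  "pairwise_nonisomorphic A X \<longleftrightarrow> (\<forall>M\<in>X. \<forall>N\<in>X. isomorphic A M N \<longrightarrow> M = N)"

text \<open>
  An algebra is basic if no indecomposable direct summand occurs twice in its regular module.
\<close>

definition basic :: "('k, 'a) module \<Rightarrow> bool" where
  "basic A \<longleftrightarrow> (\<exists>Q. finite Q \<and> (\<forall>P\<in>Q. indecomposable A P) \<and> pairwise_nonisomorphic A Q \<and>
    isomorphic A (regular_module A) (dsum_fam Q (\<lambda>P. P)))"

section \<open>Global dimension\<close>

text \<open>
  \<open>Q 0\<close> is the resolved module and \<open>Q (Suc j)\<close> the \<open>j\<close>-th term of the resolution:
  \<open>\<dots> \<rightarrow> Q 2 \<rightarrow> Q 1 \<rightarrow> Q 0 \<rightarrow> 0\<close>, with maps \<open>d j : Q (Suc j) \<rightarrow> Q j\<close>.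
\<close>

definition projective_resolution ::
    "('k, 'a) module \<Rightarrow> ('k, 'a) rmod \<Rightarrow> (nat \<Rightarrow> ('k, 'a) rmod) \<Rightarrow>
      (nat \<Rightarrow> (nat \<Rightarrow> 'k) \<Rightarrow> (nat \<Rightarrow> 'k)) \<Rightarrow> bool" where
  "projective_resolution A M Q d \<longleftrightarrow>
    Q 0 = M \<and> (\<forall>j. projective A (Q (Suc j))) \<and> (\<forall>j. d j \<in> Hom A (Q (Suc j)) (Q j)) \<and>
    d 0 ` carrier (Q 1) = carrier M \<and>
    (\<forall>j. d (Suc j) ` carrier (Q (Suc (Suc j))) = mker (Q (Suc j)) (Q j) (d j))"

definition proj_dim :: "('k, 'a) module \<Rightarrow> ('k, 'a) rmod \<Rightarrow> enat" where
  "proj_dim A M =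
    Inf {enat n | n. \<exists>Q d. projective_resolution A M Q d \<and> (\<forall>j>n. zero_module (Q (Suc j)))}"

definition gl_dim :: "('k, 'a) module \<Rightarrow> enat" where
  "gl_dim A = (SUP M\<in>fg_modules A. proj_dim A M)"

section \<open>Grothendieck groups\<close>

definition iso_class :: "('k, 'a) module \<Rightarrow> ('k, 'a) rmod \<Rightarrow> ('k, 'a) rmod set" where
  "iso_class A M = {N \<in> fg_modules A. isomorphic A M N}"

definition iso_classes :: "('k, 'a) module \<Rightarrow> ('k, 'a) rmod set set" where
  "iso_classes A = iso_class A ` fg_modules A"

definition free_K0 :: "('k, 'a) module \<Rightarrow> (('k, 'a) rmod set \<Rightarrow>\<^sub>0 int) monoid" where
  "free_K0 A = free_Abelian_group (iso_classes A)"

definition split_subgroup :: "('k, 'a) module \<Rightarrow> (('k, 'a) rmod set \<Rightarrow>\<^sub>0 int) set" where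
  "split_subgroup A = generate (free_K0 A)
    {frag_of (iso_class A D) - (frag_of (iso_class A M) + frag_of (iso_class A N)) | D M N.
       D \<in> fg_modules A \<and> M \<in> fg_modules A \<and> N \<in> fg_modules A \<and> isomorphic A D (dsum M N)}"

definition K0_split :: "('k, 'a) module \<Rightarrow> (('k, 'a) rmod set \<Rightarrow>\<^sub>0 int) set monoid" where
  "K0_split A = free_K0 A Mod split_subgroup A"

definition rel_exact ::
    "('k, 'a) module \<Rightarrow> ('k, 'a) rmod set \<Rightarrow> ('k, 'a) rmod \<Rightarrow> ('k, 'a) rmod \<Rightarrow> ('k, 'a) rmod \<Rightarrow>
      ((nat \<Rightarrow> 'k) \<Rightarrow> (nat \<Rightarrow> 'k)) \<Rightarrow> ((nat \<Rightarrow> 'k) \<Rightarrow> (nat \<Rightarrow> 'k)) \<Rightarrow> bool" where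
  "rel_exact A X M N L f g \<longleftrightarrow>
    M \<in> fg_modules A \<and> N \<in> fg_modules A \<and> L \<in> fg_modules A \<and>
    f \<in> Hom A M N \<and> g \<in> Hom A N L \<and>
    inj_on f (carrier M) \<and> f ` carrier M = mker N L g \<and> g ` carrier N = carrier L \<and>
    (\<forall>R\<in>X. (\<lambda>h. compose (carrier R) g h) ` Hom A R N = Hom A R L)"

definition rel_subgroup ::
    "('k, 'a) module \<Rightarrow> ('k, 'a) rmod set \<Rightarrow> (('k, 'a) rmod set \<Rightarrow>\<^sub>0 int) set" where
  "rel_subgroup A X = generate (free_K0 A)
    {frag_of (iso_class A M) - frag_of (iso_class A N) + frag_of (iso_class A L) | M N L.
       \<exists>f g. rel_exact A X M N L f g}"

definition K0_rel ::
    "('k, 'a) module \<Rightarrow> ('k, 'a) rmod set \<Rightarrow> (('k, 'a) rmod set \<Rightarrow>\<^sub>0 int) set monoid" where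
  "K0_rel A X = free_K0 A Mod rel_subgroup A X"

section \<open>The two invariants\<close>

text \<open>
  Both maps are defined on the free abelian group on isomorphism classes and take a common
  value on each coset of \<open>split_subgroup A\<close>; \<open>the_elem\<close> extracts that value.
\<close>

definition homological_invariant ::
    "('k, 'a) module \<Rightarrow> ('k, 'a) rmod set \<Rightarrow>
      (('k, 'a) rmod set \<Rightarrow>\<^sub>0 int) set \<Rightarrow> (('k, 'a) rmod set \<Rightarrow>\<^sub>0 int) set" where
  "homological_invariant A X C =
    the_elem ((\<lambda>x. rel_subgroup A X #>\<^bsub>free_K0 A\<^esub> x) ` C)"

definition dim_hom_free ::
    "('k, 'z) ring_scheme \<Rightarrow> ('k, 'a) module \<Rightarrow> ('k, 'a) rmod set \<Rightarrow>
      (('k, 'a) rmod set \<Rightarrow>\<^sub>0 int) \<Rightarrow> ('k, 'a) rmod \<Rightarrow> int" where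
  "dim_hom_free K A X x = (\<lambda>R\<in>X.
    \<Sum>c\<in>Poly_Mapping.keys x.
      Poly_Mapping.lookup x c * int (vdim K (hom_space A R (SOME M. M \<in> c))))"

definition dim_hom_invariant ::
    "('k, 'z) ring_scheme \<Rightarrow> ('k, 'a) module \<Rightarrow> ('k, 'a) rmod set \<Rightarrow>
      (('k, 'a) rmod set \<Rightarrow>\<^sub>0 int) set \<Rightarrow> ('k, 'a) rmod \<Rightarrow> int" where
  "dim_hom_invariant K A X C = the_elem (dim_hom_free K A X ` C)"

end

theory Submission
  imports Defs "Jordan_Normal_Form.Missing_VectorSpace"
begin

text \<open>
  Write \<open>q\<^sub>R\<close> for \<open>[M] \<mapsto> dim Hom(R, M)\<close>. Rank-nullity shows that every \<open>q\<^sub>R\<close> with \<open>R \<in> X\<close> is additive on the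
  sequences that define the relations of \<open>K\<^sub>0(\<Lambda>, X)\<close>, so \<open>ker p \<subseteq> ker q\<close> (\<open>hdim_rel_subgroup\<close>).

  For the converse, let \<open>G\<close> be the direct sum of the modules in \<open>X\<close> and \<open>\<Gamma> = End(G)\<^sup>o\<^sup>p\<close>. Two facts are
  shown, and both come from finite projective resolutions over \<open>\<Gamma>\<close>.

  The first is that each class in \<open>K\<^sub>0(\<Lambda>, X)\<close> is an integral combination of the classes \<open>[R]\<close> with
  \<open>R \<in> X\<close> (\<open>in_span_cls_of_finite_gl_dim\<close>). Approximate \<open>M\<close> by a module in \<open>add X\<close>, then the kernel, and
  so on. The approximations are onto since \<open>X\<close> contains the indecomposable projectives
  (\<open>approximation_surj\<close>), so each step is a relation. It remains to show that a late kernel \<open>N\<close> lies in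
  \<open>add X\<close>. The resolution \<open>C\<close> in \<open>add X\<close> stays exact under \<open>Hom(R, -)\<close> for \<open>R \<in> X\<close>. Put
  \<open>H L = Hom(L, G)\<close>, a \<open>\<Gamma>\<close>-module which depends contravariantly on \<open>L\<close>. For \<open>C\<close> in \<open>add X\<close> the module
  \<open>H C\<close> is projective, and by Yoneda \<open>Hom\<^sub>\<Gamma>(H C, H L) = Hom(L, C)\<close>. Hence the complex
  \<open>Hom\<^sub>\<Gamma>(H C\<^sub>k, P)\<close> is exact for all projective \<open>P\<close>. Shifting dimensions along a projective resolution
  of \<open>V\<close> of length \<open>n\<close> shows that \<open>Hom\<^sub>\<Gamma>(H C\<^sub>k, V)\<close> is exact in degree \<open>n + 2\<close>
  (\<open>resolution_exact\<close>); this is the vanishing of a Tor above the projective dimension. For \<open>V = H N\<close>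
  with \<open>N \<subseteq> C\<^sub>n\<^sub>+\<^sub>2\<close>, the restriction of maps to \<open>N\<close> is a cycle, hence a boundary, and this yields
  a section of \<open>C\<^sub>n\<^sub>+\<^sub>3 \<rightarrow> N\<close> (\<open>syzygy_id_thru\<close>).

  The second is that the matrix \<open>dim Hom(R', R)\<close> with \<open>R, R' \<in> X\<close> is nonsingular (\<open>coefficients_vanish\<close>).
  Suppose that \<open>\<Sum>\<^sub>R n\<^sub>R dim Hom(R', R) = 0\<close> for all \<open>R'\<close>. With \<open>e\<^sub>R\<close> the idempotent of \<open>\<Gamma>\<close> that belongs to
  \<open>R\<close>, the additive function \<open>V \<mapsto> \<Sum>\<^sub>R n\<^sub>R dim (V e\<^sub>R)\<close> vanishes on every \<open>H R'\<close>, so on all projectives,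
  so on all finite-dimensional \<open>\<Gamma>\<close>-modules. But \<open>H S\<close> has a submodule, its radical, whose dimension
  vector differs from that of \<open>H S\<close> in the place \<open>S\<close> only. So \<open>n\<^sub>S = 0\<close>.

  If now \<open>x\<close> is killed by \<open>q\<close>, write it as a combination of the \<open>[R]\<close> modulo relations. The combination
  is killed by \<open>q\<close> too, so its coefficients vanish, and \<open>x\<close> is a relation.

  Both arguments use that a summand of a sum of modules in \<open>X\<close> decomposes again into modules in \<open>X\<close>.
  This is the Krull-Schmidt theorem; the part of it that is needed is \<open>krull_schmidt_induct\<close>. Membership
  in \<open>add X\<close> is expressed without direct sums: the identity is a sum of maps that factor through
  modules in \<open>X\<close> (\<open>id_thru\<close>). Statements about \<open>add X\<close> are then proved for all such sums of maps, by
  induction on the number of terms.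
\<close>

section \<open>Finite-dimensional vector spaces\<close>

definition fd_space :: "('k, 'z) ring_scheme \<Rightarrow> ('k, 'v) module \<Rightarrow> bool" where
  "fd_space K V \<longleftrightarrow> vectorspace K V \<and> vectorspace.fin_dim K V"

definition klinear :: "('k, 'z) ring_scheme \<Rightarrow> ('k, 'v) module \<Rightarrow> ('k, 'w) module \<Rightarrow> ('v \<Rightarrow> 'w) \<Rightarrow> bool" where
  "klinear K V W T \<longleftrightarrow> T ` carrier V \<subseteq> carrier W \<and>
    (\<forall>x\<in>carrier V. \<forall>y\<in>carrier V. T (x \<oplus>\<^bsub>V\<^esub> y) = T x \<oplus>\<^bsub>W\<^esub> T y) \<and>
    (\<forall>c\<in>carrier K. \<forall>x\<in>carrier V. T (c \<odot>\<^bsub>V\<^esub> x) = c \<odot>\<^bsub>W\<^esub> T x)"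

lemma klinear_imp_linear_map:
  assumes "vectorspace K V" "vectorspace K W" "klinear K V W T"
  shows "linear_map K V W T"
proof -
  interpret V: vectorspace K V by fact
  interpret W: vectorspace K W by fact
  show ?thesis
    using assms(3) by unfold_locales (auto simp: klinear_def module_hom_def)
qed

lemma lin_basis_iff:
  assumes "vectorspace K V"
  shows "lin_basis K V B \<longleftrightarrow> vectorspace.basis K V B"
proof -
  interpret V: vectorspace K V by fact
  have "lin_indep K V B \<longleftrightarrow> V.lin_indpt B"
  proof (intro iffI notI)
    assume i: "lin_indep K V B" and d: "V.lin_dep B"
    from d obtain F c v where "finite F" "F \<subseteq> B" "c \<in> F \<rightarrow> carrier K"
      "V.lincomb c F = \<zero>\<^bsub>V\<^esub>" "v \<in> F" "c v \<noteq> \<zero>\<^bsub>K\<^esub>"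
      unfolding V.lin_dep_def by - (elim exE conjE, rule that, assumption+)
    then show False using i[unfolded lin_indep_def, THEN spec, THEN spec, of F c] unfolding V.lincomb_def by metis
  next
    assume i: "V.lin_indpt B"
    show "lin_indep K V B"
      unfolding lin_indep_def
    proof (intro allI impI ballI, rule ccontr)
      fix F c b
      assume "finite F \<and> F \<subseteq> B \<and> c \<in> F \<rightarrow> carrier K \<and>
        finsum V (\<lambda>b. c b \<odot>\<^bsub>V\<^esub> b) F = \<zero>\<^bsub>V\<^esub>" "b \<in> F" "c b \<noteq> \<zero>\<^bsub>K\<^esub>"
      then show False using i V.lin_dep_crit[of F B c b] unfolding V.lincomb_def by metis
    qed
  qed
  moreover have "lin_span K V B = V.span B"
    unfolding lin_span_def V.span_def V.lincomb_def by (rule refl)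
  ultimately show ?thesis unfolding lin_basis_def V.basis_def by argo
qed

lemma vdim_eq_dim:
  assumes "fd_space K V"
  shows "vdim K V = vectorspace.dim K V"
proof -
  interpret V: vectorspace K V using assms by (simp add: fd_space_def)
  have fd: V.fin_dim using assms by (simp add: fd_space_def)
  then obtain B where "finite B" "V.basis B" using V.finite_basis_exists by auto
  then have "lin_basis K V B" by (simp add: lin_basis_iff V.vectorspace_axioms)
  then have "lin_basis K V (SOME B. lin_basis K V B)" by (rule someI)
  then have b: "V.basis (SOME B. lin_basis K V B)" by (simp add: lin_basis_iff V.vectorspace_axioms)
  then have "finite (SOME B. lin_basis K V B)"
    using V.fin_dim_li_fin[OF fd] by (auto simp: V.basis_def)
  then show ?thesis unfolding vdim_def using V.dim_basis b by metis
qed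

lemma fd_spaceI_span:
  assumes "vectorspace K V" "finite B" "B \<subseteq> carrier V" "lin_span K V B = carrier V"
  shows "fd_space K V"
proof -
  interpret V: vectorspace K V by fact
  have "lin_span K V B = V.span B"
    unfolding lin_span_def V.span_def V.lincomb_def by (rule refl)
  then show ?thesis using assms unfolding fd_space_def V.fin_dim_def by metis
qed

text \<open>
  The generating set is used in this form: a subspace that contains \<open>B\<close> is everything. Arguments about
  all vectors then reduce to \<open>B\<close> as soon as their conclusion defines a subspace.
\<close>

lemma fd_spaceE:
  assumes "fd_space K V"
  obtains B where "finite B" "B \<subseteq> carrier V"
    "\<forall>U. submodule K U V \<and> B \<subseteq> U \<longrightarrow> U = carrier V"
proof -
  interpret V: vectorspace K V using assms by (simp add: fd_space_def)
  obtain B where B: "finite B" "B \<subseteq> carrier V" "V.span B = carrier V"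
    using assms unfolding fd_space_def V.fin_dim_def by metis
  have "U = carrier V" if "submodule K U V" "B \<subseteq> U" for U
    using V.span_is_subset[OF that(2,1)] B(3) submodule.subset[OF that(1)] by simp
  then show thesis using that[OF B(1,2)] by metis
qed

lemma fd_spaceE_lincomb:
  assumes "fd_space K V"
  obtains B where "finite B" "B \<subseteq> carrier V"
    "carrier V = {finsum V (\<lambda>b. c b \<odot>\<^bsub>V\<^esub> b) B | c. c \<in> B \<rightarrow> carrier K}"
proof -
  interpret V: vectorspace K V using assms by (simp add: fd_space_def)
  obtain B where B: "finite B" "B \<subseteq> carrier V" "V.span B = carrier V"
    using assms unfolding fd_space_def V.fin_dim_def by metis
  show thesis
    by (rule that[OF B(1,2)]) (use V.finite_span[OF B(1,2), unfolded B(3) V.lincomb_def] in assumption)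
qed

lemma subspace_vectorspace:
  assumes "vectorspace K V" "submodule K U V"
  shows "vectorspace K (V\<lparr>carrier := U\<rparr>)"
  using assms vectorspace.subspace_is_vs subspace.intro by blast

lemma fd_subspace:
  assumes "fd_space K V" "submodule K U V"
  shows "fd_space K (V\<lparr>carrier := U\<rparr>)"
    and "vdim K (V\<lparr>carrier := U\<rparr>) \<le> vdim K V"
    and "vdim K (V\<lparr>carrier := U\<rparr>) = vdim K V \<Longrightarrow> U = carrier V"
proof -
  interpret V: vectorspace K V using assms by (simp add: fd_space_def)
  have fd: V.fin_dim using assms by (simp add: fd_space_def)
  have UV: "U \<subseteq> carrier V" using submodule.subset[OF assms(2)] .
  interpret U: vectorspace K "V\<lparr>carrier := U\<rparr>"
    using assms(2) V.vectorspace_axioms by (rule subspace_vectorspace[rotated])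
  have li: "U.lin_dep A \<longleftrightarrow> V.lin_dep A" if "A \<subseteq> U" for A
    using V.span_li_not_depend(2)[OF that assms(2)] by simp
  obtain B where B: "finite B" "maximal B (\<lambda>S. S \<subseteq> carrier (V\<lparr>carrier := U\<rparr>) \<and> U.lin_indpt S)"
  proof -
    have "\<exists>B. finite B \<and> maximal B (\<lambda>S. S \<subseteq> carrier (V\<lparr>carrier := U\<rparr>) \<and> U.lin_indpt S)"
    proof (rule maximal_exists[where N = V.dim and B = "{}"])
      show "finite A \<and> card A \<le> V.dim" if "A \<subseteq> carrier (V\<lparr>carrier := U\<rparr>) \<and> U.lin_indpt A" for A
        using that li[of A] V.li_le_dim[OF fd, of A] UV by (metis U.carrier_vs_is_self V.carrier_vs_is_self subset_trans)
      show "{} \<subseteq> carrier (V\<lparr>carrier := U\<rparr>) \<and> U.lin_indpt {}"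
        using U.finite_lin_indpt2[of "{}"] by simp
    qed
    then show thesis using that by metis
  qed
  then have b: "U.basis B" using U.max_li_is_basis by blast
  then have BU: "B \<subseteq> U" "U.lin_indpt B" "U.span B = U" by (auto simp: U.basis_def)
  then have Bli: "V.lin_indpt B" using li by blast
  show fdU: "fd_space K (V\<lparr>carrier := U\<rparr>)"
    unfolding fd_space_def U.fin_dim_def using B(1) BU U.vectorspace_axioms by auto
  have dU: "vdim K (V\<lparr>carrier := U\<rparr>) = card B"
    using vdim_eq_dim[OF fdU] U.dim_basis[OF B(1) b] by simp
  show "vdim K (V\<lparr>carrier := U\<rparr>) \<le> vdim K V"
    using dU vdim_eq_dim[OF assms(1)] V.li_le_dim(2)[OF fd _ Bli] BU UV by auto
  show "U = carrier V" if "vdim K (V\<lparr>carrier := U\<rparr>) = vdim K V"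
  proof -
    have "V.basis B"
      using V.dim_li_is_basis[OF fd B(1) _ Bli] BU UV that dU vdim_eq_dim[OF assms(1)] by auto
    then have "V.span B = carrier V" by (simp add: V.basis_def)
    moreover have "V.span B \<subseteq> U" using V.span_is_subset[OF BU(1) assms(2)] .
    ultimately show ?thesis using UV by auto
  qed
qed

lemma kernel_submodule:
  assumes "vectorspace K V" "vectorspace K W" "klinear K V W T"
  shows "submodule K {x \<in> carrier V. T x = \<zero>\<^bsub>W\<^esub>} V"
proof -
  interpret T: linear_map K V W T using klinear_imp_linear_map[OF assms] .
  show ?thesis using T.ker_is_submodule unfolding T.ker_def .
qed

lemma rank_nullity_vdim:
  assumes V: "fd_space K V" and W: "vectorspace K W" and T: "klinear K V W T"
    and surj: "T ` carrier V = carrier W"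
  shows "fd_space K W"
    and "vdim K V = vdim K W + vdim K (V\<lparr>carrier := {x \<in> carrier V. T x = \<zero>\<^bsub>W\<^esub>}\<rparr>)"
proof -
  have VV: "vectorspace K V" using V by (simp add: fd_space_def)
  interpret T: linear_map K V W T using klinear_imp_linear_map[OF VV W T] .
  have fd: "T.V.fin_dim" using V by (simp add: fd_space_def)
  show fdW: "fd_space K W"
    using T.rank_nullity_main(2)[OF fd surj] W by (simp add: fd_space_def)
  have k: "fd_space K (V\<lparr>carrier := {x \<in> carrier V. T x = \<zero>\<^bsub>W\<^esub>}\<rparr>)"
    using fd_subspace(1)[OF V kernel_submodule[OF VV W T]] .
  show "vdim K V = vdim K W + vdim K (V\<lparr>carrier := {x \<in> carrier V. T x = \<zero>\<^bsub>W\<^esub>}\<rparr>)"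
    using T.rank_nullity_main(1)[OF fd] surj
    unfolding vdim_eq_dim[OF V] vdim_eq_dim[OF fdW] vdim_eq_dim[OF k] T.im_def T.ker_def by simp
qed

lemma linear_image_submodule:
  assumes "vectorspace K V" "vectorspace K W" "klinear K V W T"
  shows "submodule K (T ` carrier V) W"
proof -
  interpret T: linear_map K V W T using klinear_imp_linear_map[OF assms] .
  show ?thesis using T.im_is_submodule unfolding T.im_def .
qed

text \<open>
  Generators of the kernel together with preimages of generators of the image generate \<open>V\<close>.
\<close>

lemma fd_extension:
  assumes V: "vectorspace K V" and W: "fd_space K W" and T: "klinear K V W T"
    and ker: "fd_space K (V\<lparr>carrier := {x \<in> carrier V. T x = \<zero>\<^bsub>W\<^esub>}\<rparr>)"
  shows "fd_space K V"
proof -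
  let ?k = "{x \<in> carrier V. T x = \<zero>\<^bsub>W\<^esub>}"
  have WW: "vectorspace K W" using W by (simp add: fd_space_def)
  interpret V: vectorspace K V by (rule V)
  interpret W: vectorspace K W by (rule WW)
  interpret T: linear_map K V W T using klinear_imp_linear_map[OF V WW T] .
  let ?I = "T ` carrier V"
  have I: "fd_space K (W\<lparr>carrier := ?I\<rparr>)"
    using fd_subspace(1)[OF W linear_image_submodule[OF V WW T]] .
  obtain B where B: "finite B" "B \<subseteq> carrier (V\<lparr>carrier := ?k\<rparr>)" 
    "\<forall>U. submodule K U (V\<lparr>carrier := ?k\<rparr>) \<and> B \<subseteq> U \<longrightarrow> U = carrier (V\<lparr>carrier := ?k\<rparr>)"
    by (rule fd_spaceE[OF ker])
  note B = B[unfolded V.carrier_vs_is_self]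
  obtain C where C: "finite C" "C \<subseteq> carrier (W\<lparr>carrier := ?I\<rparr>)"
    "\<forall>U. submodule K U (W\<lparr>carrier := ?I\<rparr>) \<and> C \<subseteq> U \<longrightarrow> U = carrier (W\<lparr>carrier := ?I\<rparr>)"
    by (rule fd_spaceE[OF I])
  note C = C[unfolded W.carrier_vs_is_self]
  obtain D where D: "finite D" "D \<subseteq> carrier V" "C = T ` D"
    using C(1,2) by (meson finite_subset_image)
  let ?S = "V.span (B \<union> D)"
  have BD: "B \<union> D \<subseteq> carrier V" using B D by auto
  have sub: "submodule K ?S V" using V.span_is_submodule[OF BD] .
  have own: "B \<union> D \<subseteq> ?S" using V.in_own_span[OF BD] .
  have kS: "?k \<inter> ?S = ?k"
  proof (rule B(3)[rule_format], rule conjI)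
    show "submodule K (?k \<inter> ?S) (V\<lparr>carrier := ?k\<rparr>)"
      using sub kernel_submodule[OF V WW T] subspace_vectorspace[OF V kernel_submodule[OF V WW T]]
      unfolding submodule_def by (auto simp: vectorspace_def)
    show "B \<subseteq> ?k \<inter> ?S" using B own by auto
  qed
  have TS: "T ` ?S = ?I"
  proof (rule C(3)[rule_format], rule conjI)
    show "submodule K (T ` ?S) (W\<lparr>carrier := ?I\<rparr>)"
    proof -
      have "Module.module K (W\<lparr>carrier := ?I\<rparr>)" using I by (simp add: fd_space_def vectorspace_def)
      moreover have "?S \<subseteq> carrier V" using submodule.subset[OF sub] .
      moreover have "T x \<oplus>\<^bsub>W\<^esub> T y \<in> T ` ?S" if "x \<in> ?S" "y \<in> ?S" for x y
        using that sub submodule.m_closed[OF sub that] \<open>?S \<subseteq> carrier V\<close>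
        by (metis T.T_add image_eqI subsetD)
      moreover have "c \<odot>\<^bsub>W\<^esub> T x \<in> T ` ?S" if "x \<in> ?S" "c \<in> carrier K" for x c
        using that submodule.smult_closed[OF sub that(2,1)] \<open>?S \<subseteq> carrier V\<close>
        by (metis T.T_smult image_eqI subsetD)
      moreover have "\<zero>\<^bsub>W\<^esub> \<in> T ` ?S"
        using submodule.zero_closed[OF sub] T.T0_is_0 by (metis image_eqI)
      ultimately show ?thesis unfolding submodule_def by auto
    qed
    show "C \<subseteq> T ` ?S" using own D by auto
  qed
  have k: "?k \<subseteq> ?S" using kS by (rule inf.absorb_iff1[THEN iffD2])
  have im: "\<exists>u\<in>?S. T u = T v" if "v \<in> carrier V" for v
    using imageI[of v "carrier V" T, OF that, folded TS] by (metis imageE)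
  have "carrier V \<subseteq> ?S"
  proof
    fix v assume v: "v \<in> carrier V"
    then obtain u where u: "u \<in> ?S" "T u = T v" using im by blast
    then have uV: "u \<in> carrier V" using submodule.subset[OF sub] by auto
    have "v \<oplus>\<^bsub>V\<^esub> (\<ominus>\<^bsub>K\<^esub> \<one>\<^bsub>K\<^esub> \<odot>\<^bsub>V\<^esub> u) \<in> ?k"
    proof -
      have "T (v \<oplus>\<^bsub>V\<^esub> (\<ominus>\<^bsub>K\<^esub> \<one>\<^bsub>K\<^esub> \<odot>\<^bsub>V\<^esub> u)) = T v \<oplus>\<^bsub>W\<^esub> (\<ominus>\<^bsub>K\<^esub> \<one>\<^bsub>K\<^esub> \<odot>\<^bsub>W\<^esub> T v)"
        using v uV u by simp
      also have "\<dots> = \<zero>\<^bsub>W\<^esub>" using v W.smult_l_minus T.T_im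
        by (metis W.M.r_neg W.smult_one V.one_closed)
      finally show ?thesis using v uV by simp
    qed
    then have "v \<oplus>\<^bsub>V\<^esub> (\<ominus>\<^bsub>K\<^esub> \<one>\<^bsub>K\<^esub> \<odot>\<^bsub>V\<^esub> u) \<in> ?S" using k by blast
    then have "(v \<oplus>\<^bsub>V\<^esub> (\<ominus>\<^bsub>K\<^esub> \<one>\<^bsub>K\<^esub> \<odot>\<^bsub>V\<^esub> u)) \<oplus>\<^bsub>V\<^esub> u \<in> ?S" using submodule.m_closed[OF sub _ u(1)] by blast
    moreover have "(v \<oplus>\<^bsub>V\<^esub> (\<ominus>\<^bsub>K\<^esub> \<one>\<^bsub>K\<^esub> \<odot>\<^bsub>V\<^esub> u)) \<oplus>\<^bsub>V\<^esub> u = v"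
      using v uV V.smult_l_minus[of "\<one>\<^bsub>K\<^esub>" u] by (simp add: V.M.a_assoc V.M.l_neg)
    ultimately show "v \<in> ?S" by simp
  qed
  then have "?S = carrier V" using submodule.subset[OF sub] by auto
  then show ?thesis unfolding fd_space_def V.fin_dim_def
    using V B(1) D(1) BD by (metis finite_UnI)
qed

lemma submodule_Int:
  assumes "submodule K U V" "submodule K U' V"
  shows "submodule K (U \<inter> U') V"
  using assms unfolding submodule_def by auto

text \<open>
  Splitting off one map at a time shrinks the space to the common kernel \<open>0\<close>, and each step is an
  extension by a finite-dimensional image. Direct sums (through their projections) and spaces of
  homomorphisms (through evaluation at generators) are finite-dimensional for this reason.
\<close>

lemma fd_joint_kernel:
  fixes V :: "('k, 'v) module" and W :: "'i \<Rightarrow> ('k, 'w) module"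
  assumes "finite I" and "vectorspace K V"
    and "\<And>i. i \<in> I \<Longrightarrow> fd_space K (W i)"
    and "\<And>i. i \<in> I \<Longrightarrow> klinear K V (W i) (T i)"
    and "\<And>x. \<lbrakk>x \<in> carrier V; \<And>i. i \<in> I \<Longrightarrow> T i x = \<zero>\<^bsub>W i\<^esub>\<rbrakk> \<Longrightarrow> x = \<zero>\<^bsub>V\<^esub>"
  shows "fd_space K V"
  using assms
proof (induction arbitrary: V rule: finite_induct)
  case empty
  interpret V: vectorspace K V by fact
  have c: "carrier V = {\<zero>\<^bsub>V\<^esub>}" using empty(4) V.zero_closed by auto
  have "V.span {} = {\<zero>\<^bsub>V\<^esub>}" by (rule V.span_empty)
  then have "V.fin_dim" unfolding V.fin_dim_def using c by (intro exI[of _ "{}"]) auto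
  then show ?case using V.vectorspace_axioms by (simp add: fd_space_def)
next
  case (insert j J)
  have Wj: "vectorspace K (W j)" using insert.prems(2)[of j] by (simp add: fd_space_def)
  have Tj: "klinear K V (W j) (T j)" using insert.prems by simp
  let ?k = "{x \<in> carrier V. T j x = \<zero>\<^bsub>W j\<^esub>}"
  have sub: "submodule K ?k V" using kernel_submodule[OF insert.prems(1) Wj Tj] .
  have vs: "vectorspace K (V\<lparr>carrier := ?k\<rparr>)" using subspace_vectorspace[OF insert.prems(1) sub] .
  have "fd_space K (V\<lparr>carrier := ?k\<rparr>)"
  proof (rule insert.IH[OF vs])
    show "fd_space K (W i)" if "i \<in> J" for i using that insert.prems by blast
    show "klinear K (V\<lparr>carrier := ?k\<rparr>) (W i) (T i)" if "i \<in> J" for i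
      using insert.prems(3)[of i] that unfolding klinear_def by auto
    show "x = \<zero>\<^bsub>V\<lparr>carrier := ?k\<rparr>\<^esub>" 
      if "x \<in> carrier (V\<lparr>carrier := ?k\<rparr>)" "\<And>i. i \<in> J \<Longrightarrow> T i x = \<zero>\<^bsub>W i\<^esub>" for x
      using insert.prems(4)[of x] that by auto
  qed
  then show ?case using fd_extension[OF insert.prems(1) _ Tj] insert.prems(2)[of j] by simp
qed

lemma vdim_iso:
  assumes V: "fd_space K V" and W: "vectorspace K W" and T: "klinear K V W T"
    and bij: "bij_betw T (carrier V) (carrier W)"
  shows "fd_space K W" and "vdim K W = vdim K V"
proof -
  have VV: "vectorspace K V" using V by (simp add: fd_space_def)
  interpret T: linear_map K V W T using klinear_imp_linear_map[OF VV W T] .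
  have s: "T ` carrier V = carrier W" and i: "inj_on T (carrier V)" using bij by (auto simp: bij_betw_def)
  have fd: T.V.fin_dim using V by (simp add: fd_space_def)
  show W': "fd_space K W" using rank_nullity_vdim(1)[OF V W T s] .
  show "vdim K W = vdim K V"
    using T.dim_eq[OF fd i s] by (simp add: vdim_eq_dim V W')
qed

lemma fd_inj_imp_surj:
  assumes V: "fd_space K V" and T: "klinear K V V T" and inj: "inj_on T (carrier V)"
  shows "T ` carrier V = carrier V"
proof -
  have VV: "vectorspace K V" using V by (simp add: fd_space_def)
  interpret T: linear_map K V V T using klinear_imp_linear_map[OF VV VV T] .
  have sub: "submodule K (T ` carrier V) V" using linear_image_submodule[OF VV VV T] .
  have "klinear K V (V\<lparr>carrier := T ` carrier V\<rparr>) T" using T unfolding klinear_def by auto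
  then have "vdim K (V\<lparr>carrier := T ` carrier V\<rparr>) = vdim K V"
    using vdim_iso(2)[OF V subspace_vectorspace[OF VV sub]] inj by (simp add: bij_betw_def)
  then show ?thesis using fd_subspace(3)[OF V sub] by simp
qed

lemma fd_surj_imp_inj:
  assumes V: "fd_space K V" and T: "klinear K V V T" and surj: "T ` carrier V = carrier V"
  shows "inj_on T (carrier V)"
proof -
  have VV: "vectorspace K V" using V by (simp add: fd_space_def)
  interpret T: linear_map K V V T using klinear_imp_linear_map[OF VV VV T] .
  let ?k = "{x \<in> carrier V. T x = \<zero>\<^bsub>V\<^esub>}"
  have sub: "submodule K ?k V" using kernel_submodule[OF VV VV T] .
  have "vdim K (V\<lparr>carrier := ?k\<rparr>) = 0" using rank_nullity_vdim(2)[OF V VV T surj] by simp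
  moreover have fd: "fd_space K (V\<lparr>carrier := ?k\<rparr>)" using fd_subspace(1)[OF V sub] .
  ultimately have "vectorspace.dim K (V\<lparr>carrier := ?k\<rparr>) = 0" by (simp add: vdim_eq_dim)
  interpret k: vectorspace K "V\<lparr>carrier := ?k\<rparr>" using fd by (simp add: fd_space_def)
  obtain B where B: "finite B" "k.basis B" using k.finite_basis_exists fd by (auto simp: fd_space_def)
  then have "card B = 0" using k.dim_basis \<open>vectorspace.dim K (V\<lparr>carrier := ?k\<rparr>) = 0\<close> by simp
  then have "B = {}" using B by simp
  then have "?k = {\<zero>\<^bsub>V\<^esub>}" using B(2) k.span_empty by (auto simp: k.basis_def)
  then show ?thesis using T.Ke0_imp_inj unfolding T.ker_def by simp
qed

section \<open>Right modules over a ring\<close>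

text \<open>
  Negatives come from the action of \<open>-1\<close>.
\<close>

lemma right_moduleI:
  fixes A :: "('a, 'r) ring_scheme" and M :: "('a, 'm) module"
  assumes "ring A"
    and "\<zero>\<^bsub>M\<^esub> \<in> carrier M"
    and "\<And>x y. \<lbrakk>x \<in> carrier M; y \<in> carrier M\<rbrakk> \<Longrightarrow> x \<oplus>\<^bsub>M\<^esub> y \<in> carrier M"
    and "\<And>x y z. \<lbrakk>x \<in> carrier M; y \<in> carrier M; z \<in> carrier M\<rbrakk> \<Longrightarrow>
      (x \<oplus>\<^bsub>M\<^esub> y) \<oplus>\<^bsub>M\<^esub> z = x \<oplus>\<^bsub>M\<^esub> (y \<oplus>\<^bsub>M\<^esub> z)"
    and "\<And>x y. \<lbrakk>x \<in> carrier M; y \<in> carrier M\<rbrakk> \<Longrightarrow> x \<oplus>\<^bsub>M\<^esub> y = y \<oplus>\<^bsub>M\<^esub> x"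
    and "\<And>x. x \<in> carrier M \<Longrightarrow> \<zero>\<^bsub>M\<^esub> \<oplus>\<^bsub>M\<^esub> x = x"
    and "\<And>x. x \<in> carrier M \<Longrightarrow> (\<ominus>\<^bsub>A\<^esub> \<one>\<^bsub>A\<^esub>) \<odot>\<^bsub>M\<^esub> x \<oplus>\<^bsub>M\<^esub> x = \<zero>\<^bsub>M\<^esub>"
    and "\<And>a x. \<lbrakk>a \<in> carrier A; x \<in> carrier M\<rbrakk> \<Longrightarrow> a \<odot>\<^bsub>M\<^esub> x \<in> carrier M"
    and "\<And>a b x. \<lbrakk>a \<in> carrier A; b \<in> carrier A; x \<in> carrier M\<rbrakk> \<Longrightarrow>
      (a \<oplus>\<^bsub>A\<^esub> b) \<odot>\<^bsub>M\<^esub> x = a \<odot>\<^bsub>M\<^esub> x \<oplus>\<^bsub>M\<^esub> b \<odot>\<^bsub>M\<^esub> x"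
    and "\<And>a x y. \<lbrakk>a \<in> carrier A; x \<in> carrier M; y \<in> carrier M\<rbrakk> \<Longrightarrow>
      a \<odot>\<^bsub>M\<^esub> (x \<oplus>\<^bsub>M\<^esub> y) = a \<odot>\<^bsub>M\<^esub> x \<oplus>\<^bsub>M\<^esub> a \<odot>\<^bsub>M\<^esub> y"
    and "\<And>a b x. \<lbrakk>a \<in> carrier A; b \<in> carrier A; x \<in> carrier M\<rbrakk> \<Longrightarrow>
      b \<odot>\<^bsub>M\<^esub> (a \<odot>\<^bsub>M\<^esub> x) = (a \<otimes>\<^bsub>A\<^esub> b) \<odot>\<^bsub>M\<^esub> x"
    and "\<And>x. x \<in> carrier M \<Longrightarrow> \<one>\<^bsub>A\<^esub> \<odot>\<^bsub>M\<^esub> x = x"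
  shows "right_module A M"
proof -
  interpret A: ring A by fact
  have "\<exists>y\<in>carrier M. y \<oplus>\<^bsub>M\<^esub> x = \<zero>\<^bsub>M\<^esub>" if "x \<in> carrier M" for x
    using assms(7,8) that by (intro bexI[of _ "(\<ominus>\<^bsub>A\<^esub> \<one>\<^bsub>A\<^esub>) \<odot>\<^bsub>M\<^esub> x"]) simp_all
  then have "abelian_group M"
    using assms(2-6) by (intro abelian_groupI) simp_all
  then show ?thesis
    unfolding right_module_def right_module_axioms_def using assms by simp
qed

lemma (in right_module) act_zero_ring:
  assumes "x \<in> carrier M" shows "\<zero>\<^bsub>R\<^esub> \<odot>\<^bsub>M\<^esub> x = \<zero>\<^bsub>M\<^esub>"
proof -
  have "\<zero>\<^bsub>R\<^esub> \<odot>\<^bsub>M\<^esub> x \<oplus>\<^bsub>M\<^esub> \<zero>\<^bsub>R\<^esub> \<odot>\<^bsub>M\<^esub> x = \<zero>\<^bsub>R\<^esub> \<odot>\<^bsub>M\<^esub> x"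
    using act_add_ring[of "\<zero>\<^bsub>R\<^esub>" "\<zero>\<^bsub>R\<^esub>" x] assms by simp
  then show ?thesis using act_closed assms R.zero_closed
    by (metis M.add.r_cancel_one)
qed

lemma (in right_module) act_zero:
  assumes "a \<in> carrier R" shows "a \<odot>\<^bsub>M\<^esub> \<zero>\<^bsub>M\<^esub> = \<zero>\<^bsub>M\<^esub>"
proof -
  have "a \<odot>\<^bsub>M\<^esub> \<zero>\<^bsub>M\<^esub> \<oplus>\<^bsub>M\<^esub> a \<odot>\<^bsub>M\<^esub> \<zero>\<^bsub>M\<^esub> = a \<odot>\<^bsub>M\<^esub> \<zero>\<^bsub>M\<^esub>"
    using act_add[of a "\<zero>\<^bsub>M\<^esub>" "\<zero>\<^bsub>M\<^esub>"] assms by simp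
  then show ?thesis using act_closed assms M.zero_closed
    by (metis M.add.r_cancel_one)
qed

lemma (in right_module) act_minus_one:
  assumes "x \<in> carrier M" shows "(\<ominus>\<^bsub>R\<^esub> \<one>\<^bsub>R\<^esub>) \<odot>\<^bsub>M\<^esub> x = \<ominus>\<^bsub>M\<^esub> x"
proof -
  have "(\<ominus>\<^bsub>R\<^esub> \<one>\<^bsub>R\<^esub>) \<odot>\<^bsub>M\<^esub> x \<oplus>\<^bsub>M\<^esub> x = \<zero>\<^bsub>M\<^esub>"
    using act_add_ring[of "\<ominus>\<^bsub>R\<^esub> \<one>\<^bsub>R\<^esub>" "\<one>\<^bsub>R\<^esub>" x] assms
    by (simp add: R.l_neg act_one act_zero_ring)
  then show ?thesis using assms by (intro M.minus_equality[symmetric]) (simp_all add: act_closed)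
qed

lemma (in right_module) l_minus_one:
  assumes "x \<in> carrier M" shows "(\<ominus>\<^bsub>R\<^esub> \<one>\<^bsub>R\<^esub>) \<odot>\<^bsub>M\<^esub> x \<oplus>\<^bsub>M\<^esub> x = \<zero>\<^bsub>M\<^esub>"
  using assms by (simp add: act_minus_one M.l_neg)

lemma (in right_module) r_minus_one:
  assumes "x \<in> carrier M" shows "x \<oplus>\<^bsub>M\<^esub> (\<ominus>\<^bsub>R\<^esub> \<one>\<^bsub>R\<^esub>) \<odot>\<^bsub>M\<^esub> x = \<zero>\<^bsub>M\<^esub>"
  using assms by (simp add: act_minus_one M.r_neg)

subsection \<open>Homomorphisms\<close>

lemma HomI:
  assumes "f \<in> extensional (carrier M)"
    and "\<And>x. x \<in> carrier M \<Longrightarrow> f x \<in> carrier N"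
    and "\<And>x y. \<lbrakk>x \<in> carrier M; y \<in> carrier M\<rbrakk> \<Longrightarrow> f (x \<oplus>\<^bsub>M\<^esub> y) = f x \<oplus>\<^bsub>N\<^esub> f y"
    and "\<And>a x. \<lbrakk>a \<in> carrier A; x \<in> carrier M\<rbrakk> \<Longrightarrow> f (a \<odot>\<^bsub>M\<^esub> x) = a \<odot>\<^bsub>N\<^esub> f x"
  shows "f \<in> Hom A M N"
  using assms unfolding Hom_def PiE_def by simp

lemma restrict_HomI:
  assumes "right_module A M"
    and "\<And>x. x \<in> carrier M \<Longrightarrow> f x \<in> carrier N"
    and "\<And>x y. \<lbrakk>x \<in> carrier M; y \<in> carrier M\<rbrakk> \<Longrightarrow> f (x \<oplus>\<^bsub>M\<^esub> y) = f x \<oplus>\<^bsub>N\<^esub> f y"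
    and "\<And>a x. \<lbrakk>a \<in> carrier A; x \<in> carrier M\<rbrakk> \<Longrightarrow> f (a \<odot>\<^bsub>M\<^esub> x) = a \<odot>\<^bsub>N\<^esub> f x"
  shows "restrict f (carrier M) \<in> Hom A M N"
proof -
  interpret M: right_module A M by fact
  show ?thesis using assms(2-) by (intro HomI) (simp_all add: M.act_closed)
qed

lemma Hom_closed: "f \<in> Hom A M N \<Longrightarrow> x \<in> carrier M \<Longrightarrow> f x \<in> carrier N"
  unfolding Hom_def by auto

lemma Hom_add:
  "f \<in> Hom A M N \<Longrightarrow> x \<in> carrier M \<Longrightarrow> y \<in> carrier M \<Longrightarrow> f (x \<oplus>\<^bsub>M\<^esub> y) = f x \<oplus>\<^bsub>N\<^esub> f y"
  unfolding Hom_def by simp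

lemma Hom_act:
  "f \<in> Hom A M N \<Longrightarrow> a \<in> carrier A \<Longrightarrow> x \<in> carrier M \<Longrightarrow> f (a \<odot>\<^bsub>M\<^esub> x) = a \<odot>\<^bsub>N\<^esub> f x"
  unfolding Hom_def by simp

lemma Hom_extensional: "f \<in> Hom A M N \<Longrightarrow> f \<in> extensional (carrier M)"
  unfolding Hom_def PiE_def by simp

lemma Hom_eqI:
  assumes "f \<in> Hom A M N" "g \<in> Hom A M N'" "\<And>x. x \<in> carrier M \<Longrightarrow> f x = g x"
  shows "f = g"
  using assms Hom_extensional extensionalityI by metis

lemma Hom_zero:
  assumes "f \<in> Hom A M N" "right_module A M" "right_module A N"
  shows "f \<zero>\<^bsub>M\<^esub> = \<zero>\<^bsub>N\<^esub>"
proof -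
  interpret M: right_module A M by fact
  interpret N: right_module A N by fact
  show ?thesis using Hom_act[OF assms(1) M.R.zero_closed M.M.zero_closed] Hom_closed[OF assms(1) M.M.zero_closed]
    by (simp add: M.act_zero_ring N.act_zero_ring)
qed

lemma Hom_minus:
  assumes "f \<in> Hom A M N" "right_module A M" "right_module A N" "x \<in> carrier M"
  shows "f (\<ominus>\<^bsub>M\<^esub> x) = \<ominus>\<^bsub>N\<^esub> f x"
proof -
  interpret M: right_module A M by fact
  interpret N: right_module A N by fact
  show ?thesis using Hom_act[OF assms(1) _ assms(4), of "\<ominus>\<^bsub>A\<^esub> \<one>\<^bsub>A\<^esub>"] assms(4) Hom_closed[OF assms(1,4)]
    by (simp add: M.act_minus_one N.act_minus_one)
qed

lemma Hom_sub:
  assumes "f \<in> Hom A M N" "right_module A M" "right_module A N" "x \<in> carrier M" "y \<in> carrier M"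
  shows "f (x \<ominus>\<^bsub>M\<^esub> y) = f x \<ominus>\<^bsub>N\<^esub> f y"
proof -
  interpret M: right_module A M by fact
  show ?thesis using assms by (simp add: a_minus_def Hom_add Hom_minus)
qed

lemma Hom_inj_onI:
  assumes "f \<in> Hom A M N" "right_module A M" "right_module A N"
    and "\<And>x. \<lbrakk>x \<in> carrier M; f x = \<zero>\<^bsub>N\<^esub>\<rbrakk> \<Longrightarrow> x = \<zero>\<^bsub>M\<^esub>"
  shows "inj_on f (carrier M)"
proof (rule inj_onI)
  interpret M: right_module A M by fact
  interpret N: right_module A N by fact
  fix x y assume xy: "x \<in> carrier M" "y \<in> carrier M" "f x = f y"
  have "f (x \<ominus>\<^bsub>M\<^esub> y) = \<zero>\<^bsub>N\<^esub>" using Hom_sub[OF assms(1-3) xy(1,2)] xy Hom_closed[OF assms(1)]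
    by (simp add: N.M.r_neg a_minus_def)
  then have "x \<ominus>\<^bsub>M\<^esub> y = \<zero>\<^bsub>M\<^esub>" using assms(4) xy by simp
  then show "x = y" using xy(1,2) M.M.minus_equality[of x "\<ominus>\<^bsub>M\<^esub> y"] by (simp add: a_minus_def)
qed

lemma Hom_comp:
  assumes "f \<in> Hom A M N" "g \<in> Hom A N L" "right_module A M"
  shows "compose (carrier M) g f \<in> Hom A M L"
proof -
  interpret M: right_module A M by fact
  show ?thesis using assms(1,2)
    by (intro HomI) (simp_all add: compose_def Hom_closed Hom_add Hom_act M.act_closed)
qed

lemma Hom_id: "right_module A M \<Longrightarrow> (\<lambda>x\<in>carrier M. x) \<in> Hom A M M"
  by (rule restrict_HomI) auto

lemma Hom_plus:
  assumes "f \<in> Hom A M N" "g \<in> Hom A M N" "right_module A M" "right_module A N"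
  shows "(\<lambda>x\<in>carrier M. f x \<oplus>\<^bsub>N\<^esub> g x) \<in> Hom A M N"
proof -
  interpret N: right_module A N by fact
  show ?thesis using assms
    by (intro restrict_HomI) (simp_all add: Hom_closed Hom_add Hom_act N.act_add N.M.a_ac)
qed

lemma Hom_zero_map:
  assumes "right_module A M" "right_module A N"
  shows "(\<lambda>x\<in>carrier M. \<zero>\<^bsub>N\<^esub>) \<in> Hom A M N"
proof -
  interpret N: right_module A N by fact
  show ?thesis using assms by (intro restrict_HomI) (simp_all add: N.act_zero)
qed

lemma Hom_uminus:
  assumes "f \<in> Hom A M N" "right_module A M" "right_module A N"
  shows "(\<lambda>x\<in>carrier M. \<ominus>\<^bsub>N\<^esub> f x) \<in> Hom A M N"
proof -
  interpret M: right_module A M by fact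
  interpret N: right_module A N by fact
  have "a \<odot>\<^bsub>N\<^esub> (\<ominus>\<^bsub>N\<^esub> y) = \<ominus>\<^bsub>N\<^esub> (a \<odot>\<^bsub>N\<^esub> y)" if "a \<in> carrier A" "y \<in> carrier N" for a y
  proof -
    have "a \<odot>\<^bsub>N\<^esub> (\<ominus>\<^bsub>N\<^esub> y) \<oplus>\<^bsub>N\<^esub> a \<odot>\<^bsub>N\<^esub> y = \<zero>\<^bsub>N\<^esub>"
      using that by (simp add: N.act_add[symmetric] N.M.l_neg N.act_zero)
    then show ?thesis using that by (intro N.M.minus_equality[symmetric]) (simp_all add: N.act_closed)
  qed
  then show ?thesis using assms
    by (intro restrict_HomI) (simp_all add: Hom_closed Hom_add Hom_act N.M.minus_add N.M.a_comm)
qed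

lemma Hom_diff:
  assumes "f \<in> Hom A M N" "g \<in> Hom A M N" "right_module A M" "right_module A N"
  shows "(\<lambda>x\<in>carrier M. f x \<ominus>\<^bsub>N\<^esub> g x) \<in> Hom A M N"
proof -
  interpret N: right_module A N by fact
  have "(\<lambda>x\<in>carrier M. f x \<oplus>\<^bsub>N\<^esub> (\<lambda>x\<in>carrier M. \<ominus>\<^bsub>N\<^esub> g x) x) \<in> Hom A M N"
    by (rule Hom_plus[OF assms(1) Hom_uminus[OF assms(2-4)] assms(3,4)])
  moreover have "(\<lambda>x\<in>carrier M. f x \<oplus>\<^bsub>N\<^esub> (\<lambda>x\<in>carrier M. \<ominus>\<^bsub>N\<^esub> g x) x) = (\<lambda>x\<in>carrier M. f x \<ominus>\<^bsub>N\<^esub> g x)"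
    by (rule restrict_ext) (simp add: a_minus_def)
  ultimately show ?thesis by metis
qed

lemma Hom_inverse:
  assumes "f \<in> Hom A M N" "right_module A M" "right_module A N" "bij_betw f (carrier M) (carrier N)"
  obtains g where "g \<in> Hom A N M" "bij_betw g (carrier N) (carrier M)"
    "\<forall>x\<in>carrier M. g (f x) = x" "\<forall>y\<in>carrier N. f (g y) = y"
proof -
  interpret M: right_module A M by fact
  interpret N: right_module A N by fact
  let ?g = "restrict (inv_into (carrier M) f) (carrier N)"
  have gf: "?g (f x) = x" if "x \<in> carrier M" for x
    using that assms(4) Hom_closed[OF assms(1) that] by (simp add: bij_betw_def)
  have fg: "f (?g y) = y" if "y \<in> carrier N" for y
    using that assms(4) by (simp add: bij_betw_inv_into_right)
  have gc: "?g y \<in> carrier M" if "y \<in> carrier N" for y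
    using that assms(4) by (metis bij_betw_def inv_into_into restrict_apply')
  have "?g \<in> Hom A N M"
  proof (rule HomI)
    fix x y assume xy: "x \<in> carrier N" "y \<in> carrier N"
    have "?g (f (?g x \<oplus>\<^bsub>M\<^esub> ?g y)) = ?g x \<oplus>\<^bsub>M\<^esub> ?g y" using gc[OF xy(1)] gc[OF xy(2)] by (intro gf) blast
    moreover have "f (?g x \<oplus>\<^bsub>M\<^esub> ?g y) = x \<oplus>\<^bsub>N\<^esub> y"
      using Hom_add[OF assms(1) gc[OF xy(1)] gc[OF xy(2)]] fg xy by metis
    ultimately show "?g (x \<oplus>\<^bsub>N\<^esub> y) = ?g x \<oplus>\<^bsub>M\<^esub> ?g y" by metis
  next
    fix a x assume ax: "a \<in> carrier A" "x \<in> carrier N"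
    have "?g (f (a \<odot>\<^bsub>M\<^esub> ?g x)) = a \<odot>\<^bsub>M\<^esub> ?g x" using gc[OF ax(2)] M.act_closed ax by (intro gf) blast
    moreover have "f (a \<odot>\<^bsub>M\<^esub> ?g x) = a \<odot>\<^bsub>N\<^esub> x"
      using Hom_act[OF assms(1) ax(1) gc[OF ax(2)]] fg ax by metis
    ultimately show "?g (a \<odot>\<^bsub>N\<^esub> x) = a \<odot>\<^bsub>M\<^esub> ?g x" by metis
  qed (use gc in simp_all)
  moreover have "bij_betw ?g (carrier N) (carrier M)"
    by (rule bij_betw_byWitness[where f' = f]) (use gf fg gc Hom_closed[OF assms(1)] in auto)
  moreover have "\<forall>x\<in>carrier M. ?g (f x) = x" "\<forall>y\<in>carrier N. f (?g y) = y"
    using gf fg by blast+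
  ultimately show thesis by (rule that)
qed

lemma isomorphic_refl: "right_module A M \<Longrightarrow> isomorphic A M M"
  unfolding isomorphic_def by (rule bexI[OF _ Hom_id]) (auto simp: bij_betw_def inj_on_def)

lemma isomorphic_sym:
  assumes "isomorphic A M N" "right_module A M" "right_module A N"
  shows "isomorphic A N M"
  using assms Hom_inverse unfolding isomorphic_def by metis

lemma isomorphic_trans:
  assumes "isomorphic A M N" "isomorphic A N L" "right_module A M"
  shows "isomorphic A M L"
proof -
  obtain f g where f: "f \<in> Hom A M N" "bij_betw f (carrier M) (carrier N)"
    and g: "g \<in> Hom A N L" "bij_betw g (carrier N) (carrier L)"
    using assms unfolding isomorphic_def by blast
  have "bij_betw (compose (carrier M) g f) (carrier M) (carrier L)"
    using bij_betw_trans[OF f(2) g(2)] by (subst bij_betw_cong[where g = "g \<circ> f"]) (simp_all add: compose_def)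
  then show ?thesis unfolding isomorphic_def using Hom_comp[OF f(1) g(1) assms(3)] by blast
qed

subsection \<open>Submodules, kernels and images\<close>

definition subm :: "('a, 'r) ring_scheme \<Rightarrow> ('a, 'm) module \<Rightarrow> 'm set \<Rightarrow> bool" where
  "subm A M U \<longleftrightarrow> U \<subseteq> carrier M \<and> \<zero>\<^bsub>M\<^esub> \<in> U \<and> (\<forall>x\<in>U. \<forall>y\<in>U. x \<oplus>\<^bsub>M\<^esub> y \<in> U) \<and>
    (\<forall>a\<in>carrier A. \<forall>x\<in>U. a \<odot>\<^bsub>M\<^esub> x \<in> U)"

lemma right_module_sub:
  assumes "right_module A M" "subm A M U"
  shows "right_module A (M\<lparr>carrier := U\<rparr>)"
proof -
  interpret M: right_module A M by fact
  have U: "\<And>x. x \<in> U \<Longrightarrow> x \<in> carrier M" using assms(2) by (auto simp: subm_def)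
  show ?thesis using assms(2) U
    by (intro right_moduleI)
       (auto simp: subm_def M.M.a_ac M.r_minus_one M.act_add_ring M.act_add M.act_assoc M.act_one M.R.ring_axioms)
qed

lemma subm_mker:
  assumes "f \<in> Hom A M N" "right_module A M" "right_module A N"
  shows "subm A M (mker M N f)"
proof -
  interpret M: right_module A M by fact
  interpret N: right_module A N by fact
  show ?thesis using assms Hom_zero[OF assms]
    unfolding subm_def mker_def by (auto simp: Hom_add Hom_act M.act_closed N.act_zero)
qed

lemma subm_image:
  assumes "f \<in> Hom A M N" "right_module A M" "right_module A N"
  shows "subm A N (f ` carrier M)"
proof -
  interpret M: right_module A M by fact
  interpret N: right_module A N by fact
  show ?thesis unfolding subm_def
  proof (intro conjI ballI)
    show "f ` carrier M \<subseteq> carrier N" using Hom_closed[OF assms(1)] by blast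
    show "\<zero>\<^bsub>N\<^esub> \<in> f ` carrier M" using Hom_zero[OF assms] by (metis M.M.zero_closed image_eqI)
    show "x \<oplus>\<^bsub>N\<^esub> y \<in> f ` carrier M" if "x \<in> f ` carrier M" "y \<in> f ` carrier M" for x y
      using that Hom_add[OF assms(1)] by (metis (no_types, lifting) M.M.a_closed image_iff)
    show "a \<odot>\<^bsub>N\<^esub> x \<in> f ` carrier M" if "a \<in> carrier A" "x \<in> f ` carrier M" for a x
      using that Hom_act[OF assms(1)] by (metis (no_types, lifting) M.act_closed image_iff)
  qed
qed

lemma Hom_inclusion:
  assumes "subm A M U"
  shows "(\<lambda>x\<in>U. x) \<in> Hom A (M\<lparr>carrier := U\<rparr>) M"
  using assms unfolding subm_def by (intro HomI) auto

lemma Hom_restrict: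
  assumes "f \<in> Hom A M N" "subm A M U"
  shows "restrict f U \<in> Hom A (M\<lparr>carrier := U\<rparr>) N"
  using assms unfolding subm_def by (intro HomI) (auto simp: Hom_closed Hom_add Hom_act subsetD)

lemma Hom_corestrict:
  assumes "f \<in> Hom A M N" "f ` carrier M \<subseteq> U"
  shows "f \<in> Hom A M (N\<lparr>carrier := U\<rparr>)"
  using assms by (intro HomI) (auto simp: Hom_extensional Hom_add Hom_act)

lemma Hom_expand:
  assumes "f \<in> Hom A M (N\<lparr>carrier := U\<rparr>)" "U \<subseteq> carrier N"
  shows "f \<in> Hom A M N"
  using assms Hom_closed[OF assms(1)]
  by (intro HomI) (auto simp: Hom_extensional Hom_add Hom_act)

subsection \<open>Direct sums\<close>

lemma dsum_simps [simp]:
  "carrier (dsum M N) = carrier M \<times> carrier N"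
  "\<zero>\<^bsub>dsum M N\<^esub> = (\<zero>\<^bsub>M\<^esub>, \<zero>\<^bsub>N\<^esub>)"
  "(x, y) \<oplus>\<^bsub>dsum M N\<^esub> (x', y') = (x \<oplus>\<^bsub>M\<^esub> x', y \<oplus>\<^bsub>N\<^esub> y')"
  "a \<odot>\<^bsub>dsum M N\<^esub> (x, y) = (a \<odot>\<^bsub>M\<^esub> x, a \<odot>\<^bsub>N\<^esub> y)"
  by (simp_all add: dsum_def)

lemma right_module_dsum:
  assumes "right_module A M" "right_module A N"
  shows "right_module A (dsum M N)"
proof -
  interpret M: right_module A M by fact
  interpret N: right_module A N by fact
  show ?thesis
    by (rule right_moduleI)
       (auto simp: M.M.a_ac N.M.a_ac M.r_minus_one N.r_minus_one M.act_add_ring N.act_add_ring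
          M.act_add N.act_add M.act_assoc N.act_assoc M.act_one N.act_one M.R.ring_axioms
          M.act_closed N.act_closed)
qed

lemma Hom_dsum:
  assumes "right_module A M" "right_module A N"
  shows "(\<lambda>x\<in>carrier M. (x, \<zero>\<^bsub>N\<^esub>)) \<in> Hom A M (dsum M N)"
    and "(\<lambda>y\<in>carrier N. (\<zero>\<^bsub>M\<^esub>, y)) \<in> Hom A N (dsum M N)"
    and "(\<lambda>z\<in>carrier (dsum M N). fst z) \<in> Hom A (dsum M N) M"
    and "(\<lambda>z\<in>carrier (dsum M N). snd z) \<in> Hom A (dsum M N) N"
proof -
  interpret M: right_module A M by fact
  interpret N: right_module A N by fact
  note r = right_module_dsum[OF assms]
  show "(\<lambda>x\<in>carrier M. (x, \<zero>\<^bsub>N\<^esub>)) \<in> Hom A M (dsum M N)"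
    using assms by (intro restrict_HomI) (auto simp: N.act_zero)
  show "(\<lambda>y\<in>carrier N. (\<zero>\<^bsub>M\<^esub>, y)) \<in> Hom A N (dsum M N)"
    using assms by (intro restrict_HomI) (auto simp: M.act_zero)
  show "(\<lambda>z\<in>carrier (dsum M N). fst z) \<in> Hom A (dsum M N) M"
    using r by (intro restrict_HomI) auto
  show "(\<lambda>z\<in>carrier (dsum M N). snd z) \<in> Hom A (dsum M N) N"
    using r by (intro restrict_HomI) auto
qed

lemma dsum_fam_simps [simp]:
  "carrier (dsum_fam I M) = (\<Pi>\<^sub>E i\<in>I. carrier (M i))"
  "\<zero>\<^bsub>dsum_fam I M\<^esub> = (\<lambda>i\<in>I. \<zero>\<^bsub>M i\<^esub>)"
  "x \<oplus>\<^bsub>dsum_fam I M\<^esub> y = (\<lambda>i\<in>I. x i \<oplus>\<^bsub>M i\<^esub> y i)"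
  "a \<odot>\<^bsub>dsum_fam I M\<^esub> x = (\<lambda>i\<in>I. a \<odot>\<^bsub>M i\<^esub> x i)"
  by (simp_all add: dsum_fam_def)

lemma right_module_dsum_fam:
  assumes "ring A" "\<And>i. i \<in> I \<Longrightarrow> right_module A (M i)"
  shows "right_module A (dsum_fam I M)"
proof -
  have g: "abelian_group (M i)" if "i \<in> I" for i
    using assms(2)[OF that] by (simp add: right_module_def)
  have z: "\<zero>\<^bsub>M i\<^esub> \<in> carrier (M i)" if "i \<in> I" for i
    using g[OF that] by (simp add: abelian_group_def abelian_monoid.zero_closed)
  note am = abelian_group.axioms(1)[OF g]
  show ?thesis
    using assms(1)
    by (intro right_moduleI)
      (auto intro!: restrict_ext z extensionalityI[of _ I]
        simp: PiE_iff abelian_monoid.a_closed[OF am] right_module.act_closed[OF assms(2)] abelian_monoid.a_assoc[OF am] 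
        abelian_monoid.a_comm[OF am] abelian_monoid.a_lcomm[OF am] abelian_monoid.l_zero[OF am] right_module.r_minus_one[OF assms(2)] right_module.l_minus_one[OF assms(2)]
        right_module.act_add_ring[OF assms(2)] right_module.act_add[OF assms(2)] right_module.act_assoc[OF assms(2)]
        right_module.act_one[OF assms(2)])
qed

lemma Hom_dsum_fam:
  assumes "ring A" "\<And>i. i \<in> I \<Longrightarrow> right_module A (M i)" "j \<in> I"
  shows "(\<lambda>x\<in>carrier (dsum_fam I M). x j) \<in> Hom A (dsum_fam I M) (M j)"
    and "(\<lambda>x\<in>carrier (M j). (\<lambda>i\<in>I. if i = j then x else \<zero>\<^bsub>M i\<^esub>)) \<in> Hom A (M j) (dsum_fam I M)"
proof -
  have g: "abelian_group (M i)" if "i \<in> I" for i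
    using assms(2)[OF that] by (simp add: right_module_def)
  have z: "\<zero>\<^bsub>M i\<^esub> \<in> carrier (M i)" if "i \<in> I" for i
    using g[OF that] by (simp add: abelian_group_def abelian_monoid.zero_closed)
  note am = abelian_group.axioms(1)[OF g]
  show "(\<lambda>x\<in>carrier (dsum_fam I M). x j) \<in> Hom A (dsum_fam I M) (M j)"
    using assms right_module_dsum_fam[OF assms(1,2)] by (intro restrict_HomI) auto
  show "(\<lambda>x\<in>carrier (M j). (\<lambda>i\<in>I. if i = j then x else \<zero>\<^bsub>M i\<^esub>)) \<in> Hom A (M j) (dsum_fam I M)"
    using assms
    by (intro restrict_HomI) (auto intro!: restrict_ext simp: z abelian_monoid.l_zero[OF am] right_module.act_zero[OF assms(2)])
qed

section \<open>Modules over a finite-dimensional algebra\<close>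

lemma underlying_space_simps [simp]:
  "carrier (underlying_space A M) = carrier M"
  "\<zero>\<^bsub>underlying_space A M\<^esub> = \<zero>\<^bsub>M\<^esub>"
  "x \<oplus>\<^bsub>underlying_space A M\<^esub> y = x \<oplus>\<^bsub>M\<^esub> y"
  "c \<odot>\<^bsub>underlying_space A M\<^esub> x = (c \<odot>\<^bsub>A\<^esub> \<one>\<^bsub>A\<^esub>) \<odot>\<^bsub>M\<^esub> x"
  "underlying_space A (M\<lparr>carrier := U\<rparr>) = (underlying_space A M)\<lparr>carrier := U\<rparr>"
  by (simp_all add: underlying_space_def)

lemma finsum_underlying_space: "finsum (underlying_space A M) = finsum M"
  by (intro ext) (simp add: finsum_def finprod_def underlying_space_def)

lemma hom_space_simps [simp]:
  "carrier (hom_space A M N) = Hom A M N"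
  "\<zero>\<^bsub>hom_space A M N\<^esub> = (\<lambda>x\<in>carrier M. \<zero>\<^bsub>N\<^esub>)"
  "f \<oplus>\<^bsub>hom_space A M N\<^esub> g = (\<lambda>x\<in>carrier M. f x \<oplus>\<^bsub>N\<^esub> g x)"
  "c \<odot>\<^bsub>hom_space A M N\<^esub> f = (\<lambda>x\<in>carrier M. (c \<odot>\<^bsub>A\<^esub> \<one>\<^bsub>A\<^esub>) \<odot>\<^bsub>N\<^esub> f x)"
  by (simp_all add: hom_space_def)

lemma (in abelian_monoid) finsum_in_closed_set:
  assumes "finite S" "U \<subseteq> carrier G" "\<zero> \<in> U" "\<And>x y. \<lbrakk>x \<in> U; y \<in> U\<rbrakk> \<Longrightarrow> x \<oplus> y \<in> U"
    and "\<And>s. s \<in> S \<Longrightarrow> f s \<in> U"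
  shows "finsum G f S \<in> U"
  using assms(1,5)
proof (induction S rule: finite_induct)
  case (insert s S)
  then have "finsum G f (insert s S) = f s \<oplus> finsum G f S"
    using assms(2) by (intro finsum_insert) auto
  then show ?case using insert assms(4) by simp
qed (use assms(3) in simp)

text \<open>
  Transport of structure; it serves to move a module to the carrier type \<open>nat \<Rightarrow> 'k\<close> of the objects of
  \<open>mod A\<close>.
\<close>

lemma right_module_transport:
  fixes R :: "('a, 'r) ring_scheme" and M :: "('a, 'm) module" and \<phi> :: "'m \<Rightarrow> 'n"
  assumes "right_module R M" "inj_on \<phi> (carrier M)"
  shows "\<exists>N :: ('a, 'n) module. right_module R N \<and> isomorphic R M N"
proof -
  interpret right_module R M by fact
  let ?\<psi> = "inv_into (carrier M) \<phi>"
  define N :: "('a, 'n) module" where "N = \<lparr>carrier = \<phi> ` carrier M, mult = undefined, one = undefined,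
     ring.zero = \<phi> \<zero>\<^bsub>M\<^esub>, add = (\<lambda>u v. \<phi> (?\<psi> u \<oplus>\<^bsub>M\<^esub> ?\<psi> v)), smult = (\<lambda>a u. \<phi> (a \<odot>\<^bsub>M\<^esub> ?\<psi> u))\<rparr>"
  have [simp]: "carrier N = \<phi> ` carrier M" "\<zero>\<^bsub>N\<^esub> = \<phi> \<zero>\<^bsub>M\<^esub>" by (simp_all add: N_def)
  have [simp]: "\<phi> x \<oplus>\<^bsub>N\<^esub> \<phi> y = \<phi> (x \<oplus>\<^bsub>M\<^esub> y)" if "x \<in> carrier M" "y \<in> carrier M" for x y
    using that assms(2) by (simp add: N_def)
  have [simp]: "a \<odot>\<^bsub>N\<^esub> \<phi> x = \<phi> (a \<odot>\<^bsub>M\<^esub> x)" if "x \<in> carrier M" for a x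
    using that assms(2) by (simp add: N_def)
  have "right_module R N"
    by (rule right_moduleI)
      (auto simp: act_closed M.a_ac r_minus_one act_add_ring act_add act_assoc act_one R.ring_axioms)
  moreover have "restrict \<phi> (carrier M) \<in> Hom R M N"
    using right_module_axioms by (intro restrict_HomI) simp_all
  moreover have "bij_betw (restrict \<phi> (carrier M)) (carrier M) (carrier N)"
    using assms(2) by (simp add: bij_betw_def)
  ultimately have "right_module R N \<and> isomorphic R M N" unfolding isomorphic_def by fast
  then show ?thesis by (rule exI)
qed

context fd_algebra
begin

abbreviation US :: "('a, 'm) module \<Rightarrow> ('k, 'm) module" where
  "US M \<equiv> underlying_space A M"

lemma fd_algebra_space: "fd_space K A"
proof -
  have "vectorspace K A" by unfold_locales
  then show ?thesis using finite_dim fd_spaceI_span by blast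
qed

lemma scalar_closed: "c \<in> carrier K \<Longrightarrow> c \<odot>\<^bsub>A\<^esub> \<one>\<^bsub>A\<^esub> \<in> carrier A"
  by simp

lemma scalar_mult_left: "\<lbrakk>c \<in> carrier K; a \<in> carrier A\<rbrakk> \<Longrightarrow> (c \<odot>\<^bsub>A\<^esub> \<one>\<^bsub>A\<^esub>) \<otimes>\<^bsub>A\<^esub> a = c \<odot>\<^bsub>A\<^esub> a"
  by (simp add: smult_mult_left)

lemma scalar_mult_right: "\<lbrakk>c \<in> carrier K; a \<in> carrier A\<rbrakk> \<Longrightarrow> a \<otimes>\<^bsub>A\<^esub> (c \<odot>\<^bsub>A\<^esub> \<one>\<^bsub>A\<^esub>) = c \<odot>\<^bsub>A\<^esub> a"
  by (simp add: smult_mult_right)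

lemma scalar_act_commute:
  assumes "right_module A M" "c \<in> carrier K" "a \<in> carrier A" "x \<in> carrier M"
  shows "a \<odot>\<^bsub>M\<^esub> ((c \<odot>\<^bsub>A\<^esub> \<one>\<^bsub>A\<^esub>) \<odot>\<^bsub>M\<^esub> x) = (c \<odot>\<^bsub>A\<^esub> \<one>\<^bsub>A\<^esub>) \<odot>\<^bsub>M\<^esub> (a \<odot>\<^bsub>M\<^esub> x)"
  using assms by (simp add: right_module.act_assoc[OF assms(1)] scalar_mult_left scalar_mult_right)

lemma vectorspace_US:
  assumes "right_module A M"
  shows "vectorspace K (US M)"
proof -
  interpret M: right_module A M by fact
  have "\<exists>y\<in>carrier M. x \<oplus>\<^bsub>M\<^esub> y = \<zero>\<^bsub>M\<^esub>" if "x \<in> carrier M" for x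
    using M.M.r_neg[OF that] that by (intro bexI[of _ "\<ominus>\<^bsub>M\<^esub> x"]) simp_all
  moreover have "((a \<otimes>\<^bsub>K\<^esub> b) \<odot>\<^bsub>A\<^esub> \<one>\<^bsub>A\<^esub>) \<odot>\<^bsub>M\<^esub> v = (a \<odot>\<^bsub>A\<^esub> \<one>\<^bsub>A\<^esub>) \<odot>\<^bsub>M\<^esub> ((b \<odot>\<^bsub>A\<^esub> \<one>\<^bsub>A\<^esub>) \<odot>\<^bsub>M\<^esub> v)"
    if "a \<in> carrier K" "b \<in> carrier K" "v \<in> carrier M" for a b v
    using that by (simp add: M.act_assoc scalar_mult_right smult_assoc1)
  moreover have "((a \<oplus>\<^bsub>K\<^esub> b) \<odot>\<^bsub>A\<^esub> \<one>\<^bsub>A\<^esub>) \<odot>\<^bsub>M\<^esub> v = (a \<odot>\<^bsub>A\<^esub> \<one>\<^bsub>A\<^esub>) \<odot>\<^bsub>M\<^esub> v \<oplus>\<^bsub>M\<^esub> (b \<odot>\<^bsub>A\<^esub> \<one>\<^bsub>A\<^esub>) \<odot>\<^bsub>M\<^esub> v"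
    if "a \<in> carrier K" "b \<in> carrier K" "v \<in> carrier M" for a b v
    using that by (simp add: smult_l_distr M.act_add_ring)
  ultimately show ?thesis
    by (intro vs_criteria) (simp_all add: M.act_closed M.act_add M.act_one M.M.a_ac field_axioms)
qed

lemma submodule_US:
  assumes "right_module A M" "subm A M U"
  shows "submodule K U (US M)"
  using assms(2) vectorspace_US[OF assms(1)] unfolding submodule_def vectorspace_def subm_def by auto

lemma klinear_Hom:
  assumes "f \<in> Hom A M N"
  shows "klinear K (US M) (US N) f"
  using assms unfolding klinear_def by (auto simp: Hom_closed Hom_add Hom_act)

lemma vectorspace_hom_space:
  assumes M: "right_module A M" and N: "right_module A N"
  shows "vectorspace K (hom_space A M N)"
proof -
  interpret M: right_module A M by fact
  interpret N: right_module A N by fact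
  have s: "(\<lambda>x\<in>carrier M. (c \<odot>\<^bsub>A\<^esub> \<one>\<^bsub>A\<^esub>) \<odot>\<^bsub>N\<^esub> f x) \<in> Hom A M N" if "c \<in> carrier K" "f \<in> Hom A M N" for c f
    using that M N by (intro restrict_HomI) (simp_all add: Hom_closed Hom_add Hom_act N.act_closed N.act_add scalar_act_commute)
  have neg: "\<exists>g\<in>Hom A M N. (\<lambda>x\<in>carrier M. f x \<oplus>\<^bsub>N\<^esub> g x) = (\<lambda>x\<in>carrier M. \<zero>\<^bsub>N\<^esub>)" if "f \<in> Hom A M N" for f
    using that Hom_uminus[OF that M N]
    by (intro bexI[of _ "\<lambda>x\<in>carrier M. \<ominus>\<^bsub>N\<^esub> f x"]) (auto intro!: restrict_ext simp: Hom_closed N.M.r_neg)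
  have c: "((a \<otimes>\<^bsub>K\<^esub> b) \<odot>\<^bsub>A\<^esub> \<one>\<^bsub>A\<^esub>) \<odot>\<^bsub>N\<^esub> v = (a \<odot>\<^bsub>A\<^esub> \<one>\<^bsub>A\<^esub>) \<odot>\<^bsub>N\<^esub> ((b \<odot>\<^bsub>A\<^esub> \<one>\<^bsub>A\<^esub>) \<odot>\<^bsub>N\<^esub> v)"
    if "a \<in> carrier K" "b \<in> carrier K" "v \<in> carrier N" for a b v
    using that by (simp add: N.act_assoc scalar_mult_right smult_assoc1)
  have d: "((a \<oplus>\<^bsub>K\<^esub> b) \<odot>\<^bsub>A\<^esub> \<one>\<^bsub>A\<^esub>) \<odot>\<^bsub>N\<^esub> v = (a \<odot>\<^bsub>A\<^esub> \<one>\<^bsub>A\<^esub>) \<odot>\<^bsub>N\<^esub> v \<oplus>\<^bsub>N\<^esub> (b \<odot>\<^bsub>A\<^esub> \<one>\<^bsub>A\<^esub>) \<odot>\<^bsub>N\<^esub> v"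
    if "a \<in> carrier K" "b \<in> carrier K" "v \<in> carrier N" for a b v
    using that by (simp add: smult_l_distr N.act_add_ring)
  show ?thesis
  proof (rule vs_criteria)
    show "\<forall>v\<in>carrier (hom_space A M N). v \<oplus>\<^bsub>hom_space A M N\<^esub> \<zero>\<^bsub>hom_space A M N\<^esub> = v"
      by (auto intro!: extensionalityI[of _ "carrier M"] simp: Hom_extensional Hom_closed)
    show "\<forall>v\<in>carrier (hom_space A M N). \<one>\<^bsub>K\<^esub> \<odot>\<^bsub>hom_space A M N\<^esub> v = v"
      by (auto intro!: extensionalityI[of _ "carrier M"] simp: Hom_extensional Hom_closed N.act_one)
    show "\<forall>f\<in>carrier (hom_space A M N). \<exists>g\<in>carrier (hom_space A M N).
        f \<oplus>\<^bsub>hom_space A M N\<^esub> g = \<zero>\<^bsub>hom_space A M N\<^esub>"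
      using neg by simp
  qed (auto intro!: restrict_ext s Hom_plus[OF _ _ M N] Hom_zero_map[OF M N]
      simp: Hom_closed c d N.act_add N.M.a_ac field_axioms)
qed

text \<open>
  The objects of \<open>mod A\<close> up to isomorphism, on any carrier type: direct sums, spaces of homomorphisms
  and the modules \<open>H N\<close> below do not live on functions \<open>nat \<Rightarrow> 'k\<close>.
\<close>

definition fdmod :: "('a, 'm) module \<Rightarrow> bool" where
  "fdmod M \<longleftrightarrow> right_module A M \<and> fd_space K (US M)"

lemma fdmodD: "fdmod M \<Longrightarrow> right_module A M" "fdmod M \<Longrightarrow> fd_space K (US M)"
  by (simp_all add: fdmod_def)

text \<open>
  If \<open>B\<close> spans \<open>A\<close> over \<open>K\<close> and \<open>S\<close> generates \<open>M\<close> over \<open>A\<close>, the products \<open>s b\<close> span \<open>M\<close> over \<open>K\<close>.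
\<close>

lemma fin_gen_imp_fdmod:
  assumes M: "right_module A M" and "fin_gen A M"
  shows "fdmod M"
proof -
  interpret M: right_module A M by fact
  interpret US: vectorspace K "US M" using vectorspace_US[OF M] .
  obtain S where S: "finite S" "S \<subseteq> carrier M"
      "carrier M = {finsum M (\<lambda>s. c s \<odot>\<^bsub>M\<^esub> s) S | c. c \<in> S \<rightarrow> carrier A}"
    using assms(2) unfolding fin_gen_def by blast
  obtain B where B: "finite B" "B \<subseteq> carrier A" "\<forall>U. submodule K U A \<and> B \<subseteq> U \<longrightarrow> U = carrier A"
    by (rule fd_spaceE[OF fd_algebra_space])
  define F where "F = (\<lambda>(b, s). b \<odot>\<^bsub>M\<^esub> s) ` (B \<times> S)"
  have F: "finite F" "F \<subseteq> carrier (US M)"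
    using B(1,2) S(1,2) M.act_closed by (auto simp: F_def)
  let ?U = "US.span F"
  have U: "submodule K ?U (US M)" using US.span_is_submodule[OF F(2)] .
  have own: "F \<subseteq> ?U" using US.in_own_span[OF F(2)] .
  have aS: "a \<odot>\<^bsub>M\<^esub> s \<in> ?U" if "a \<in> carrier A" "s \<in> S" for a s
  proof -
    have s: "s \<in> carrier M" using that S by blast
    have "{a \<in> carrier A. a \<odot>\<^bsub>M\<^esub> s \<in> ?U} = carrier A"
    proof (rule B(3)[rule_format], rule conjI)
      have "(c \<odot>\<^bsub>A\<^esub> a) \<odot>\<^bsub>M\<^esub> s = c \<odot>\<^bsub>US M\<^esub> (a \<odot>\<^bsub>M\<^esub> s)" if "c \<in> carrier K" "a \<in> carrier A" for c a
        using that s by (simp add: M.act_assoc scalar_mult_right)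
      moreover have "\<zero>\<^bsub>A\<^esub> \<odot>\<^bsub>M\<^esub> s \<in> ?U"
        using submodule.zero_closed[OF U] s by (simp add: M.act_zero_ring)
      moreover have "(a \<oplus>\<^bsub>A\<^esub> b) \<odot>\<^bsub>M\<^esub> s \<in> ?U"
        if "a \<in> carrier A" "b \<in> carrier A" "a \<odot>\<^bsub>M\<^esub> s \<in> ?U" "b \<odot>\<^bsub>M\<^esub> s \<in> ?U" for a b
        using submodule.m_closed[OF U that(3,4)] that s by (simp add: M.act_add_ring)
      ultimately show "submodule K {a \<in> carrier A. a \<odot>\<^bsub>M\<^esub> s \<in> ?U} A"
        using submodule.smult_closed[OF U] module_axioms unfolding submodule_def by simp
      show "B \<subseteq> {a \<in> carrier A. a \<odot>\<^bsub>M\<^esub> s \<in> ?U}" using B(2) own that(2) by (auto simp: F_def)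
    qed
    then show ?thesis using that by blast
  qed
  have sub: "?U \<subseteq> carrier M" using submodule.subset[OF U] by simp
  have "finsum M (\<lambda>s. c s \<odot>\<^bsub>M\<^esub> s) S \<in> ?U" if "c \<in> S \<rightarrow> carrier A" for c
  proof (rule M.M.finsum_in_closed_set[OF S(1) sub])
    show "\<zero>\<^bsub>M\<^esub> \<in> ?U" using submodule.zero_closed[OF U] by simp
    show "x \<oplus>\<^bsub>M\<^esub> y \<in> ?U" if "x \<in> ?U" "y \<in> ?U" for x y using submodule.m_closed[OF U that] by simp
    show "c s \<odot>\<^bsub>M\<^esub> s \<in> ?U" if "s \<in> S" for s using aS that \<open>c \<in> S \<rightarrow> carrier A\<close> by blast
  qed
  then have "?U = carrier M" using S(3) sub by auto
  then show ?thesis unfolding fdmod_def fd_space_def US.fin_dim_def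
    using M F US.vectorspace_axioms by auto
qed

lemma fdmod_imp_fin_gen:
  assumes "fdmod M"
  shows "fin_gen A M"
proof -
  obtain B where B: "finite B" "B \<subseteq> carrier (US M)"
    "carrier (US M) = {finsum (US M) (\<lambda>b. c b \<odot>\<^bsub>US M\<^esub> b) B | c. c \<in> B \<rightarrow> carrier K}"
    by (rule fd_spaceE_lincomb[OF fdmodD(2)[OF assms]])
  interpret M: right_module A M using fdmodD(1)[OF assms] .
  have "carrier M = {finsum M (\<lambda>s. c s \<odot>\<^bsub>M\<^esub> s) B | c. c \<in> B \<rightarrow> carrier A}"
  proof (intro equalityI subsetI)
    fix x assume "x \<in> carrier M"
    then obtain c where c: "c \<in> B \<rightarrow> carrier K" "x = finsum M (\<lambda>b. (c b \<odot>\<^bsub>A\<^esub> \<one>\<^bsub>A\<^esub>) \<odot>\<^bsub>M\<^esub> b) B"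
      using B(3) by (auto simp: finsum_underlying_space)
    then show "x \<in> {finsum M (\<lambda>s. c s \<odot>\<^bsub>M\<^esub> s) B | c. c \<in> B \<rightarrow> carrier A}"
      by (intro CollectI exI[of _ "\<lambda>b. c b \<odot>\<^bsub>A\<^esub> \<one>\<^bsub>A\<^esub>"]) auto
  next
    fix x assume "x \<in> {finsum M (\<lambda>s. c s \<odot>\<^bsub>M\<^esub> s) B | c. c \<in> B \<rightarrow> carrier A}"
    then show "x \<in> carrier M" using B(2) by (auto intro!: M.M.finsum_closed M.act_closed)
  qed
  then show ?thesis unfolding fin_gen_def using B(1,2) by auto
qed

lemma fg_modules_iff: "M \<in> fg_modules A \<longleftrightarrow> fdmod M"
  unfolding fg_modules_def using fin_gen_imp_fdmod fdmod_imp_fin_gen fdmodD by auto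

lemma fdmod_sub:
  assumes "fdmod M" "subm A M U"
  shows "fdmod (M\<lparr>carrier := U\<rparr>)"
  using fd_subspace(1)[OF fdmodD(2)[OF assms(1)] submodule_US[OF fdmodD(1)[OF assms(1)] assms(2)]]
    right_module_sub[OF fdmodD(1)[OF assms(1)] assms(2)]
  by (simp add: fdmod_def)

lemma fdmod_iso:
  assumes "isomorphic A M N" "fdmod M" "right_module A N"
  shows "fdmod N" and "vdim K (US N) = vdim K (US M)"
proof -
  obtain f where f: "f \<in> Hom A M N" "bij_betw f (carrier M) (carrier N)"
    using assms(1) unfolding isomorphic_def by blast
  note i = vdim_iso[OF fdmodD(2)[OF assms(2)] vectorspace_US[OF assms(3)] klinear_Hom[OF f(1)]]
  show "fdmod N" using i(1) f(2) assms(3) by (simp add: fdmod_def)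
  show "vdim K (US N) = vdim K (US M)" using i(2) f(2) by simp
qed

text \<open>
  An element is determined by any choice of coordinates with respect to a finite spanning set. Numbering
  the spanning set turns the coordinates into a function \<open>nat \<Rightarrow> 'k\<close>.
\<close>

lemma fg_representative:
  assumes "fdmod M"
  obtains N where "N \<in> fg_modules A" "isomorphic A M N"
proof -
  interpret M: right_module A M using fdmodD(1)[OF assms] .
  obtain B where B: "finite B" "B \<subseteq> carrier (US M)"
    "carrier (US M) = {finsum (US M) (\<lambda>b. c b \<odot>\<^bsub>US M\<^esub> b) B | c. c \<in> B \<rightarrow> carrier K}"
    by (rule fd_spaceE_lincomb[OF fdmodD(2)[OF assms]])
  obtain e :: "_ \<Rightarrow> nat" where e: "inj_on e B" using finite_imp_inj_to_nat_seg[OF B(1)] by (elim exE conjE)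
  have "\<exists>d. x = finsum M (\<lambda>b. (d (e b) \<odot>\<^bsub>A\<^esub> \<one>\<^bsub>A\<^esub>) \<odot>\<^bsub>M\<^esub> b) B" if "x \<in> carrier M" for x
  proof -
    have "\<exists>c. x = finsum M (\<lambda>b. (c b \<odot>\<^bsub>A\<^esub> \<one>\<^bsub>A\<^esub>) \<odot>\<^bsub>M\<^esub> b) B \<and> c \<in> B \<rightarrow> carrier K"
      using that unfolding B(3)[unfolded finsum_underlying_space underlying_space_simps] by (rule CollectD)
    then obtain c where c: "x = finsum M (\<lambda>b. (c b \<odot>\<^bsub>A\<^esub> \<one>\<^bsub>A\<^esub>) \<odot>\<^bsub>M\<^esub> b) B" "c \<in> B \<rightarrow> carrier K"
      by (elim exE conjE)
    have "finsum M (\<lambda>b. (c (inv_into B e (e b)) \<odot>\<^bsub>A\<^esub> \<one>\<^bsub>A\<^esub>) \<odot>\<^bsub>M\<^esub> b) B = x"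
      unfolding c(1)
      by (rule M.M.finsum_cong') (use c(2) B(2) e in \<open>auto intro!: M.act_closed\<close>)
    then show ?thesis by (intro exI[of _ "\<lambda>i. c (inv_into B e i)"]) simp
  qed
  then obtain d where d: "\<And>x. x \<in> carrier M \<Longrightarrow> x = finsum M (\<lambda>b. (d x (e b) \<odot>\<^bsub>A\<^esub> \<one>\<^bsub>A\<^esub>) \<odot>\<^bsub>M\<^esub> b) B"
    by metis
  have "inj_on d (carrier M)" by (rule inj_onI) (metis d)
  then have "\<exists>N :: ('k, 'a) rmod. right_module A N \<and> isomorphic A M N"
    by (rule right_module_transport[OF M.right_module_axioms])
  then obtain N :: "('k, 'a) rmod" where N: "right_module A N" "isomorphic A M N" by (elim exE conjE)
  show thesis by (rule that[OF _ N(2)]) (simp add: fg_modules_iff fdmod_iso(1)[OF N(2) assms N(1)])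
qed

lemma fdmod_dsum:
  assumes M: "fdmod M" and N: "fdmod N"
  shows "fdmod (dsum M N)"
proof -
  note MN = fdmodD(1)[OF M] fdmodD(1)[OF N]
  note d = right_module_dsum[OF MN]
  interpret M: right_module A M using fdmodD(1)[OF M] .
  interpret N: right_module A N using fdmodD(1)[OF N] .
  let ?p = "\<lambda>z\<in>carrier (dsum M N). fst z" and ?i = "\<lambda>y\<in>carrier N. (\<zero>\<^bsub>M\<^esub>, y)"
  have k: "mker (dsum M N) M ?p = {\<zero>\<^bsub>M\<^esub>} \<times> carrier N" by (auto simp: mker_def)
  have "?i \<in> Hom A N ((dsum M N)\<lparr>carrier := {\<zero>\<^bsub>M\<^esub>} \<times> carrier N\<rparr>)"
    by (rule Hom_corestrict[OF Hom_dsum(2)[OF MN]]) auto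
  moreover have "bij_betw ?i (carrier N) (carrier ((dsum M N)\<lparr>carrier := {\<zero>\<^bsub>M\<^esub>} \<times> carrier N\<rparr>))"
    by (auto simp: bij_betw_def inj_on_def)
  ultimately have "isomorphic A N ((dsum M N)\<lparr>carrier := {\<zero>\<^bsub>M\<^esub>} \<times> carrier N\<rparr>)"
    unfolding isomorphic_def by metis
  then have "fdmod ((dsum M N)\<lparr>carrier := mker (dsum M N) M ?p\<rparr>)"
    using fdmod_iso(1)[OF _ N] right_module_sub[OF d subm_mker[OF Hom_dsum(3)[OF MN] d MN(1)]]
    unfolding k by metis
  then show ?thesis
    using fd_extension[OF vectorspace_US[OF d] fdmodD(2)[OF M] klinear_Hom[OF Hom_dsum(3)[OF MN]]] d
    by (simp add: fdmod_def mker_def)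
qed

lemma fdmod_dsum_fam:
  assumes "finite I" "\<And>i. i \<in> I \<Longrightarrow> fdmod (M i)"
  shows "fdmod (dsum_fam I M)"
proof -
  have r: "right_module A (dsum_fam I M)"
    using right_module_dsum_fam[OF A.ring_axioms] fdmodD(1)[OF assms(2)] .
  have "fd_space K (US (dsum_fam I M))"
  proof (rule fd_joint_kernel[OF assms(1) vectorspace_US[OF r], where W = "\<lambda>i. US (M i)"
        and T = "\<lambda>i. (\<lambda>x\<in>carrier (dsum_fam I M). x i)"])
    show "fd_space K (US (M i))" if "i \<in> I" for i using assms(2)[OF that] fdmodD by blast
    show "klinear K (US (dsum_fam I M)) (US (M i)) (\<lambda>x\<in>carrier (dsum_fam I M). x i)" if "i \<in> I" for i
      by (rule klinear_Hom[OF Hom_dsum_fam(1)[OF A.ring_axioms fdmodD(1)[OF assms(2)] that]])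
  qed (auto intro!: extensionalityI[of _ I] simp: PiE_def)
  then show ?thesis using r by (simp add: fdmod_def)
qed

text \<open>
  A homomorphism is determined by its values on a finite spanning set of \<open>M\<close>.
\<close>

lemma fd_hom_space:
  assumes M: "fdmod M" and N: "fdmod N"
  shows "fd_space K (hom_space A M N)"
proof -
  note MN = fdmodD(1)[OF M] fdmodD(1)[OF N]
  obtain B where B: "finite B" "B \<subseteq> carrier (US M)"
    "\<forall>U. submodule K U (US M) \<and> B \<subseteq> U \<longrightarrow> U = carrier (US M)"
    by (rule fd_spaceE[OF fdmodD(2)[OF M]])
  show ?thesis
  proof (rule fd_joint_kernel[OF B(1) vectorspace_hom_space[OF MN], where W = "\<lambda>_. US N" and T = "\<lambda>b f. f b"])
    show "fd_space K (US N)" by (rule fdmodD(2)[OF N])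
    show "klinear K (hom_space A M N) (US N) (\<lambda>f. f b)" if "b \<in> B" for b
      using that B(2) unfolding klinear_def by (auto simp: Hom_closed)
    show "f = \<zero>\<^bsub>hom_space A M N\<^esub>" if "f \<in> carrier (hom_space A M N)" "\<And>b. b \<in> B \<Longrightarrow> f b = \<zero>\<^bsub>US N\<^esub>" for f
    proof -
      have f: "f \<in> Hom A M N" using that by simp
      have "mker M N f = carrier M"
        using B(3)[rule_format, of "mker M N f"] submodule_US[OF MN(1) subm_mker[OF f MN]] B(2) that(2)
        by (auto simp: mker_def)
      then show ?thesis using f by (auto intro!: Hom_eqI[OF f Hom_zero_map[OF MN]] simp: mker_def)
    qed
  qed
qed

end

section \<open>Local endomorphism rings and the Krull-Schmidt principle\<close>

text \<open>
  Indecomposability of a nonzero module, in a form that makes sense for every carrier type.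
\<close>

definition trivial_idem :: "('a, 'r) ring_scheme \<Rightarrow> ('a, 'm) module \<Rightarrow> bool" where
  "trivial_idem A M \<longleftrightarrow> (\<forall>e\<in>Hom A M M. compose (carrier M) e e = e \<longrightarrow>
     e = (\<lambda>x\<in>carrier M. \<zero>\<^bsub>M\<^esub>) \<or> e = (\<lambda>x\<in>carrier M. x))"

text \<open>
  The maps \<open>N \<rightarrow> N'\<close> that factor through some finite direct sum of modules in \<open>Y\<close>. Listing the summands
  as \<open>p i\<close> avoids forming these sums, which live on further carrier types.
\<close>

inductive_set thru :: "('a, 'r) ring_scheme \<Rightarrow> ('a, 'x) module set \<Rightarrow> ('a, 'm) module \<Rightarrow> ('a, 'n) module \<Rightarrow> ('m \<Rightarrow> 'n) set"
  for A Y N N' where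
  thru_zero: "(\<lambda>x\<in>carrier N. \<zero>\<^bsub>N'\<^esub>) \<in> thru A Y N N'"
| thru_step: "\<lbrakk>R \<in> Y; i \<in> Hom A N R; p \<in> Hom A R N'; s \<in> thru A Y N N'\<rbrakk> \<Longrightarrow>
    (\<lambda>x\<in>carrier N. s x \<oplus>\<^bsub>N'\<^esub> p (i x)) \<in> thru A Y N N'"

lemma thru_Hom:
  assumes "s \<in> thru A Y N N'" "right_module A N" "right_module A N'"
  shows "s \<in> Hom A N N'"
  using assms(1)
proof induction
  case thru_zero
  then show ?case using Hom_zero_map assms by blast
next
  case (thru_step R i p s)
  have "(\<lambda>x\<in>carrier N. s x \<oplus>\<^bsub>N'\<^esub> compose (carrier N) p i x) \<in> Hom A N N'"
    using Hom_plus[OF thru_step.IH Hom_comp[OF thru_step(2,3) assms(2)] assms(2,3)] .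
  moreover have "(\<lambda>x\<in>carrier N. s x \<oplus>\<^bsub>N'\<^esub> compose (carrier N) p i x) = (\<lambda>x\<in>carrier N. s x \<oplus>\<^bsub>N'\<^esub> p (i x))"
    by (rule restrict_ext) (simp add: compose_def)
  ultimately show ?case by metis
qed

lemma thru_sandwich:
  assumes "s \<in> thru A Y N N'" "a \<in> Hom A N' L'" "b \<in> Hom A L N"
    and "right_module A N" "right_module A N'" "right_module A L" "right_module A L'"
    and "\<And>R. R \<in> Y \<Longrightarrow> right_module A R"
  shows "(\<lambda>x\<in>carrier L. a (s (b x))) \<in> thru A Y L L'"
  using assms(1)
proof induction
  case thru_zero
  have "(\<lambda>x\<in>carrier L. a ((\<lambda>x\<in>carrier N. \<zero>\<^bsub>N'\<^esub>) (b x))) = (\<lambda>x\<in>carrier L. \<zero>\<^bsub>L'\<^esub>)"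
    by (rule restrict_ext) (simp add: Hom_closed[OF assms(3)] Hom_zero[OF assms(2,5,7)])
  then show ?case using thru.thru_zero by metis
next
  case (thru_step R i p s)
  note s = thru_Hom[OF thru_step(4) assms(4,5)]
  have "(\<lambda>x\<in>carrier L. a ((\<lambda>x\<in>carrier N. s x \<oplus>\<^bsub>N'\<^esub> p (i x)) (b x))) =
    (\<lambda>x\<in>carrier L. (\<lambda>x\<in>carrier L. a (s (b x))) x \<oplus>\<^bsub>L'\<^esub> compose (carrier R) a p (compose (carrier L) i b x))"
    by (rule restrict_ext)
      (simp add: Hom_closed[OF assms(3)] Hom_closed[OF s] Hom_closed[OF thru_step(2)] Hom_closed[OF thru_step(3)]
        Hom_add[OF assms(2)] compose_def)
  moreover have "(\<lambda>x\<in>carrier L. (\<lambda>x\<in>carrier L. a (s (b x))) x \<oplus>\<^bsub>L'\<^esub> compose (carrier R) a p (compose (carrier L) i b x)) \<in> thru A Y L L'"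
    using thru.thru_step[OF thru_step(1) Hom_comp[OF assms(3) thru_step(2) assms(6)]
      Hom_comp[OF thru_step(3) assms(2) assms(8)[OF thru_step(1)]] thru_step.IH] .
  ultimately show ?case by metis
qed

text \<open>
  \<open>N\<close> is a direct summand of a finite direct sum of modules in \<open>Y\<close>: the maps \<open>i\<close> and \<open>p\<close> of the
  decomposition of the identity are the components of an inclusion and of a retraction.
\<close>

definition id_thru :: "('a, 'r) ring_scheme \<Rightarrow> ('a, 'x) module set \<Rightarrow> ('a, 'm) module \<Rightarrow> bool" where
  "id_thru A Y N \<longleftrightarrow> (\<lambda>x\<in>carrier N. x) \<in> thru A Y N N"

lemma id_thru_retract:
  assumes "id_thru A Y N" "a \<in> Hom A N L" "b \<in> Hom A L N" "\<And>x. x \<in> carrier L \<Longrightarrow> a (b x) = x"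
    and "right_module A N" "right_module A L" "\<And>R. R \<in> Y \<Longrightarrow> right_module A R"
  shows "id_thru A Y L"
proof -
  have "(\<lambda>x\<in>carrier L. a ((\<lambda>x\<in>carrier N. x) (b x))) \<in> thru A Y L L"
    using thru_sandwich[OF assms(1)[unfolded id_thru_def] assms(2,3,5,5,6,6,7)] .
  moreover have "(\<lambda>x\<in>carrier L. a ((\<lambda>x\<in>carrier N. x) (b x))) = (\<lambda>x\<in>carrier L. x)"
    by (rule restrict_ext) (simp add: assms(4) Hom_closed[OF assms(3)])
  ultimately show ?thesis by (simp add: id_thru_def)
qed

lemma Hom_funpow:
  assumes "f \<in> Hom A N N" "right_module A N"
  shows "restrict (f ^^ k) (carrier N) \<in> Hom A N N"
proof (induction k)
  case 0
  have "restrict (f ^^ 0) (carrier N) = (\<lambda>x\<in>carrier N. x)" by (rule restrict_ext) simp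
  then show ?case using Hom_id[OF assms(2)] by metis
next
  case (Suc k)
  have "compose (carrier N) f (restrict (f ^^ k) (carrier N)) = restrict (f ^^ Suc k) (carrier N)"
    by (rule ext) (simp add: compose_def)
  then show ?case using Hom_comp[OF Suc assms(1,2)] by metis
qed

context fd_algebra
begin

lemma End_inj_imp_bij:
  assumes "fdmod N" "f \<in> Hom A N N" "inj_on f (carrier N)"
  shows "bij_betw f (carrier N) (carrier N)"
  using fd_inj_imp_surj[OF fdmodD(2)[OF assms(1)] klinear_Hom[OF assms(2)]] assms(3)
  by (simp add: bij_betw_def)

lemma End_surj_imp_bij:
  assumes "fdmod N" "f \<in> Hom A N N" "f ` carrier N = carrier N"
  shows "bij_betw f (carrier N) (carrier N)"
  using fd_surj_imp_inj[OF fdmodD(2)[OF assms(1)] klinear_Hom[OF assms(2)]] assms(3)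
  by (simp add: bij_betw_def)

lemma vdim_sub_less:
  assumes "fdmod M" "subm A M U" "U \<noteq> carrier M"
  shows "vdim K (US (M\<lparr>carrier := U\<rparr>)) < vdim K (US M)"
proof -
  note s = fd_subspace(2,3)[OF fdmodD(2)[OF assms(1)] submodule_US[OF fdmodD(1)[OF assms(1)] assms(2)]]
  have "vdim K ((US M)\<lparr>carrier := U\<rparr>) \<noteq> vdim K (US M)"
    using s(2) assms(3) by auto
  then show ?thesis using s(1) by simp
qed

text \<open>
  Fitting's lemma. The images of the powers of \<open>f\<close> become stationary, say from \<open>F = f\<^sup>k\<close> on. Then \<open>F\<close> is
  invertible on its image, and following \<open>F\<close> by this inverse gives an idempotent \<open>e\<close> with kernel
  \<open>ker F\<close>. If \<open>e = 1\<close>, then \<open>f\<close> is onto. If \<open>e = 0\<close>, then \<open>f\<close> is nilpotent and fixes only \<open>0\<close>.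
\<close>

lemma nonbij_no_fixed_point:
  assumes N: "fdmod N" and triv: "trivial_idem A N" and f: "f \<in> Hom A N N"
    and nb: "\<not> bij_betw f (carrier N) (carrier N)" and x: "x \<in> carrier N" "f x = x"
  shows "x = \<zero>\<^bsub>N\<^esub>"
proof -
  note rN = fdmodD(1)[OF N]
  interpret N: right_module A N by (rule rN)
  define F where "F k = restrict (f ^^ k) (carrier N)" for k
  have F: "F k \<in> Hom A N N" for k unfolding F_def by (rule Hom_funpow[OF f rN])
  have F_add: "F (k + m) y = F k (F m y)" if "y \<in> carrier N" for k m y
    using that Hom_closed[OF F, of y m] by (simp add: F_def funpow_add)
  define U where "U k = F k ` carrier N" for k
  have U: "subm A N (U k)" for k unfolding U_def by (rule subm_image[OF F rN rN])
  have Usub: "U (k + m) \<subseteq> U k" for k m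
    unfolding U_def using F_add Hom_closed[OF F] by auto
  have UN: "U k \<subseteq> carrier N" for k unfolding U_def using Hom_closed[OF F] by auto
  define d where "d k = vdim K (US (N\<lparr>carrier := U k\<rparr>))" for k
  have fdU: "fdmod (N\<lparr>carrier := U k\<rparr>)" for k by (rule fdmod_sub[OF N U])
  have subU: "subm A (N\<lparr>carrier := U k\<rparr>) (U (k + m))" for k m
    using U[of "k + m"] Usub[of k m] unfolding subm_def by simp
  have upd: "N\<lparr>carrier := U k, carrier := U m\<rparr> = N\<lparr>carrier := U m\<rparr>" for k m by simp
  \<comment> \<open>The image \<open>U k0\<close> has the least dimension. The exponent \<open>k = k0 + 1\<close> is positive, so an element of
    \<open>U k\<close> lies in the image of \<open>f\<close>.\<close>
  obtain k0 where k0: "\<And>m. d k0 \<le> d m"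
    using ex_has_least_nat[of "\<lambda>_. True" 0 d] by auto
  define k where "k = Suc k0"
  have dd: "d (k0 + m) = d k0" for m
    using fd_subspace(2)[OF fdmodD(2)[OF fdU] submodule_US[OF fdmodD(1)[OF fdU] subU], of k0 m] k0[of "k0 + m"]
    by (simp add: d_def)
  have Ueq: "U (k + k) = U k"
  proof (rule ccontr)
    assume "U (k + k) \<noteq> U k"
    then have "d (k + k) < d k"
      using vdim_sub_less[OF fdU subU, of k k] unfolding d_def upd by simp
    then show False using dd[of "Suc 0"] dd[of "Suc k"] by (simp add: k_def)
  qed
  let ?NU = "N\<lparr>carrier := U k\<rparr>"
  note rU = fdmodD(1)[OF fdU]
  define h where "h = restrict (F k) (U k)"
  have hU: "h \<in> Hom A ?NU N" unfolding h_def by (rule Hom_restrict[OF F U])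
  have im: "h ` U k = U k"
  proof -
    have "h ` U k = F k ` (F k ` carrier N)" unfolding h_def U_def by simp
    also have "\<dots> = U (k + k)" unfolding U_def using F_add by (auto simp: image_image)
    finally show ?thesis using Ueq by simp
  qed
  have h: "h \<in> Hom A ?NU ?NU" using Hom_corestrict[OF hU] im by simp
  have "bij_betw h (carrier ?NU) (carrier ?NU)"
    using End_surj_imp_bij[OF fdU h] im by simp
  then obtain g where g: "g \<in> Hom A ?NU ?NU" and gh: "\<And>y. y \<in> carrier ?NU \<Longrightarrow> g (h y) = y"
      and hg: "\<And>y. y \<in> carrier ?NU \<Longrightarrow> h (g y) = y"
    using Hom_inverse[OF h rU rU] by metis
  have FU: "F k y \<in> U k" if "y \<in> carrier N" for y using that unfolding U_def by blast
  have FNU: "F k \<in> Hom A N ?NU" by (rule Hom_corestrict[OF F]) (simp add: U_def)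
  define e where "e = compose (carrier N) g (F k)"
  have eU: "e \<in> Hom A N ?NU" unfolding e_def by (rule Hom_comp[OF FNU g rN])
  have e: "e \<in> Hom A N N" by (rule Hom_expand[OF eU UN])
  have e_app: "e y = g (F k y)" if "y \<in> carrier N" for y using that by (simp add: e_def compose_def)
  have eUm: "e y \<in> U k" if "y \<in> carrier N" for y using Hom_closed[OF eU that] by simp
  have Fe: "F k (e y) = F k y" if "y \<in> carrier N" for y
    using hg[of "F k y"] FU[OF that] eUm[OF that] e_app[OF that] by (simp add: h_def)
  have "compose (carrier N) e e = e"
  proof (rule Hom_eqI[OF Hom_comp[OF e e rN] e])
    fix y assume y: "y \<in> carrier N"
    show "compose (carrier N) e e y = e y"
      using compose_eq[OF y, of e e] e_app[OF y] e_app[OF Hom_closed[OF e y]] Fe[OF y] by simp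
  qed
  then consider "e = (\<lambda>x\<in>carrier N. \<zero>\<^bsub>N\<^esub>)" | "e = (\<lambda>x\<in>carrier N. x)"
    using triv e unfolding trivial_idem_def by blast
  then show ?thesis
  proof cases
    case 1
    have "(f ^^ m) x = x" for m using x(2) by (induction m) simp_all
    then have "F k x = x" using x(1) by (simp add: F_def)
    moreover have "F k x = \<zero>\<^bsub>N\<^esub>" using Fe[OF x(1)] 1 x(1) Hom_zero[OF F rN rN] by simp
    ultimately show ?thesis by simp
  next
    case 2
    have "f ` carrier N = carrier N"
    proof
      show "f ` carrier N \<subseteq> carrier N" using Hom_closed[OF f] by blast
      show "carrier N \<subseteq> f ` carrier N"
      proof
        fix y assume y: "y \<in> carrier N"
        then have "y \<in> U k" using eUm[OF y] 2 by simp
        then obtain z where z: "z \<in> carrier N" "y = F k z" unfolding U_def by blast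
        then have "y = f (F k0 z)" by (simp add: F_def k_def)
        then show "y \<in> f ` carrier N" using Hom_closed[OF F z(1)] by blast
      qed
    qed
    then show ?thesis using End_surj_imp_bij[OF N f] nb by simp
  qed
qed

text \<open>
  Let \<open>v\<close> be the inverse of \<open>f + g\<close>. Then \<open>v f + v g = 1\<close>, so a zero of \<open>v g\<close> is a fixed point of \<open>v f\<close>. If
  \<open>f\<close> is not bijective, Fitting's lemma makes that fixed point \<open>0\<close>, and \<open>v g\<close> is injective.
\<close>

lemma local_End:
  assumes N: "fdmod N" and triv: "trivial_idem A N" and f: "f \<in> Hom A N N" and g: "g \<in> Hom A N N"
    and bij: "bij_betw (\<lambda>x\<in>carrier N. f x \<oplus>\<^bsub>N\<^esub> g x) (carrier N) (carrier N)"
  shows "bij_betw f (carrier N) (carrier N) \<or> bij_betw g (carrier N) (carrier N)"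
proof (cases "bij_betw f (carrier N) (carrier N)")
  case nf: False
  note rN = fdmodD(1)[OF N]
  interpret N: right_module A N by (rule rN)
  let ?u = "\<lambda>x\<in>carrier N. f x \<oplus>\<^bsub>N\<^esub> g x"
  have u: "?u \<in> Hom A N N" by (rule Hom_plus[OF f g rN rN])
  obtain v where v: "v \<in> Hom A N N" and vb: "bij_betw v (carrier N) (carrier N)"
      and vu': "\<forall>y\<in>carrier N. v (?u y) = y" and "\<forall>y\<in>carrier N. ?u (v y) = y"
    by (rule Hom_inverse[OF u rN rN bij])
  have vu: "v (?u y) = y" if "y \<in> carrier N" for y by (rule bspec[OF vu' that])
  let ?f = "compose (carrier N) v f" and ?g = "compose (carrier N) v g"
  have f': "?f \<in> Hom A N N" and g': "?g \<in> Hom A N N"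
    using Hom_comp[OF f v rN] Hom_comp[OF g v rN] by auto
  have sum: "?f x \<oplus>\<^bsub>N\<^esub> ?g x = x" if "x \<in> carrier N" for x
    using vu[OF that] that by (simp add: compose_def Hom_add[OF v] Hom_closed[OF f] Hom_closed[OF g])
  have cancel: "bij_betw w (carrier N) (carrier N)"
    if w: "w \<in> Hom A N N" and b: "bij_betw (compose (carrier N) v w) (carrier N) (carrier N)" for w
  proof (rule End_inj_imp_bij[OF N w])
    show "inj_on w (carrier N)"
    proof (rule inj_onI)
      fix x y assume xy: "x \<in> carrier N" "y \<in> carrier N" "w x = w y"
      then have "compose (carrier N) v w x = compose (carrier N) v w y" by (simp add: compose_eq)
      then show "x = y" using inj_onD[OF bij_betw_imp_inj_on[OF b]] xy(1,2) by blast
    qed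
  qed
  have nf': "\<not> bij_betw ?f (carrier N) (carrier N)" using cancel[OF f] nf by blast
  have "inj_on ?g (carrier N)"
  proof (rule Hom_inj_onI[OF g' rN rN])
    fix x assume x: "x \<in> carrier N" "?g x = \<zero>\<^bsub>N\<^esub>"
    then have "?f x = x" using sum[OF x(1)] Hom_closed[OF f' x(1)] by simp
    then show "x = \<zero>\<^bsub>N\<^esub>" using nonbij_no_fixed_point[OF N triv f' nf' x(1)] by blast
  qed
  then show ?thesis using cancel[OF g] End_inj_imp_bij[OF N g'] by blast
qed simp

text \<open>
  In a local ring a sum is invertible only if one of its terms is.
\<close>

lemma thru_bij:
  assumes "s \<in> thru A Y N N" and N: "fdmod N" "\<not> zero_module N" and triv: "trivial_idem A N"
    and bij: "bij_betw s (carrier N) (carrier N)"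
  shows "\<exists>R i p. R \<in> Y \<and> i \<in> Hom A N R \<and> p \<in> Hom A R N \<and>
    bij_betw (compose (carrier N) p i) (carrier N) (carrier N)"
  using assms(1) bij
proof induction
  note rN = fdmodD(1)[OF N(1)]
  interpret N: right_module A N by (rule rN)
  case thru_zero
  then have "carrier N = {\<zero>\<^bsub>N\<^esub>}"
    using N.M.zero_closed by (auto simp: bij_betw_def)
  then show ?case using N(2) by blast
next
  case (thru_step R i p s)
  note rN = fdmodD(1)[OF N(1)]
  note pi = Hom_comp[OF thru_step(2,3) rN]
  have "(\<lambda>x\<in>carrier N. s x \<oplus>\<^bsub>N\<^esub> p (i x)) = (\<lambda>x\<in>carrier N. s x \<oplus>\<^bsub>N\<^esub> compose (carrier N) p i x)"
    by (rule restrict_ext) (simp add: compose_def)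
  then have "bij_betw s (carrier N) (carrier N) \<or> bij_betw (compose (carrier N) p i) (carrier N) (carrier N)"
    using local_End[OF N(1) triv thru_Hom[OF thru_step(4) rN rN] pi] thru_step.prems by metis
  then show ?case using thru_step by blast
qed

text \<open>
  Correct \<open>p\<close> to a left inverse \<open>q\<close> of \<open>i\<close>. Then \<open>i q\<close> is an idempotent of \<open>R\<close>, nonzero because \<open>N\<close> is.
\<close>

lemma summand_of_trivial_idem_iso:
  assumes rN: "right_module A N" and nz: "\<not> zero_module N" and rR: "right_module A R"
    and triv: "trivial_idem A R" and i: "i \<in> Hom A N R" and p: "p \<in> Hom A R N"
    and bij: "bij_betw (compose (carrier N) p i) (carrier N) (carrier N)"
  shows "bij_betw i (carrier N) (carrier R)"
proof -
  interpret N: right_module A N by (rule rN)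
  note pi = Hom_comp[OF i p rN]
  obtain v where v: "v \<in> Hom A N N" "\<And>y. y \<in> carrier N \<Longrightarrow> v (compose (carrier N) p i y) = y"
    using Hom_inverse[OF pi rN rN bij] by metis
  let ?q = "compose (carrier R) v p"
  have q: "?q \<in> Hom A R N" by (rule Hom_comp[OF p v(1) rR])
  have qi: "?q (i y) = y" if "y \<in> carrier N" for y
    using v(2)[OF that] that Hom_closed[OF i that] by (simp add: compose_def)
  let ?e = "compose (carrier R) i ?q"
  have e: "?e \<in> Hom A R R" by (rule Hom_comp[OF q i rR])
  have e_app: "?e y = i (?q y)" if "y \<in> carrier R" for y using that by (simp add: compose_eq)
  have "compose (carrier R) ?e ?e = ?e"
  proof (rule Hom_eqI[OF Hom_comp[OF e e rR] e])
    fix x assume x: "x \<in> carrier R"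
    show "compose (carrier R) ?e ?e x = ?e x"
      using compose_eq[OF x, of ?e ?e] e_app[OF x] e_app[OF Hom_closed[OF e x]] qi[OF Hom_closed[OF q x]] by simp
  qed
  then consider "?e = (\<lambda>x\<in>carrier R. \<zero>\<^bsub>R\<^esub>)" | "?e = (\<lambda>x\<in>carrier R. x)"
    using triv e unfolding trivial_idem_def by blast
  then show ?thesis
  proof cases
    case 1
    have "y = \<zero>\<^bsub>N\<^esub>" if y: "y \<in> carrier N" for y
    proof -
      have "?e (i y) = \<zero>\<^bsub>R\<^esub>" using 1 Hom_closed[OF i y] by (metis restrict_apply')
      then have "i y = \<zero>\<^bsub>R\<^esub>" using e_app[OF Hom_closed[OF i y]] qi[OF y] by simp
      then show ?thesis using qi[OF y] Hom_zero[OF q rR rN] by simp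
    qed
    then show ?thesis using nz N.M.zero_closed by blast
  next
    case 2
    have iq: "i (?q y) = y" if "y \<in> carrier R" for y using e_app[OF that] 2 that by (metis restrict_apply')
    show ?thesis
      by (rule bij_betw_byWitness[where f' = ?q]) (use qi iq Hom_closed[OF i] Hom_closed[OF q] in auto)
  qed
qed

lemma idempotent_kernel_projection:
  assumes "right_module A M" "e \<in> Hom A M M" "compose (carrier M) e e = e"
  shows "(\<lambda>x\<in>carrier M. x \<ominus>\<^bsub>M\<^esub> e x) \<in> Hom A M (M\<lparr>carrier := mker M M e\<rparr>)"
    and "x \<in> mker M M e \<Longrightarrow> x \<ominus>\<^bsub>M\<^esub> e x = x"
    and "x \<in> e ` carrier M \<Longrightarrow> e x = x"
proof -
  interpret M: right_module A M by fact
  have ee: "e (e x) = e x" if "x \<in> carrier M" for x using that assms(3) by (metis compose_eq)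
  have "(\<lambda>x\<in>carrier M. (\<lambda>x\<in>carrier M. x) x \<oplus>\<^bsub>M\<^esub> (\<lambda>x\<in>carrier M. \<ominus>\<^bsub>M\<^esub> e x) x) \<in> Hom A M M"
    by (rule Hom_plus[OF Hom_id Hom_uminus]) (use assms in auto)
  moreover have "(\<lambda>x\<in>carrier M. (\<lambda>x\<in>carrier M. x) x \<oplus>\<^bsub>M\<^esub> (\<lambda>x\<in>carrier M. \<ominus>\<^bsub>M\<^esub> e x) x) = (\<lambda>x\<in>carrier M. x \<ominus>\<^bsub>M\<^esub> e x)"
    by (rule restrict_ext) (simp add: a_minus_def)
  ultimately have "(\<lambda>x\<in>carrier M. x \<ominus>\<^bsub>M\<^esub> e x) \<in> Hom A M M" by simp
  moreover have "e (x \<ominus>\<^bsub>M\<^esub> e x) = \<zero>\<^bsub>M\<^esub>" if "x \<in> carrier M" for x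
    using Hom_sub[OF assms(2,1,1) that Hom_closed[OF assms(2) that]] ee[OF that] Hom_closed[OF assms(2) that]
    by (simp add: a_minus_def M.M.r_neg)
  ultimately show "(\<lambda>x\<in>carrier M. x \<ominus>\<^bsub>M\<^esub> e x) \<in> Hom A M (M\<lparr>carrier := mker M M e\<rparr>)"
    by (intro Hom_corestrict) (auto simp: mker_def Hom_closed[OF assms(2)])
  show "x \<ominus>\<^bsub>M\<^esub> e x = x" if "x \<in> mker M M e"
    using that by (simp add: mker_def a_minus_def)
  show "e x = x" if "x \<in> e ` carrier M" using that ee by auto
qed

text \<open>
  The existence part of the Krull-Schmidt theorem for summands of sums of modules in \<open>Y\<close>, as an
  induction rule: such a module is assembled from modules isomorphic to members of \<open>Y\<close> by splittings
  \<open>M = ker e \<oplus> im e\<close>. A nontrivial idempotent cuts \<open>N\<close> into summands of smaller dimension. Without one,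
  \<open>End N\<close> is local, so one of the maps \<open>p i\<close> that add up to the identity is bijective, and the member
  of \<open>Y\<close> that it passes through is isomorphic to \<open>N\<close>.
\<close>

lemma krull_schmidt_induct:
  assumes "fdmod N" and "id_thru A Y N"
    and Y: "\<And>R. R \<in> Y \<Longrightarrow> right_module A R" "\<And>R. R \<in> Y \<Longrightarrow> trivial_idem A R"
    and zero: "\<And>M. \<lbrakk>fdmod M; zero_module M\<rbrakk> \<Longrightarrow> P M"
    and split: "\<And>M e. \<lbrakk>fdmod M; e \<in> Hom A M M; compose (carrier M) e e = e;
      P (M\<lparr>carrier := mker M M e\<rparr>); P (M\<lparr>carrier := e ` carrier M\<rparr>)\<rbrakk> \<Longrightarrow> P M"
    and iso: "\<And>M R. \<lbrakk>fdmod M; R \<in> Y; isomorphic A M R\<rbrakk> \<Longrightarrow> P M"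
  shows "P N"
  using assms(1,2)
proof (induction "vdim K (US N)" arbitrary: N rule: less_induct)
  case less
  note rN = fdmodD(1)[OF less.prems(1)]
  interpret N: right_module A N by (rule rN)
  consider "zero_module N" | "\<not> zero_module N" "trivial_idem A N" | "\<not> trivial_idem A N" by blast
  then show ?case
  proof cases
    case 1
    then show ?thesis using zero[OF less.prems(1)] by blast
  next
    case 2
    have "bij_betw (\<lambda>x\<in>carrier N. x) (carrier N) (carrier N)" by (auto simp: bij_betw_def inj_on_def)
    then obtain R i p where *: "R \<in> Y" "i \<in> Hom A N R" "p \<in> Hom A R N"
        "bij_betw (compose (carrier N) p i) (carrier N) (carrier N)"
      using thru_bij[OF less.prems(2)[unfolded id_thru_def] less.prems(1) 2] by blast
    have "bij_betw i (carrier N) (carrier R)"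
      by (rule summand_of_trivial_idem_iso[OF rN 2(1) Y(1)[OF *(1)] Y(2)[OF *(1)] *(2,3,4)])
    then show ?thesis using iso[OF less.prems(1) *(1)] *(2) unfolding isomorphic_def by blast
  next
    case 3
    then obtain e where e: "e \<in> Hom A N N" "compose (carrier N) e e = e"
      and ne: "e \<noteq> (\<lambda>x\<in>carrier N. \<zero>\<^bsub>N\<^esub>)" "e \<noteq> (\<lambda>x\<in>carrier N. x)"
      unfolding trivial_idem_def by blast
    note ip = idempotent_kernel_projection[OF rN e]
    note k = subm_mker[OF e(1) rN rN] and m = subm_image[OF e(1) rN rN]
    have kne: "mker N N e \<noteq> carrier N"
    proof
      assume "mker N N e = carrier N"
      then have "e x = \<zero>\<^bsub>N\<^esub>" if "x \<in> carrier N" for x using that unfolding mker_def by blast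
      then have "e = (\<lambda>x\<in>carrier N. \<zero>\<^bsub>N\<^esub>)" by (intro Hom_eqI[OF e(1) Hom_zero_map[OF rN rN]]) simp
      then show False using ne(1) by blast
    qed
    have mne: "e ` carrier N \<noteq> carrier N"
    proof
      assume "e ` carrier N = carrier N"
      then have "e x = x" if "x \<in> carrier N" for x using that ip(3) by blast
      then have "e = (\<lambda>x\<in>carrier N. x)" by (intro Hom_eqI[OF e(1) Hom_id[OF rN]]) simp
      then show False using ne(2) by blast
    qed
    have "id_thru A Y (N\<lparr>carrier := mker N N e\<rparr>)"
      by (rule id_thru_retract[OF less.prems(2) ip(1) Hom_inclusion[OF k] _ rN right_module_sub[OF rN k] Y(1)])
        (auto simp: mker_def a_minus_def)
    then have pk: "P (N\<lparr>carrier := mker N N e\<rparr>)"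
      using less.hyps[OF vdim_sub_less[OF less.prems(1) k kne] fdmod_sub[OF less.prems(1) k]] by blast
    have "e ((\<lambda>x\<in>e ` carrier N. x) x) = x" if "x \<in> carrier (N\<lparr>carrier := e ` carrier N\<rparr>)" for x
    proof -
      have "x \<in> e ` carrier N" using that by simp
      then show ?thesis using ip(3) by (simp only: restrict_apply')
    qed
    then have "id_thru A Y (N\<lparr>carrier := e ` carrier N\<rparr>)"
      by (rule id_thru_retract[OF less.prems(2) Hom_corestrict[OF e(1) order_refl] Hom_inclusion[OF m] _ rN right_module_sub[OF rN m] Y(1)])
    then have pm: "P (N\<lparr>carrier := e ` carrier N\<rparr>)"
      using less.hyps[OF vdim_sub_less[OF less.prems(1) m mne] fdmod_sub[OF less.prems(1) m]] by blast
    show ?thesis by (rule split[OF less.prems(1) e pk pm])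
  qed
qed

text \<open>
  An idempotent decomposes \<open>M\<close> as \<open>ker e \<oplus> im e\<close>.
\<close>

lemma indecomposable_imp_trivial_idem:
  assumes "indecomposable A M"
  shows "trivial_idem A M"
  unfolding trivial_idem_def
proof (intro ballI impI)
  fix e assume e: "e \<in> Hom A M M" "compose (carrier M) e e = e"
  have fM: "fdmod M" using assms unfolding indecomposable_def fg_modules_iff by blast
  note rM = fdmodD(1)[OF fM]
  interpret M: right_module A M by (rule rM)
  note ip = idempotent_kernel_projection[OF rM e]
  note k = subm_mker[OF e(1) rM rM] and m = subm_image[OF e(1) rM rM]
  let ?k = "M\<lparr>carrier := mker M M e\<rparr>" and ?m = "M\<lparr>carrier := e ` carrier M\<rparr>"
  let ?\<phi> = "\<lambda>x\<in>carrier M. (x \<ominus>\<^bsub>M\<^esub> e x, e x)"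
  let ?p = "\<lambda>x\<in>carrier M. x \<ominus>\<^bsub>M\<^esub> e x"
  have \<phi>: "?\<phi> \<in> Hom A M (dsum ?k ?m)"
    using Hom_closed[OF ip(1)] Hom_add[OF ip(1)] Hom_act[OF ip(1)]
    by (intro restrict_HomI[OF rM]) (auto simp: Hom_add[OF e(1)] Hom_act[OF e(1)] M.act_closed)
  have kk: "x \<in> carrier M" "e x = \<zero>\<^bsub>M\<^esub>" if "x \<in> mker M M e" for x using that by (auto simp: mker_def)
  have "bij_betw ?\<phi> (carrier M) (carrier (dsum ?k ?m))"
  proof (rule bij_betw_byWitness[where f' = "\<lambda>(x, y). x \<oplus>\<^bsub>M\<^esub> y"])
    show "\<forall>x\<in>carrier M. (\<lambda>(x, y). x \<oplus>\<^bsub>M\<^esub> y) (?\<phi> x) = x"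
      using Hom_closed[OF e(1)] by (auto simp: a_minus_def M.M.a_assoc M.M.l_neg)
    show "\<forall>z\<in>carrier (dsum ?k ?m). ?\<phi> ((\<lambda>(x, y). x \<oplus>\<^bsub>M\<^esub> y) z) = z"
    proof
      fix z assume "z \<in> carrier (dsum ?k ?m)"
      then obtain x y where z: "z = (x, y)" "x \<in> mker M M e" "y \<in> e ` carrier M" by auto
      have y: "y \<in> carrier M" using z(3) Hom_closed[OF e(1)] by blast
      have y: "y \<in> carrier M" "e y = y" using y ip(3)[OF z(3)] by simp_all
      have "e (x \<oplus>\<^bsub>M\<^esub> y) = y" using kk[OF z(2)] y by (simp add: Hom_add[OF e(1)])
      then show "?\<phi> ((\<lambda>(x, y). x \<oplus>\<^bsub>M\<^esub> y) z) = z"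
        using kk[OF z(2)] y by (simp add: z(1) a_minus_def M.M.a_assoc M.M.r_neg)
    qed
    show "?\<phi> ` carrier M \<subseteq> carrier (dsum ?k ?m)" using Hom_closed[OF \<phi>] by blast
    show "(\<lambda>(x, y). x \<oplus>\<^bsub>M\<^esub> y) ` carrier (dsum ?k ?m) \<subseteq> carrier M"
      using kk Hom_closed[OF e(1)] by auto
  qed
  then have "isomorphic A M (dsum ?k ?m)" using \<phi> unfolding isomorphic_def by blast
  moreover have "?k \<in> fg_modules A" "?m \<in> fg_modules A"
    using fdmod_sub[OF fM k] fdmod_sub[OF fM m] by (simp_all add: fg_modules_iff)
  ultimately have "zero_module ?k \<or> zero_module ?m"
    using assms unfolding indecomposable_def by blast
  then show "e = (\<lambda>x\<in>carrier M. \<zero>\<^bsub>M\<^esub>) \<or> e = (\<lambda>x\<in>carrier M. x)"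
  proof
    assume z: "zero_module ?m"
    have "e = (\<lambda>x\<in>carrier M. \<zero>\<^bsub>M\<^esub>)"
      by (rule Hom_eqI[OF e(1) Hom_zero_map[OF rM rM]]) (use z in auto)
    then show ?thesis by blast
  next
    assume z: "zero_module ?k"
    have "x = e x" if x: "x \<in> carrier M" for x
    proof -
      have "x \<ominus>\<^bsub>M\<^esub> e x = \<zero>\<^bsub>M\<^esub>" using Hom_closed[OF ip(1) x] z x by simp
      then show ?thesis using x Hom_closed[OF e(1) x] M.M.minus_equality[of x "\<ominus>\<^bsub>M\<^esub> e x"]
        by (simp add: a_minus_def)
    qed
    then have "e = (\<lambda>x\<in>carrier M. x)" by (intro Hom_eqI[OF e(1) Hom_id[OF rM]]) simp
    then show ?thesis by blast
  qed
qed

end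

section \<open>Approximations\<close>

lemma id_thru_dsum:
  assumes "id_thru A Y N" "R \<in> Y" "right_module A N" "\<And>R. R \<in> Y \<Longrightarrow> right_module A R"
  shows "id_thru A Y (dsum N R)"
proof -
  note rN = assms(3) and rR = assms(4)[OF assms(2)]
  interpret N: right_module A N by (rule rN)
  interpret R: right_module A R by (rule rR)
  note rD = right_module_dsum[OF rN rR]
  note ip = Hom_dsum[OF rN rR]
  let ?D = "dsum N R"
  let ?a = "\<lambda>x\<in>carrier N. (x, \<zero>\<^bsub>R\<^esub>)" and ?b = "\<lambda>z\<in>carrier ?D. fst z"
    and ?i = "\<lambda>z\<in>carrier ?D. snd z" and ?p = "\<lambda>y\<in>carrier R. (\<zero>\<^bsub>N\<^esub>, y)"
  let ?s = "\<lambda>x\<in>carrier ?D. ?a ((\<lambda>x\<in>carrier N. x) (?b x))"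
  have s: "?s \<in> thru A Y ?D ?D"
    by (rule thru_sandwich[OF assms(1)[unfolded id_thru_def] ip(1) ip(3) rN rN rD rD assms(4)])
  have "(\<lambda>x\<in>carrier ?D. ?s x \<oplus>\<^bsub>?D\<^esub> ?p (?i x)) \<in> thru A Y ?D ?D"
    by (rule thru_step[OF assms(2) ip(4) ip(2) s])
  moreover have "(\<lambda>x\<in>carrier ?D. ?s x \<oplus>\<^bsub>?D\<^esub> ?p (?i x)) = (\<lambda>x\<in>carrier ?D. x)"
    by (rule restrict_ext) auto
  ultimately show ?thesis unfolding id_thru_def by metis
qed

context fd_algebra
begin

lemma fg_representative_maps:
  assumes "fdmod M"
  obtains N :: "('k, 'a) rmod" and \<phi> \<psi> where "fdmod N" "\<phi> \<in> Hom A M N" "\<psi> \<in> Hom A N M"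
    "\<forall>x\<in>carrier M. \<psi> (\<phi> x) = x" "\<forall>y\<in>carrier N. \<phi> (\<psi> y) = y" "isomorphic A M N"
proof -
  obtain N :: "('k, 'a) rmod" where N: "N \<in> fg_modules A" "isomorphic A M N"
    using fg_representative[OF assms] by metis
  have fN: "fdmod N" using N(1) by (simp add: fg_modules_iff)
  obtain \<phi> where \<phi>: "\<phi> \<in> Hom A M N" "bij_betw \<phi> (carrier M) (carrier N)"
    using N(2) unfolding isomorphic_def by metis
  obtain \<psi> where "\<psi> \<in> Hom A N M" "bij_betw \<psi> (carrier N) (carrier M)"
      "\<forall>x\<in>carrier M. \<psi> (\<phi> x) = x" "\<forall>y\<in>carrier N. \<phi> (\<psi> y) = y"
    by (rule Hom_inverse[OF \<phi>(1) fdmodD(1)[OF assms] fdmodD(1)[OF fN] \<phi>(2)])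
  then show thesis using that[OF fN \<phi>(1) _ _ _ N(2)] by metis
qed

text \<open>
  One summand \<open>R\<close> is added for each pair \<open>(R, h)\<close> in \<open>T\<close>. The sum lives on pairs, so every step passes to
  an isomorphic copy on the type \<open>nat \<Rightarrow> 'k\<close>.
\<close>

lemma approximation_finite:
  assumes M: "fdmod M" and Y: "\<And>R. R \<in> Y \<Longrightarrow> fdmod R"
    and "finite T" and "\<And>R h. (R, h) \<in> T \<Longrightarrow> R \<in> Y \<and> h \<in> Hom A R M"
  shows "\<exists>(C :: ('k, 'a) rmod) c. fdmod C \<and> id_thru A Y C \<and> c \<in> Hom A C M \<and>
    (\<forall>(R, h)\<in>T. \<exists>j\<in>Hom A R C. \<forall>x\<in>carrier R. c (j x) = h x)"
  using assms(3,4)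
proof (induction T rule: finite_induct)
  case empty
  note rM = fdmodD(1)[OF M]
  interpret M: right_module A M by (rule rM)
  have z: "subm A M {\<zero>\<^bsub>M\<^esub>}" by (simp add: subm_def M.act_zero)
  obtain C :: "('k, 'a) rmod" and \<phi> \<psi> where C: "fdmod C" "\<phi> \<in> Hom A (M\<lparr>carrier := {\<zero>\<^bsub>M\<^esub>}\<rparr>) C"
    "\<psi> \<in> Hom A C (M\<lparr>carrier := {\<zero>\<^bsub>M\<^esub>}\<rparr>)"
    "\<forall>x\<in>carrier (M\<lparr>carrier := {\<zero>\<^bsub>M\<^esub>}\<rparr>). \<psi> (\<phi> x) = x" "\<forall>y\<in>carrier C. \<phi> (\<psi> y) = y"
    "isomorphic A (M\<lparr>carrier := {\<zero>\<^bsub>M\<^esub>}\<rparr>) C"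
    by (rule fg_representative_maps[OF fdmod_sub[OF M z]])
  note rC = fdmodD(1)[OF C(1)]
  have "\<phi> \<zero>\<^bsub>M\<^esub> = \<zero>\<^bsub>C\<^esub>" using Hom_zero[OF C(2) right_module_sub[OF rM z] rC] by simp
  then have c0: "y = \<zero>\<^bsub>C\<^esub>" if "y \<in> carrier C" for y
    using C(5) Hom_closed[OF C(3) that] that by auto
  have "(\<lambda>x\<in>carrier C. x) = (\<lambda>x\<in>carrier C. \<zero>\<^bsub>C\<^esub>)" by (rule restrict_ext) (rule c0)
  then have "id_thru A Y C" unfolding id_thru_def using thru_zero by metis
  then show ?case using C(1) Hom_zero_map[OF rC rM] by auto
next
  case (insert t T)
  obtain R h where t: "t = (R, h)" by (cases t)
  have R: "R \<in> Y" "h \<in> Hom A R M" using insert.prems t by auto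
  have "\<exists>(C :: ('k, 'a) rmod) c. fdmod C \<and> id_thru A Y C \<and> c \<in> Hom A C M \<and>
    (\<forall>(R, h)\<in>T. \<exists>j\<in>Hom A R C. \<forall>x\<in>carrier R. c (j x) = h x)"
    by (rule insert.IH) (use insert.prems in blast)
  then obtain C :: "('k, 'a) rmod" and c where C: "fdmod C" "id_thru A Y C" "c \<in> Hom A C M"
    "\<And>R h. (R, h) \<in> T \<Longrightarrow> \<exists>j\<in>Hom A R C. \<forall>x\<in>carrier R. c (j x) = h x"
    by blast
  note rM = fdmodD(1)[OF M] and rC = fdmodD(1)[OF C(1)] and fR = Y[OF R(1)]
  note rR = fdmodD(1)[OF fR]
  interpret M: right_module A M by (rule rM)
  interpret C: right_module A C by (rule rC)
  interpret R: right_module A R by (rule rR)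
  note rD = right_module_dsum[OF rC rR] and fD = fdmod_dsum[OF C(1) fR] and ip = Hom_dsum[OF rC rR]
  let ?D = "dsum C R"
  obtain C' :: "('k, 'a) rmod" and \<phi> \<psi> where C': "fdmod C'" "\<phi> \<in> Hom A ?D C'"
    "\<psi> \<in> Hom A C' ?D" "\<forall>x\<in>carrier ?D. \<psi> (\<phi> x) = x" "\<forall>y\<in>carrier C'. \<phi> (\<psi> y) = y"
    "isomorphic A ?D C'"
    by (rule fg_representative_maps[OF fD])
  note rC' = fdmodD(1)[OF C'(1)]
  have it: "id_thru A Y C'"
    by (rule id_thru_retract[OF id_thru_dsum[OF C(2) R(1) rC fdmodD(1)[OF Y]] C'(2,3) _ rD rC' fdmodD(1)[OF Y]])
      (use C'(5) in auto)
  let ?d = "\<lambda>z\<in>carrier ?D. c (fst z) \<oplus>\<^bsub>M\<^esub> h (snd z)"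
  have d: "?d \<in> Hom A ?D M"
  proof (rule restrict_HomI[OF rD])
    fix z w assume "z \<in> carrier ?D" "w \<in> carrier ?D"
    then obtain x y x' y' where "z = (x, y)" "w = (x', y')" "x \<in> carrier C" "x' \<in> carrier C" "y \<in> carrier R" "y' \<in> carrier R"
      by auto
    then show "c (fst (z \<oplus>\<^bsub>?D\<^esub> w)) \<oplus>\<^bsub>M\<^esub> h (snd (z \<oplus>\<^bsub>?D\<^esub> w)) =
      c (fst z) \<oplus>\<^bsub>M\<^esub> h (snd z) \<oplus>\<^bsub>M\<^esub> (c (fst w) \<oplus>\<^bsub>M\<^esub> h (snd w))"
      by (simp add: Hom_add[OF C(3)] Hom_add[OF R(2)] Hom_closed[OF C(3)] Hom_closed[OF R(2)] M.M.a_ac)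
  next
    fix a z assume "a \<in> carrier A" "z \<in> carrier ?D"
    then obtain x y where "z = (x, y)" "x \<in> carrier C" "y \<in> carrier R" "a \<in> carrier A" by auto
    then show "c (fst (a \<odot>\<^bsub>?D\<^esub> z)) \<oplus>\<^bsub>M\<^esub> h (snd (a \<odot>\<^bsub>?D\<^esub> z)) = a \<odot>\<^bsub>M\<^esub> (c (fst z) \<oplus>\<^bsub>M\<^esub> h (snd z))"
      by (simp add: Hom_act[OF C(3)] Hom_act[OF R(2)] Hom_closed[OF C(3)] Hom_closed[OF R(2)] M.act_add)
  qed (auto simp: Hom_closed[OF C(3)] Hom_closed[OF R(2)])
  let ?c = "compose (carrier C') ?d \<psi>"
  have c': "?c \<in> Hom A C' M" by (rule Hom_comp[OF C'(3) d rC'])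
  have c'_\<phi>: "?c (\<phi> z) = c (fst z) \<oplus>\<^bsub>M\<^esub> h (snd z)" if "z \<in> carrier ?D" for z
    using compose_eq[OF Hom_closed[OF C'(2) that], of ?d \<psi>] bspec[OF C'(4) that] restrict_apply'[OF that] by metis
  have "\<exists>j\<in>Hom A R' C'. \<forall>x\<in>carrier R'. ?c (j x) = h' x" if "(R', h') \<in> insert t T" for R' h'
  proof (cases "(R', h') = t")
    case True
    then have eq: "R' = R" "h' = h" using t by auto
    let ?j = "compose (carrier R) \<phi> (\<lambda>y\<in>carrier R. (\<zero>\<^bsub>C\<^esub>, y))"
    have "?j \<in> Hom A R C'" by (rule Hom_comp[OF ip(2) C'(2) rR])
    moreover have "?c (?j x) = h x" if x: "x \<in> carrier R" for x
    proof -
      have "?j x = \<phi> (\<zero>\<^bsub>C\<^esub>, x)" using x by (simp add: compose_eq)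
      moreover have "?c (\<phi> (\<zero>\<^bsub>C\<^esub>, x)) = h x"
        using c'_\<phi>[of "(\<zero>\<^bsub>C\<^esub>, x)"] x Hom_zero[OF C(3) rC rM] Hom_closed[OF R(2) x] by simp
      ultimately show ?thesis by metis
    qed
    ultimately show ?thesis unfolding eq by (intro bexI[of _ ?j] ballI)
  next
    case False
    then have T: "(R', h') \<in> T" using that by blast
    have R': "R' \<in> Y" and h': "h' \<in> Hom A R' M" using insert.prems T by blast+
    note rR' = fdmodD(1)[OF Y[OF R']]
    obtain j where j: "j \<in> Hom A R' C" "\<forall>x\<in>carrier R'. c (j x) = h' x" using C(4)[OF T] by blast
    let ?j = "compose (carrier R') \<phi> (compose (carrier R') (\<lambda>x\<in>carrier C. (x, \<zero>\<^bsub>R\<^esub>)) j)"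
    have "?j \<in> Hom A R' C'" by (rule Hom_comp[OF Hom_comp[OF j(1) ip(1) rR'] C'(2) rR'])
    moreover have "?c (?j x) = h' x" if x: "x \<in> carrier R'" for x
    proof -
      have "?j x = \<phi> (j x, \<zero>\<^bsub>R\<^esub>)" using x Hom_closed[OF j(1) x] by (simp add: compose_eq)
      moreover have "?c (\<phi> (j x, \<zero>\<^bsub>R\<^esub>)) = h' x"
        using c'_\<phi>[of "(j x, \<zero>\<^bsub>R\<^esub>)"] x Hom_zero[OF R(2) rR rM] Hom_closed[OF j(1) x] j(2) Hom_closed[OF h' x] by simp
      ultimately show ?thesis by metis
    qed
    ultimately show ?thesis by (intro bexI[of _ ?j] ballI)
  qed
  then show ?case using C'(1) it c' by blast
qed

text \<open>
  The existence of \<open>Y\<close>-approximations: it suffices to hit spanning sets of the finite-dimensional spaces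
  \<open>Hom(R, M)\<close>, because the maps that factor through \<open>c\<close> form a subspace.
\<close>

lemma approximation:
  assumes M: "fdmod M" and Y: "finite Y" "\<And>R. R \<in> Y \<Longrightarrow> fdmod R"
  obtains C :: "('k, 'a) rmod" and c where "fdmod C" "id_thru A Y C" "c \<in> Hom A C M"
    "\<forall>R\<in>Y. \<forall>h\<in>Hom A R M. \<exists>j\<in>Hom A R C. \<forall>x\<in>carrier R. c (j x) = h x"
proof -
  note rM = fdmodD(1)[OF M]
  interpret M: right_module A M by (rule rM)
  have "\<exists>B. finite B \<and> B \<subseteq> Hom A R M \<and>
      (\<forall>U. submodule K U (hom_space A R M) \<and> B \<subseteq> U \<longrightarrow> U = Hom A R M)" if "R \<in> Y" for R
    by (rule fd_spaceE[OF fd_hom_space[OF Y(2)[OF that] M]]) auto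
  then obtain B where B: "\<And>R. R \<in> Y \<Longrightarrow> finite (B R) \<and> B R \<subseteq> Hom A R M \<and>
      (\<forall>U. submodule K U (hom_space A R M) \<and> B R \<subseteq> U \<longrightarrow> U = Hom A R M)" by metis
  have "finite (Sigma Y B)" using Y(1) B by (intro finite_SigmaI) auto
  moreover have "R \<in> Y \<and> h \<in> Hom A R M" if "(R, h) \<in> Sigma Y B" for R h using that B by blast
  ultimately obtain C :: "('k, 'a) rmod" and c where C: "fdmod C" "id_thru A Y C" "c \<in> Hom A C M"
    "\<forall>(R, h)\<in>Sigma Y B. \<exists>j\<in>Hom A R C. \<forall>x\<in>carrier R. c (j x) = h x"
    using approximation_finite[OF M Y(2), of Y "Sigma Y B"] by blast
  note rC = fdmodD(1)[OF C(1)]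
  interpret C: right_module A C by (rule rC)
  have "\<exists>j\<in>Hom A R C. \<forall>x\<in>carrier R. c (j x) = h x" if R: "R \<in> Y" and h: "h \<in> Hom A R M" for R h
  proof -
    note rR = fdmodD(1)[OF Y(2)[OF R]]
    let ?U = "{h \<in> Hom A R M. \<exists>j\<in>Hom A R C. \<forall>x\<in>carrier R. c (j x) = h x}"
    interpret HC: vectorspace K "hom_space A R C" by (rule vectorspace_hom_space[OF rR rC])
    interpret HM: vectorspace K "hom_space A R M" by (rule vectorspace_hom_space[OF rR rM])
    have "submodule K ?U (hom_space A R M)"
      unfolding submodule_def
    proof (intro conjI allI impI)
      show "Module.module K (hom_space A R M)" by (rule HM.module_axioms)
      show "?U \<subseteq> carrier (hom_space A R M)" by auto
      fix v w assume v: "v \<in> ?U" and w: "w \<in> ?U"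
      then obtain j j' where j: "j \<in> Hom A R C" "\<forall>x\<in>carrier R. c (j x) = v x"
        and j': "j' \<in> Hom A R C" "\<forall>x\<in>carrier R. c (j' x) = w x" by blast
      have "(\<lambda>x\<in>carrier R. j x \<oplus>\<^bsub>C\<^esub> j' x) \<in> Hom A R C" by (rule Hom_plus[OF j(1) j'(1) rR rC])
      moreover have "(\<lambda>x\<in>carrier R. v x \<oplus>\<^bsub>M\<^esub> w x) \<in> Hom A R M"
        by (rule Hom_plus) (use v w rR rM in auto)
      ultimately show "v \<oplus>\<^bsub>hom_space A R M\<^esub> w \<in> ?U" using j(2) j'(2)
        by (auto intro!: bexI[of _ "\<lambda>x\<in>carrier R. j x \<oplus>\<^bsub>C\<^esub> j' x"] simp: Hom_add[OF C(3)] Hom_closed[OF j(1)] Hom_closed[OF j'(1)])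
    next
      show "\<zero>\<^bsub>hom_space A R M\<^esub> \<in> ?U"
        using Hom_zero_map[OF rR rM] Hom_zero_map[OF rR rC] Hom_zero[OF C(3) rC rM]
        by (auto intro!: bexI[of _ "\<lambda>x\<in>carrier R. \<zero>\<^bsub>C\<^esub>"])
    next
      fix k v assume k: "k \<in> carrier K" and v: "v \<in> ?U"
      then obtain j where j: "j \<in> Hom A R C" "\<forall>x\<in>carrier R. c (j x) = v x" by blast
      have "k \<odot>\<^bsub>hom_space A R C\<^esub> j \<in> Hom A R C" "k \<odot>\<^bsub>hom_space A R M\<^esub> v \<in> Hom A R M"
        using HC.smult_closed[OF k, of j] HM.smult_closed[OF k, of v] j(1) v by auto
      then show "k \<odot>\<^bsub>hom_space A R M\<^esub> v \<in> ?U" using j k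
        by (auto intro!: bexI[of _ "k \<odot>\<^bsub>hom_space A R C\<^esub> j"] simp: Hom_act[OF C(3)] Hom_closed[OF j(1)])
    qed
    moreover have "B R \<subseteq> ?U"
    proof
      fix b assume b: "b \<in> B R"
      then have "(R, b) \<in> Sigma Y B" using R by simp
      then have "\<exists>j\<in>Hom A R C. \<forall>x\<in>carrier R. c (j x) = b x" using C(4) by fast
      moreover have "b \<in> Hom A R M" using B[OF R] b by (elim conjE) (rule subsetD)
      ultimately show "b \<in> ?U" by simp
    qed
    moreover have imp: "\<forall>U. submodule K U (hom_space A R M) \<and> B R \<subseteq> U \<longrightarrow> U = Hom A R M"
      using B[OF R] by (elim conjE)
    ultimately have "?U = Hom A R M" by (intro imp[rule_format] conjI)
    then have "h \<in> ?U" using h by simp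
    then show ?thesis by simp
  qed
  then have "\<forall>R\<in>Y. \<forall>h\<in>Hom A R M. \<exists>j\<in>Hom A R C. \<forall>x\<in>carrier R. c (j x) = h x"
    by (intro ballI)
  then show thesis by (rule that[OF C(1-3)])
qed

section \<open>Surjectivity of approximations\<close>

lemma regular_module_simps [simp]:
  "carrier (regular_module A) = carrier A" "\<zero>\<^bsub>regular_module A\<^esub> = \<zero>\<^bsub>A\<^esub>"
  "x \<oplus>\<^bsub>regular_module A\<^esub> y = x \<oplus>\<^bsub>A\<^esub> y" "a \<odot>\<^bsub>regular_module A\<^esub> x = x \<otimes>\<^bsub>A\<^esub> a"
  by (simp_all add: regular_module_def)

lemma right_module_regular: "right_module A (regular_module A)"
proof -
  have am: "abelian_monoid A" and ag: "abelian_group A"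
    using A.ring_axioms by (simp_all add: ring_def abelian_group_def)
  show ?thesis
    by (rule right_moduleI)
      (auto simp: A.ring_axioms A.m_assoc A.l_distr A.r_distr abelian_monoid.a_assoc[OF am]
        abelian_monoid.a_comm[OF am] abelian_monoid.a_lcomm[OF am] A.r_minus abelian_group.r_neg[OF ag])
qed

lemma Hom_regular:
  assumes "right_module A M" "x \<in> carrier M"
  shows "(\<lambda>a\<in>carrier A. a \<odot>\<^bsub>M\<^esub> x) \<in> Hom A (regular_module A) M"
proof -
  interpret M: right_module A M by fact
  have "restrict (\<lambda>a. a \<odot>\<^bsub>M\<^esub> x) (carrier (regular_module A)) \<in> Hom A (regular_module A) M"
    by (rule restrict_HomI[OF right_module_regular])
      (simp_all add: M.act_closed assms(2) M.act_add_ring M.act_assoc)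
  then show ?thesis by simp
qed

text \<open>
  An element of a finite direct sum is the sum of its coordinates.
\<close>

lemma dsum_fam_image_induct:
  assumes "finite Q" "\<And>P. P \<in> Q \<Longrightarrow> right_module A (N P)" and g: "g \<in> Hom A (dsum_fam Q N) M"
    and "right_module A M" "subm A M U"
    and "\<And>P y. \<lbrakk>P \<in> Q; y \<in> carrier (N P)\<rbrakk> \<Longrightarrow> g (\<lambda>i\<in>Q. if i = P then y else \<zero>\<^bsub>N i\<^esub>) \<in> U"
    and "z \<in> carrier (dsum_fam Q N)"
  shows "g z \<in> U"
proof -
  have rD: "right_module A (dsum_fam Q N)"
    by (rule right_module_dsum_fam[OF A.ring_axioms]) (rule assms(2))
  have ag: "abelian_group (N i)" if "i \<in> Q" for i using assms(2)[OF that] by (simp add: right_module_def)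
  note am = abelian_group.axioms(1)[OF ag]
  have "g (\<lambda>i\<in>Q. if i \<in> S then z i else \<zero>\<^bsub>N i\<^esub>) \<in> U" if "S \<subseteq> Q" for S
    using finite_subset[OF that assms(1)] that
  proof (induction S rule: finite_induct)
    case empty
    have "(\<lambda>i\<in>Q. if i \<in> {} then z i else \<zero>\<^bsub>N i\<^esub>) = \<zero>\<^bsub>dsum_fam Q N\<^esub>" by simp
    then show ?case using Hom_zero[OF g rD assms(4)] assms(5) unfolding subm_def by metis
  next
    case (insert P S)
    let ?w = "\<lambda>i\<in>Q. if i \<in> S then z i else \<zero>\<^bsub>N i\<^esub>" and ?u = "\<lambda>i\<in>Q. if i = P then z P else \<zero>\<^bsub>N i\<^esub>"
    have zc: "z i \<in> carrier (N i)" if "i \<in> Q" for i using assms(7) that by auto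
    have c: "?w \<in> carrier (dsum_fam Q N)" "?u \<in> carrier (dsum_fam Q N)"
      using zc abelian_monoid.zero_closed[OF am] insert.prems by auto
    have eq: "(\<lambda>i\<in>Q. if i \<in> insert P S then z i else \<zero>\<^bsub>N i\<^esub>) = ?u \<oplus>\<^bsub>dsum_fam Q N\<^esub> ?w"
      unfolding dsum_fam_simps
      by (rule restrict_ext) (use insert.hyps zc in \<open>auto simp: abelian_monoid.l_zero[OF am] abelian_monoid.r_zero[OF am] abelian_monoid.zero_closed[OF am]\<close>)
    have gs: "g (?u \<oplus>\<^bsub>dsum_fam Q N\<^esub> ?w) = g ?u \<oplus>\<^bsub>M\<^esub> g ?w" by (rule Hom_add[OF g c(2,1)])
    have gu: "g ?u \<in> U" using assms(6)[of P "z P"] zc insert.prems by blast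
    have gw: "g ?w \<in> U" using insert.IH insert.prems by blast
    have "g ?u \<oplus>\<^bsub>M\<^esub> g ?w \<in> U"
      using assms(5) gu gw unfolding subm_def by blast
    then show ?case unfolding eq gs .
  qed
  from this[OF order_refl] have "g (\<lambda>i\<in>Q. z i) \<in> U" by (simp cong: restrict_cong)
  moreover have "(\<lambda>i\<in>Q. z i) = z" using assms(7) by (auto simp: PiE_def extensional_restrict)
  ultimately show ?thesis by simp
qed

text \<open>
  A map out of the regular module is determined by the image of \<open>1\<close>, which may be prescribed; so choose
  a preimage of \<open>h (p 1)\<close> and restrict along \<open>i\<close>.
\<close>

lemma regular_summand_projective:
  assumes "P \<in> fg_modules A" and i: "i \<in> Hom A P (regular_module A)" and p: "p \<in> Hom A (regular_module A) P"
    and pi: "\<And>x. x \<in> carrier P \<Longrightarrow> p (i x) = x"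
  shows "projective A P"
  unfolding projective_def
proof (intro conjI ballI impI)
  show "P \<in> fg_modules A" by fact
  fix N L g h assume N: "N \<in> fg_modules A" and L: "L \<in> fg_modules A" and g: "g \<in> Hom A N L"
    and surj: "g ` carrier N = carrier L" and h: "h \<in> Hom A P L"
  note rP = fdmodD(1)[OF assms(1)[unfolded fg_modules_iff]] and rN = fdmodD(1)[OF N[unfolded fg_modules_iff]]
    and rL = fdmodD(1)[OF L[unfolded fg_modules_iff]]
  interpret L: right_module A L by (rule rL)
  have p1: "p \<one>\<^bsub>A\<^esub> \<in> carrier P" using Hom_closed[OF p] by simp
  obtain n where n: "n \<in> carrier N" "g n = h (p \<one>\<^bsub>A\<^esub>)"
    using Hom_closed[OF h p1] unfolding surj[symmetric] by (elim imageE) (rule that, simp_all)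
  let ?l = "\<lambda>a\<in>carrier A. a \<odot>\<^bsub>N\<^esub> n"
  have l: "?l \<in> Hom A (regular_module A) N" by (rule Hom_regular[OF rN n(1)])
  have gl: "g (?l a) = h (p a)" if a: "a \<in> carrier A" for a
  proof -
    have "p (a \<odot>\<^bsub>regular_module A\<^esub> \<one>\<^bsub>A\<^esub>) = a \<odot>\<^bsub>P\<^esub> p \<one>\<^bsub>A\<^esub>" using Hom_act[OF p a] by simp
    then have "p a = a \<odot>\<^bsub>P\<^esub> p \<one>\<^bsub>A\<^esub>" using a by simp
    then show ?thesis using a n Hom_act[OF g a n(1)] Hom_act[OF h a p1] by simp
  qed
  have "compose (carrier P) g (compose (carrier P) ?l i) = h"
    by (rule Hom_eqI[OF Hom_comp[OF Hom_comp[OF i l rP] g rP] h])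
      (use gl Hom_closed[OF i] pi in \<open>simp add: compose_eq\<close>)
  then show "\<exists>h'\<in>Hom A P N. compose (carrier P) g h' = h" using Hom_comp[OF i l rP] by blast
qed

text \<open>
  An element \<open>x\<close> of \<open>M\<close> is the image of \<open>1\<close> under a map from the regular module. The regular module is a
  direct sum of indecomposable projectives, these occur in \<open>X\<close>, and every map from a member of \<open>X\<close> factors
  through \<open>c\<close>.
\<close>

lemma approximation_surj:
  assumes "basic A" and X: "\<And>P. \<lbrakk>indecomposable A P; projective A P\<rbrakk> \<Longrightarrow> \<exists>R\<in>X. isomorphic A P R"
    and fX: "\<And>R. R \<in> X \<Longrightarrow> fdmod R"
    and M: "fdmod M" and C: "fdmod C" and c: "c \<in> Hom A C M"
    and lift: "\<forall>R\<in>X. \<forall>h\<in>Hom A R M. \<exists>j\<in>Hom A R C. \<forall>x\<in>carrier R. c (j x) = h x"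
  shows "c ` carrier C = carrier M"
proof
  note rM = fdmodD(1)[OF M] and rC = fdmodD(1)[OF C]
  interpret M: right_module A M by (rule rM)
  show "c ` carrier C \<subseteq> carrier M" using Hom_closed[OF c] by blast
  obtain Q where Q: "finite Q" "\<And>P. P \<in> Q \<Longrightarrow> indecomposable A P"
    "isomorphic A (regular_module A) (dsum_fam Q (\<lambda>P. P))"
    using assms(1) unfolding basic_def by blast
  have fgQ: "P \<in> fg_modules A" if "P \<in> Q" for P using Q(2)[OF that] by (simp add: indecomposable_def)
  have rQ: "right_module A P" if "P \<in> Q" for P using fgQ[OF that] by (simp add: fg_modules_iff fdmodD)
  let ?D = "dsum_fam Q (\<lambda>P. P)"
  have rD: "right_module A ?D"
    by (rule right_module_dsum_fam[OF A.ring_axioms]) (rule rQ)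
  obtain \<phi> where \<phi>: "\<phi> \<in> Hom A (regular_module A) ?D" "bij_betw \<phi> (carrier (regular_module A)) (carrier ?D)"
    using Q(3) unfolding isomorphic_def by metis
  obtain \<psi> where \<psi>: "\<psi> \<in> Hom A ?D (regular_module A)" "bij_betw \<psi> (carrier ?D) (carrier (regular_module A))"
      "\<forall>x\<in>carrier (regular_module A). \<psi> (\<phi> x) = x" "\<forall>y\<in>carrier ?D. \<phi> (\<psi> y) = y"
    by (rule Hom_inverse[OF \<phi>(1) right_module_regular rD \<phi>(2)])
  show "carrier M \<subseteq> c ` carrier C"
  proof
    fix x assume x: "x \<in> carrier M"
    let ?l = "\<lambda>a\<in>carrier A. a \<odot>\<^bsub>M\<^esub> x"
    have l: "?l \<in> Hom A (regular_module A) M" by (rule Hom_regular[OF rM x])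
    let ?g = "compose (carrier ?D) ?l \<psi>"
    have g: "?g \<in> Hom A ?D M" by (rule Hom_comp[OF \<psi>(1) l rD])
    have o: "\<one>\<^bsub>A\<^esub> \<in> carrier (regular_module A)" by simp
    have "?g (\<phi> \<one>\<^bsub>A\<^esub>) \<in> c ` carrier C"
    proof (rule dsum_fam_image_induct[OF Q(1) rQ g rM subm_image[OF c rC rM] _ Hom_closed[OF \<phi>(1) o]])
      fix P y assume P: "P \<in> Q" and y: "y \<in> carrier P"
      let ?pr = "\<lambda>x\<in>carrier ?D. x P" and ?in = "\<lambda>x\<in>carrier P. (\<lambda>i\<in>Q. if i = P then x else \<zero>\<^bsub>i\<^esub>)"
      have pr: "?pr \<in> Hom A ?D P" and inj: "?in \<in> Hom A P ?D"
        using Hom_dsum_fam[of A Q "\<lambda>P. P" P, OF A.ring_axioms rQ P] by blast+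
      have "projective A P"
      proof (rule regular_summand_projective[OF fgQ[OF P] Hom_comp[OF inj \<psi>(1) rQ[OF P]] Hom_comp[OF \<phi>(1) pr right_module_regular]])
        fix z assume z: "z \<in> carrier P"
        have "\<psi> (?in z) \<in> carrier (regular_module A)" by (rule Hom_closed[OF \<psi>(1) Hom_closed[OF inj z]])
        then have "compose (carrier (regular_module A)) ?pr \<phi> (\<psi> (?in z)) = ?pr (\<phi> (\<psi> (?in z)))"
          by (rule compose_eq)
        also have "\<phi> (\<psi> (?in z)) = ?in z" using \<psi>(4) Hom_closed[OF inj z] by blast
        also have "?pr (?in z) = z" using Hom_closed[OF inj z] z P by simp
        finally show "compose (carrier (regular_module A)) ?pr \<phi> (compose (carrier P) \<psi> ?in z) = z"
          using compose_eq[OF z, of \<psi> ?in] by metis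
      qed
      then obtain R where R: "R \<in> X" "isomorphic A P R" using X Q(2)[OF P] by blast
      obtain \<alpha> where \<alpha>: "\<alpha> \<in> Hom A P R" "bij_betw \<alpha> (carrier P) (carrier R)"
        using R(2) unfolding isomorphic_def by metis
      obtain \<beta> where \<beta>: "\<beta> \<in> Hom A R P" "bij_betw \<beta> (carrier R) (carrier P)"
          "\<forall>x\<in>carrier P. \<beta> (\<alpha> x) = x" "\<forall>y\<in>carrier R. \<alpha> (\<beta> y) = y"
        by (rule Hom_inverse[OF \<alpha>(1) rQ[OF P] fdmodD(1)[OF fX[OF R(1)]] \<alpha>(2)])
      note rR = fdmodD(1)[OF fX[OF R(1)]]
      let ?h = "compose (carrier R) ?g (compose (carrier R) ?in \<beta>)"
      have h: "?h \<in> Hom A R M" by (rule Hom_comp[OF Hom_comp[OF \<beta>(1) inj rR] g rR])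
      obtain j where j: "j \<in> Hom A R C" "\<forall>x\<in>carrier R. c (j x) = ?h x" using lift R(1) h by blast
      have \<alpha>y: "\<alpha> y \<in> carrier R" by (rule Hom_closed[OF \<alpha>(1) y])
      have "c (j (\<alpha> y)) = ?h (\<alpha> y)" using j(2) \<alpha>y by blast
      also have "\<dots> = ?g (?in (\<beta> (\<alpha> y)))" using \<alpha>y by (simp add: compose_eq)
      also have "\<beta> (\<alpha> y) = y" using \<beta>(3) y by blast
      also have "?in y = (\<lambda>i\<in>Q. if i = P then y else \<zero>\<^bsub>i\<^esub>)" using y by simp
      finally show "?g (\<lambda>i\<in>Q. if i = P then y else \<zero>\<^bsub>i\<^esub>) \<in> c ` carrier C"
        using Hom_closed[OF j(1) \<alpha>y] by (metis image_eqI)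
    qed
    moreover have "?g (\<phi> \<one>\<^bsub>A\<^esub>) = x"
    proof -
      have "?g (\<phi> \<one>\<^bsub>A\<^esub>) = ?l (\<psi> (\<phi> \<one>\<^bsub>A\<^esub>))" by (rule compose_eq[OF Hom_closed[OF \<phi>(1) o]])
      also have "\<psi> (\<phi> \<one>\<^bsub>A\<^esub>) = \<one>\<^bsub>A\<^esub>" using \<psi>(3) o by blast
      also have "?l \<one>\<^bsub>A\<^esub> = x" using M.act_one[OF x] by simp
      finally show ?thesis .
    qed
    ultimately show "x \<in> c ` carrier C" by simp
  qed
qed

end

section \<open>Composition of homomorphisms\<close>

lemma comp_assoc:
  assumes "f \<in> Hom A M N"
  shows "compose (carrier M) h (compose (carrier M) g f) = compose (carrier M) (compose (carrier N) h g) f"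
  by (rule ext) (simp add: compose_def Hom_closed[OF assms])

lemma comp_add_left:
  assumes "h \<in> Hom A M N"
  shows "compose (carrier M) (\<lambda>x\<in>carrier N. f x \<oplus>\<^bsub>L\<^esub> g x) h =
    (\<lambda>x\<in>carrier M. compose (carrier M) f h x \<oplus>\<^bsub>L\<^esub> compose (carrier M) g h x)"
  by (rule ext) (simp add: compose_def Hom_closed[OF assms])

lemma comp_add_right:
  assumes "k \<in> Hom A N L" "f \<in> Hom A M N" "g \<in> Hom A M N"
  shows "compose (carrier M) k (\<lambda>x\<in>carrier M. f x \<oplus>\<^bsub>N\<^esub> g x) =
    (\<lambda>x\<in>carrier M. compose (carrier M) k f x \<oplus>\<^bsub>L\<^esub> compose (carrier M) k g x)"
  by (rule ext) (simp add: compose_def Hom_closed[OF assms(2)] Hom_closed[OF assms(3)] Hom_add[OF assms(1)])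

lemma comp_zero_left:
  assumes "h \<in> Hom A M N"
  shows "compose (carrier M) (\<lambda>x\<in>carrier N. \<zero>\<^bsub>L\<^esub>) h = (\<lambda>x\<in>carrier M. \<zero>\<^bsub>L\<^esub>)"
  by (rule ext) (simp add: compose_def Hom_closed[OF assms])

lemma comp_zero_right:
  assumes "k \<in> Hom A N L" "right_module A N" "right_module A L"
  shows "compose (carrier M) k (\<lambda>x\<in>carrier M. \<zero>\<^bsub>N\<^esub>) = (\<lambda>x\<in>carrier M. \<zero>\<^bsub>L\<^esub>)"
  by (rule ext) (simp add: compose_def Hom_zero[OF assms])

lemma comp_id_left:
  assumes "f \<in> Hom A M N"
  shows "compose (carrier M) (\<lambda>x\<in>carrier N. x) f = f"
  by (rule extensionalityI[of _ "carrier M"])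
    (auto simp: compose_def Hom_closed[OF assms] Hom_extensional[OF assms])

lemma comp_id_right:
  assumes "f \<in> Hom A M N"
  shows "compose (carrier M) f (\<lambda>x\<in>carrier M. x) = f"
  by (rule extensionalityI[of _ "carrier M"])
    (auto simp: compose_def Hom_extensional[OF assms])

section \<open>The endomorphism algebra of a generator\<close>

text \<open>
  A module \<open>G\<close> with \<open>add G = add X\<close>. That members of \<open>X\<close> are summands of \<open>G\<close> is recorded by \<open>\<iota>\<close> and \<open>\<pi>\<close>,
  that \<open>G\<close> is a summand of a sum of members of \<open>X\<close> by \<open>id_thru\<close>. In this form no element of \<open>G\<close> has to be
  written as a family.
\<close>

locale add_generator = fd_algebra K A
  for K :: "'k ring" (structure) and A :: "('k, 'a) module" (structure) +
  fixes X :: "('a, 'x) module set" and G :: "('a, 'g) module"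
    and \<iota> :: "('a, 'x) module \<Rightarrow> 'x \<Rightarrow> 'g" and \<pi> :: "('a, 'x) module \<Rightarrow> 'g \<Rightarrow> 'x"
  assumes finX: "finite X" and fdX: "\<And>R. R \<in> X \<Longrightarrow> fdmod R"
    and fdG: "fdmod G"
    and \<iota>: "\<And>R. R \<in> X \<Longrightarrow> \<iota> R \<in> Hom A R G" and \<pi>: "\<And>R. R \<in> X \<Longrightarrow> \<pi> R \<in> Hom A G R"
    and \<pi>\<iota>: "\<And>R x. \<lbrakk>R \<in> X; x \<in> carrier R\<rbrakk> \<Longrightarrow> \<pi> R (\<iota> R x) = x"
    and G_thru: "id_thru A X G"
begin

lemmas rG = fdmodD(1)[OF fdG]
lemmas rX = fdmodD(1)[OF fdX]

abbreviation \<Gamma> :: "('k, 'g \<Rightarrow> 'g) module" where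
  "\<Gamma> \<equiv> op_algebra (End_algebra A G)"

lemma \<Gamma>_simps [simp]:
  "carrier \<Gamma> = Hom A G G" "\<one>\<^bsub>\<Gamma>\<^esub> = (\<lambda>x\<in>carrier G. x)" "\<zero>\<^bsub>\<Gamma>\<^esub> = (\<lambda>x\<in>carrier G. \<zero>\<^bsub>G\<^esub>)"
  "f \<oplus>\<^bsub>\<Gamma>\<^esub> g = (\<lambda>x\<in>carrier G. f x \<oplus>\<^bsub>G\<^esub> g x)" "f \<otimes>\<^bsub>\<Gamma>\<^esub> g = compose (carrier G) g f"
  "c \<odot>\<^bsub>\<Gamma>\<^esub> f = (\<lambda>x\<in>carrier G. (c \<odot>\<^bsub>A\<^esub> \<one>\<^bsub>A\<^esub>) \<odot>\<^bsub>G\<^esub> f x)"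
  by (simp_all add: op_algebra_def End_algebra_def hom_space_def)

lemma module_\<Gamma>: "Module.module K \<Gamma>"
proof -
  interpret HS: vectorspace K "hom_space A G G" by (rule vectorspace_hom_space[OF rG rG])
  show ?thesis
    using HS.module_axioms
    by (simp add: Module.module_def module_axioms_def abelian_group_def abelian_monoid_def
        abelian_group_axioms_def op_algebra_def End_algebra_def)
qed

lemma ring_\<Gamma>: "ring \<Gamma>"
proof -
  interpret HS: Module.module K \<Gamma> by (rule module_\<Gamma>)
  show ?thesis
  proof (rule ringI)
    show "abelian_group \<Gamma>" by (rule HS.abelian_group_axioms)
    show "Group.monoid \<Gamma>"
      by (rule monoidI)
        (simp_all add: Hom_comp[OF _ _ rG] Hom_id[OF rG] comp_assoc comp_id_left comp_id_right)
    show "(x \<oplus>\<^bsub>\<Gamma>\<^esub> y) \<otimes>\<^bsub>\<Gamma>\<^esub> z = x \<otimes>\<^bsub>\<Gamma>\<^esub> z \<oplus>\<^bsub>\<Gamma>\<^esub> y \<otimes>\<^bsub>\<Gamma>\<^esub> z"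
      if "x \<in> carrier \<Gamma>" "y \<in> carrier \<Gamma>" "z \<in> carrier \<Gamma>" for x y z
      using that by (simp add: comp_add_right[where A = A and N = G and L = G])
    show "z \<otimes>\<^bsub>\<Gamma>\<^esub> (x \<oplus>\<^bsub>\<Gamma>\<^esub> y) = z \<otimes>\<^bsub>\<Gamma>\<^esub> x \<oplus>\<^bsub>\<Gamma>\<^esub> z \<otimes>\<^bsub>\<Gamma>\<^esub> y"
      if "x \<in> carrier \<Gamma>" "y \<in> carrier \<Gamma>" "z \<in> carrier \<Gamma>" for x y z
      using that by (simp add: comp_add_left[where A = A and N = G])
  qed
qed

sublocale \<Gamma>: fd_algebra K \<Gamma>
proof (intro fd_algebra.intro fd_algebra_axioms.intro)
  show "field K" by (rule field_axioms)
  show "Module.module K \<Gamma>" by (rule module_\<Gamma>)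
  show "ring \<Gamma>" by (rule ring_\<Gamma>)
  interpret G: right_module A G by (rule rG)
  show "(c \<odot>\<^bsub>\<Gamma>\<^esub> x) \<otimes>\<^bsub>\<Gamma>\<^esub> y = c \<odot>\<^bsub>\<Gamma>\<^esub> (x \<otimes>\<^bsub>\<Gamma>\<^esub> y)"
    if "c \<in> carrier K" "x \<in> carrier \<Gamma>" "y \<in> carrier \<Gamma>" for c x y
    unfolding \<Gamma>_simps by (rule ext) (use that in \<open>simp add: compose_def Hom_closed Hom_act\<close>)
  show "x \<otimes>\<^bsub>\<Gamma>\<^esub> (c \<odot>\<^bsub>\<Gamma>\<^esub> y) = c \<odot>\<^bsub>\<Gamma>\<^esub> (x \<otimes>\<^bsub>\<Gamma>\<^esub> y)"
    if "c \<in> carrier K" "x \<in> carrier \<Gamma>" "y \<in> carrier \<Gamma>" for c x y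
    unfolding \<Gamma>_simps by (rule ext) (use that in \<open>simp add: compose_def Hom_closed\<close>)
  show "\<exists>B. finite B \<and> B \<subseteq> carrier \<Gamma> \<and> lin_span K \<Gamma> B = carrier \<Gamma>"
  proof -
    interpret HS: vectorspace K "hom_space A G G" by (rule vectorspace_hom_space[OF rG rG])
    obtain B where B: "finite B" "B \<subseteq> Hom A G G" "HS.span B = Hom A G G"
      using fd_hom_space[OF fdG fdG] unfolding fd_space_def HS.fin_dim_def by auto
    have "lin_span K \<Gamma> B = lin_span K (hom_space A G G) B"
      unfolding lin_span_def finsum_def finprod_def op_algebra_def End_algebra_def by simp
    also have "\<dots> = HS.span B"
      unfolding lin_span_def HS.span_def HS.lincomb_def by (rule refl)
    finally show ?thesis using B by auto
  qed
qed

text \<open>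
  \<open>End G\<close> acts on \<open>Hom(N, G)\<close> from the left by composition, so \<open>\<Gamma> = (End G)\<^sup>o\<^sup>p\<close> acts from the right.
\<close>

definition H :: "('a, 'm) module \<Rightarrow> ('g \<Rightarrow> 'g, 'm \<Rightarrow> 'g) module" where
  "H N = \<lparr>carrier = Hom A N G, mult = undefined, one = undefined,
     ring.zero = (\<lambda>x\<in>carrier N. \<zero>\<^bsub>G\<^esub>),
     add = (\<lambda>f g. \<lambda>x\<in>carrier N. f x \<oplus>\<^bsub>G\<^esub> g x),
     smult = (\<lambda>f h. compose (carrier N) f h)\<rparr>"

lemma H_simps [simp]:
  "carrier (H N) = Hom A N G" "\<zero>\<^bsub>H N\<^esub> = (\<lambda>x\<in>carrier N. \<zero>\<^bsub>G\<^esub>)"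
  "f \<oplus>\<^bsub>H N\<^esub> g = (\<lambda>x\<in>carrier N. f x \<oplus>\<^bsub>G\<^esub> g x)" "a \<odot>\<^bsub>H N\<^esub> h = compose (carrier N) a h"
  by (simp_all add: H_def)

lemma right_module_H:
  assumes N: "right_module A N"
  shows "right_module \<Gamma> (H N)"
proof -
  interpret HS: vectorspace K "hom_space A N G" by (rule vectorspace_hom_space[OF N rG])
  interpret G: right_module A G by (rule rG)
  interpret \<Gamma>r: ring \<Gamma> by (rule ring_\<Gamma>)
  show ?thesis
  proof (rule right_moduleI)
    show "ring \<Gamma>" by (rule ring_\<Gamma>)
    show "\<zero>\<^bsub>H N\<^esub> \<in> carrier (H N)" using HS.M.zero_closed by simp
    fix x y z assume x: "x \<in> carrier (H N)" and y: "y \<in> carrier (H N)" and z: "z \<in> carrier (H N)"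
    show "x \<oplus>\<^bsub>H N\<^esub> y \<in> carrier (H N)" using HS.M.a_closed[of x y] x y by simp
    show "(x \<oplus>\<^bsub>H N\<^esub> y) \<oplus>\<^bsub>H N\<^esub> z = x \<oplus>\<^bsub>H N\<^esub> (y \<oplus>\<^bsub>H N\<^esub> z)" using HS.M.a_assoc[of x y z] x y z by simp
    show "x \<oplus>\<^bsub>H N\<^esub> y = y \<oplus>\<^bsub>H N\<^esub> x" using HS.M.a_comm[of x y] x y by simp
    show "\<zero>\<^bsub>H N\<^esub> \<oplus>\<^bsub>H N\<^esub> x = x" using HS.M.l_zero[of x] x by simp
    show "\<one>\<^bsub>\<Gamma>\<^esub> \<odot>\<^bsub>H N\<^esub> x = x" using x by (simp add: comp_id_left)
    show "\<ominus>\<^bsub>\<Gamma>\<^esub> \<one>\<^bsub>\<Gamma>\<^esub> \<odot>\<^bsub>H N\<^esub> x \<oplus>\<^bsub>H N\<^esub> x = \<zero>\<^bsub>H N\<^esub>"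
    proof -
      have x': "x \<in> Hom A N G" using x by simp
      have ag: "abelian_group \<Gamma>" using ring_\<Gamma> by (simp add: ring_def)
      have n: "\<ominus>\<^bsub>\<Gamma>\<^esub> \<one>\<^bsub>\<Gamma>\<^esub> \<oplus>\<^bsub>\<Gamma>\<^esub> \<one>\<^bsub>\<Gamma>\<^esub> = \<zero>\<^bsub>\<Gamma>\<^esub>" by (rule abelian_group.l_neg[OF ag]) (use Hom_id[OF rG] in simp)
      have "\<ominus>\<^bsub>\<Gamma>\<^esub> \<one>\<^bsub>\<Gamma>\<^esub> \<odot>\<^bsub>H N\<^esub> x \<oplus>\<^bsub>H N\<^esub> x = \<ominus>\<^bsub>\<Gamma>\<^esub> \<one>\<^bsub>\<Gamma>\<^esub> \<odot>\<^bsub>H N\<^esub> x \<oplus>\<^bsub>H N\<^esub> \<one>\<^bsub>\<Gamma>\<^esub> \<odot>\<^bsub>H N\<^esub> x"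
        using x' by (simp add: comp_id_left)
      also have "\<dots> = (\<ominus>\<^bsub>\<Gamma>\<^esub> \<one>\<^bsub>\<Gamma>\<^esub> \<oplus>\<^bsub>\<Gamma>\<^esub> \<one>\<^bsub>\<Gamma>\<^esub>) \<odot>\<^bsub>H N\<^esub> x"
        unfolding H_simps \<Gamma>_simps(4) by (rule comp_add_left[OF x', symmetric])
      also have "\<dots> = \<zero>\<^bsub>H N\<^esub>" unfolding n unfolding H_simps \<Gamma>_simps by (rule comp_zero_left[OF x'])
      finally show ?thesis .
    qed
    fix a b assume a: "a \<in> carrier \<Gamma>" and b: "b \<in> carrier \<Gamma>"
    show "a \<odot>\<^bsub>H N\<^esub> x \<in> carrier (H N)" using N a x by (simp add: Hom_comp[where A = A and N = G])
    show "(a \<oplus>\<^bsub>\<Gamma>\<^esub> b) \<odot>\<^bsub>H N\<^esub> x = a \<odot>\<^bsub>H N\<^esub> x \<oplus>\<^bsub>H N\<^esub> b \<odot>\<^bsub>H N\<^esub> x"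
      using x by (simp add: comp_add_left[where A = A and N = G])
    show "a \<odot>\<^bsub>H N\<^esub> (x \<oplus>\<^bsub>H N\<^esub> y) = a \<odot>\<^bsub>H N\<^esub> x \<oplus>\<^bsub>H N\<^esub> a \<odot>\<^bsub>H N\<^esub> y"
      using a x y by (simp add: comp_add_right[where A = A and N = G and L = G])
    show "b \<odot>\<^bsub>H N\<^esub> (a \<odot>\<^bsub>H N\<^esub> x) = (a \<otimes>\<^bsub>\<Gamma>\<^esub> b) \<odot>\<^bsub>H N\<^esub> x"
      using x by (simp add: comp_assoc[where A = A and N = G])
  qed
qed

lemma klinear_hom_space_H:
  assumes N: "right_module A N"
  shows "klinear K (hom_space A N G) (underlying_space \<Gamma> (H N)) (\<lambda>h. h)"
  unfolding klinear_def
proof (intro conjI ballI)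
  interpret G: right_module A G by (rule rG)
  fix c h assume c: "c \<in> carrier K" and h: "h \<in> carrier (hom_space A N G)"
  show "c \<odot>\<^bsub>hom_space A N G\<^esub> h = c \<odot>\<^bsub>underlying_space \<Gamma> (H N)\<^esub> h"
    unfolding hom_space_simps underlying_space_simps H_simps \<Gamma>_simps
    by (rule ext) (use h in \<open>simp add: compose_def Hom_closed\<close>)
qed auto

lemma fdmod_H:
  assumes N: "fdmod N"
  shows "\<Gamma>.fdmod (H N)"
proof -
  note rN = fdmodD(1)[OF N]
  have "fd_space K (underlying_space \<Gamma> (H N))"
    by (rule vdim_iso(1)[OF fd_hom_space[OF N fdG] \<Gamma>.vectorspace_US[OF right_module_H[OF rN]] klinear_hom_space_H[OF rN]])
      (auto simp: bij_betw_def inj_on_def)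
  then show ?thesis using right_module_H[OF rN] by (simp add: \<Gamma>.fdmod_def)
qed

lemma Hom_precomp:
  assumes "f \<in> Hom A N N'" "right_module A N" "right_module A N'"
  shows "(\<lambda>h\<in>Hom A N' G. compose (carrier N) h f) \<in> Hom \<Gamma> (H N') (H N)"
proof -
  have "restrict (\<lambda>h. compose (carrier N) h f) (carrier (H N')) \<in> Hom \<Gamma> (H N') (H N)"
    by (rule restrict_HomI[OF right_module_H[OF assms(3)]])
      (simp_all add: Hom_comp[OF assms(1) _ assms(2)] comp_add_left[OF assms(1)] comp_assoc[OF assms(1)])
  then show ?thesis by simp
qed

lemma Hom_act_on:
  assumes "q \<in> Hom A G C" "right_module A C" "right_module \<Gamma> V" "y \<in> carrier V"
  shows "(\<lambda>h\<in>Hom A C G. compose (carrier G) h q \<odot>\<^bsub>V\<^esub> y) \<in> Hom \<Gamma> (H C) V"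
proof -
  interpret Vm: right_module \<Gamma> V by fact
  have q: "compose (carrier G) h q \<in> carrier \<Gamma>" if "h \<in> Hom A C G" for h
    using Hom_comp[OF assms(1) that rG] by simp
  have "restrict (\<lambda>h. compose (carrier G) h q \<odot>\<^bsub>V\<^esub> y) (carrier (H C)) \<in> Hom \<Gamma> (H C) V"
  proof (rule restrict_HomI[OF right_module_H[OF assms(2)]])
    fix h h' assume h: "h \<in> carrier (H C)" "h' \<in> carrier (H C)"
    show "compose (carrier G) h q \<odot>\<^bsub>V\<^esub> y \<in> carrier V" using Vm.act_closed[OF q assms(4)] h by simp
    have "compose (carrier G) (h \<oplus>\<^bsub>H C\<^esub> h') q = compose (carrier G) h q \<oplus>\<^bsub>\<Gamma>\<^esub> compose (carrier G) h' q"
      using comp_add_left[OF assms(1)] by simp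
    then show "compose (carrier G) (h \<oplus>\<^bsub>H C\<^esub> h') q \<odot>\<^bsub>V\<^esub> y =
        compose (carrier G) h q \<odot>\<^bsub>V\<^esub> y \<oplus>\<^bsub>V\<^esub> compose (carrier G) h' q \<odot>\<^bsub>V\<^esub> y"
      using Vm.act_add_ring[OF q q assms(4)] h by (metis H_simps(1))
  next
    fix a h assume a: "a \<in> carrier \<Gamma>" and h: "h \<in> carrier (H C)"
    have "compose (carrier G) (a \<odot>\<^bsub>H C\<^esub> h) q = compose (carrier G) h q \<otimes>\<^bsub>\<Gamma>\<^esub> a"
      using comp_assoc[OF assms(1), of a h] by simp
    then show "compose (carrier G) (a \<odot>\<^bsub>H C\<^esub> h) q \<odot>\<^bsub>V\<^esub> y = a \<odot>\<^bsub>V\<^esub> (compose (carrier G) h q \<odot>\<^bsub>V\<^esub> y)"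
      using Vm.act_assoc[OF q a assms(4)] h by (metis H_simps(1))
  qed
  then show ?thesis by simp
qed

text \<open>
  The map \<open>h p i\<close> is the multiple of the fixed element \<open>\<iota> i\<close> of \<open>H C\<close> by the element \<open>h p \<pi>\<close> of \<open>\<Gamma>\<close>. So a
  \<open>\<Gamma>\<close>-homomorphism on \<open>H C\<close> is known at all \<open>h p i\<close> once it is known at \<open>\<iota> i\<close>.
\<close>

lemma Hom_H_middle:
  assumes \<phi>: "\<phi> \<in> Hom \<Gamma> (H C) V" and R: "R \<in> X" and i: "i \<in> Hom A C R" and p: "p \<in> Hom A R C"
    and rC: "right_module A C" and h: "h \<in> Hom A C G"
  shows "\<phi> (compose (carrier C) h (compose (carrier C) p i)) =
    compose (carrier G) h (compose (carrier G) p (\<pi> R)) \<odot>\<^bsub>V\<^esub> \<phi> (compose (carrier C) (\<iota> R) i)"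
proof -
  note ii = Hom_comp[OF i \<iota>[OF R] rC] and pp = Hom_comp[OF \<pi>[OF R] p rG]
  have "compose (carrier C) h (compose (carrier C) p i) =
    compose (carrier G) h (compose (carrier G) p (\<pi> R)) \<odot>\<^bsub>H C\<^esub> compose (carrier C) (\<iota> R) i"
    unfolding H_simps
    by (rule ext) (simp add: compose_def Hom_closed[OF i] Hom_closed[OF \<iota>[OF R]] \<pi>\<iota>[OF R])
  moreover have "\<phi> (compose (carrier G) h (compose (carrier G) p (\<pi> R)) \<odot>\<^bsub>H C\<^esub> compose (carrier C) (\<iota> R) i) =
    compose (carrier G) h (compose (carrier G) p (\<pi> R)) \<odot>\<^bsub>V\<^esub> \<phi> (compose (carrier C) (\<iota> R) i)"
    by (rule Hom_act[OF \<phi>]) (use Hom_comp[OF pp h rG] ii in simp_all)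
  ultimately show ?thesis by simp
qed

lemma comp_thru_step:
  assumes "h \<in> Hom A C L" "s \<in> Hom A C C" "i \<in> Hom A C R" "p \<in> Hom A R C"
  shows "compose (carrier C) h (\<lambda>x\<in>carrier C. s x \<oplus>\<^bsub>C\<^esub> p (i x)) =
    (\<lambda>x\<in>carrier C. compose (carrier C) h s x \<oplus>\<^bsub>L\<^esub> compose (carrier C) h (compose (carrier C) p i) x)"
  by (rule ext)
    (simp add: compose_def Hom_add[OF assms(1)] Hom_closed[OF assms(2)] Hom_closed[OF assms(3)] Hom_closed[OF assms(4)])

text \<open>
  Yoneda's lemma for \<open>C\<close> in \<open>add X\<close>. For a map \<open>p i\<close> through \<open>R \<in> X\<close>, the homomorphism \<open>h \<mapsto> \<chi> (h p i)\<close> is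
  composition with \<open>p \<pi> (\<chi> (\<iota> i))\<close>; adding these up along a decomposition of the identity of \<open>C\<close> gives
  \<open>g\<close>.
\<close>

lemma Hom_H_representable:
  assumes C: "fdmod C" "id_thru A X C" and N: "right_module A N" and \<chi>: "\<chi> \<in> Hom \<Gamma> (H C) (H N)"
  shows "\<exists>g\<in>Hom A N C. \<forall>h\<in>Hom A C G. \<chi> h = compose (carrier N) h g"
proof -
  note rC = fdmodD(1)[OF C(1)]
  have claim: "\<exists>g\<in>Hom A N C. \<forall>h\<in>Hom A C G. \<chi> (compose (carrier C) h s) = compose (carrier N) h g"
    if "s \<in> thru A X C C" for s
    using that
  proof induction
    case thru_zero
    have "\<chi> (compose (carrier C) h (\<lambda>x\<in>carrier C. \<zero>\<^bsub>C\<^esub>)) = compose (carrier N) h (\<lambda>x\<in>carrier N. \<zero>\<^bsub>C\<^esub>)"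
      if h: "h \<in> Hom A C G" for h
      unfolding comp_zero_right[OF h rC rG]
      by (rule Hom_zero[OF \<chi> right_module_H[OF rC] right_module_H[OF N], unfolded H_simps])
    then show ?case using Hom_zero_map[OF N rC] by (intro bexI ballI)
  next
    case (thru_step R i p s)
    then obtain g where g: "g \<in> Hom A N C" "\<forall>h\<in>Hom A C G. \<chi> (compose (carrier C) h s) = compose (carrier N) h g"
      by blast
    note s = thru_Hom[OF thru_step(4) rC rC] and R = thru_step(1) and i = thru_step(2) and p = thru_step(3)
    note ii = Hom_comp[OF i \<iota>[OF R] rC] and pp = Hom_comp[OF \<pi>[OF R] p rG]
    have \<chi>i: "\<chi> (compose (carrier C) (\<iota> R) i) \<in> Hom A N G" using Hom_closed[OF \<chi>] ii by simp
    let ?k = "compose (carrier N) (compose (carrier G) p (\<pi> R)) (\<chi> (compose (carrier C) (\<iota> R) i))"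
    have k: "?k \<in> Hom A N C" by (rule Hom_comp[OF \<chi>i pp N])
    let ?g = "\<lambda>x\<in>carrier N. g x \<oplus>\<^bsub>C\<^esub> ?k x"
    have "\<chi> (compose (carrier C) h (\<lambda>x\<in>carrier C. s x \<oplus>\<^bsub>C\<^esub> p (i x))) = compose (carrier N) h ?g"
      if h: "h \<in> Hom A C G" for h
    proof -
      have hs: "compose (carrier C) h s \<in> Hom A C G" and hpi: "compose (carrier C) h (compose (carrier C) p i) \<in> Hom A C G"
        using Hom_comp[OF s h rC] Hom_comp[OF Hom_comp[OF i p rC] h rC] by auto
      have "\<chi> (compose (carrier C) h (\<lambda>x\<in>carrier C. s x \<oplus>\<^bsub>C\<^esub> p (i x))) =
        \<chi> (compose (carrier C) h s \<oplus>\<^bsub>H C\<^esub> compose (carrier C) h (compose (carrier C) p i))"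
        unfolding comp_thru_step[OF h s i p] H_simps ..
      also have "\<dots> = \<chi> (compose (carrier C) h s) \<oplus>\<^bsub>H N\<^esub> \<chi> (compose (carrier C) h (compose (carrier C) p i))"
        using Hom_add[OF \<chi>] hs hpi by simp
      also have "\<chi> (compose (carrier C) h (compose (carrier C) p i)) = compose (carrier N) h ?k"
        unfolding Hom_H_middle[OF \<chi> R i p rC h] H_simps by (rule comp_assoc[OF \<chi>i, symmetric])
      also have "\<chi> (compose (carrier C) h s) = compose (carrier N) h g" using g(2) h by blast
      also have "compose (carrier N) h g \<oplus>\<^bsub>H N\<^esub> compose (carrier N) h ?k = compose (carrier N) h ?g"
        using comp_add_right[OF h g(1) k] by simp
      finally show ?thesis .
    qed
    then show ?case using Hom_plus[OF g(1) k N rC] by (intro bexI ballI)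
  qed
  obtain g where g: "g \<in> Hom A N C"
    "\<forall>h\<in>Hom A C G. \<chi> (compose (carrier C) h (\<lambda>x\<in>carrier C. x)) = compose (carrier N) h g"
    using claim[OF C(2)[unfolded id_thru_def]] by blast
  have "\<chi> h = compose (carrier N) h g" if "h \<in> Hom A C G" for h
    using bspec[OF g(2) that] comp_id_right[OF that] by simp
  then show ?thesis using g(1) by blast
qed

text \<open>
  A module in \<open>add X\<close> embeds into a power of \<open>G\<close>.
\<close>

lemma cogenerated:
  assumes C: "fdmod C" "id_thru A X C" and y: "y \<in> carrier C"
    and z: "\<And>h. h \<in> Hom A C G \<Longrightarrow> h y = \<zero>\<^bsub>G\<^esub>"
  shows "y = \<zero>\<^bsub>C\<^esub>"
proof -
  note rC = fdmodD(1)[OF C(1)]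
  interpret C: right_module A C by (rule rC)
  have "s y = \<zero>\<^bsub>C\<^esub>" if "s \<in> thru A X C C" for s
    using that
  proof induction
    case (thru_step R i p s)
    note R = thru_step(1) and i = thru_step(2) and p = thru_step(3)
    have "\<iota> R (i y) = \<zero>\<^bsub>G\<^esub>" using z[OF Hom_comp[OF i \<iota>[OF R] rC]] y by (simp add: compose_eq)
    then have "i y = \<zero>\<^bsub>R\<^esub>"
      using \<pi>\<iota>[OF R Hom_closed[OF i y]] Hom_zero[OF \<pi>[OF R] rG rX[OF R]] by simp
    then show ?case using thru_step.IH y Hom_zero[OF p rX[OF R] rC] by simp
  qed (use y in simp)
  from this[OF C(2)[unfolded id_thru_def]] show ?thesis using y by simp
qed

lemma cogenerated_eq:
  assumes C: "fdmod C" "id_thru A X C" and xy: "x \<in> carrier C" "y \<in> carrier C"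
    and z: "\<And>h. h \<in> Hom A C G \<Longrightarrow> h x = h y"
  shows "x = y"
proof -
  note rC = fdmodD(1)[OF C(1)]
  interpret C: right_module A C by (rule rC)
  interpret G: right_module A G by (rule rG)
  have "x \<ominus>\<^bsub>C\<^esub> y = \<zero>\<^bsub>C\<^esub>"
  proof (rule cogenerated[OF C])
    show "x \<ominus>\<^bsub>C\<^esub> y \<in> carrier C" using xy by simp
    fix h assume h: "h \<in> Hom A C G"
    show "h (x \<ominus>\<^bsub>C\<^esub> y) = \<zero>\<^bsub>G\<^esub>"
      using Hom_sub[OF h rC rG xy] z[OF h] Hom_closed[OF h xy(2)] by (simp add: a_minus_def G.M.r_neg)
  qed
  then show ?thesis using xy C.M.minus_equality[of x "\<ominus>\<^bsub>C\<^esub> y"] by (simp add: a_minus_def)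
qed

text \<open>
  \<open>H C\<close> is projective for \<open>C\<close> in \<open>add X\<close>. It is enough to lift \<open>h \<mapsto> \<phi> (h p i)\<close>, and for this to choose a
  preimage \<open>y\<close> of the single value \<open>\<phi> (\<iota> i)\<close>. Instead of \<open>d\<close> being onto, the
  values of \<open>\<phi>\<close> are required to lie in its image: below they lie in a syzygy.
\<close>

lemma H_lift:
  assumes C: "fdmod C" "id_thru A X C" and Q: "right_module \<Gamma> Q" and V: "right_module \<Gamma> V"
    and d: "d \<in> Hom \<Gamma> Q V" and \<phi>: "\<phi> \<in> Hom \<Gamma> (H C) V"
    and im: "\<And>h. h \<in> Hom A C G \<Longrightarrow> \<phi> h \<in> d ` carrier Q"
  shows "\<exists>\<psi>\<in>Hom \<Gamma> (H C) Q. \<forall>h\<in>Hom A C G. d (\<psi> h) = \<phi> h"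
proof -
  note rC = fdmodD(1)[OF C(1)] and rHC = right_module_H[OF fdmodD(1)[OF C(1)]]
  interpret Q: right_module \<Gamma> Q by (rule Q)
  have claim: "\<exists>\<psi>\<in>Hom \<Gamma> (H C) Q. \<forall>h\<in>Hom A C G. d (\<psi> h) = \<phi> (compose (carrier C) h s)"
    if "s \<in> thru A X C C" for s
    using that
  proof induction
    case thru_zero
    have "d ((\<lambda>h\<in>carrier (H C). \<zero>\<^bsub>Q\<^esub>) h) = \<phi> (compose (carrier C) h (\<lambda>x\<in>carrier C. \<zero>\<^bsub>C\<^esub>))"
      if h: "h \<in> Hom A C G" for h
    proof -
      have "d ((\<lambda>h\<in>carrier (H C). \<zero>\<^bsub>Q\<^esub>) h) = \<zero>\<^bsub>V\<^esub>" using Hom_zero[OF d Q V] h by simp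
      also have "\<zero>\<^bsub>V\<^esub> = \<phi> (compose (carrier C) h (\<lambda>x\<in>carrier C. \<zero>\<^bsub>C\<^esub>))"
        unfolding comp_zero_right[OF h rC rG] by (rule Hom_zero[OF \<phi> rHC V, unfolded H_simps, symmetric])
      finally show ?thesis .
    qed
    then show ?case using Hom_zero_map[OF rHC Q] by (intro bexI ballI)
  next
    case (thru_step R i p s)
    then obtain \<psi> where \<psi>: "\<psi> \<in> Hom \<Gamma> (H C) Q" "\<forall>h\<in>Hom A C G. d (\<psi> h) = \<phi> (compose (carrier C) h s)"
      by blast
    note s = thru_Hom[OF thru_step(4) rC rC] and R = thru_step(1) and i = thru_step(2) and p = thru_step(3)
    note ii = Hom_comp[OF i \<iota>[OF R] rC] and pp = Hom_comp[OF \<pi>[OF R] p rG]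
    obtain y where y: "y \<in> carrier Q" "d y = \<phi> (compose (carrier C) (\<iota> R) i)"
      using im[OF ii] by (elim imageE) (rule that, simp_all)
    let ?a = "\<lambda>h\<in>Hom A C G. compose (carrier G) h (compose (carrier G) p (\<pi> R)) \<odot>\<^bsub>Q\<^esub> y"
    have a: "?a \<in> Hom \<Gamma> (H C) Q" by (rule Hom_act_on[OF pp rC Q y(1)])
    let ?\<psi> = "\<lambda>h\<in>carrier (H C). \<psi> h \<oplus>\<^bsub>Q\<^esub> ?a h"
    have "d (?\<psi> h) = \<phi> (compose (carrier C) h (\<lambda>x\<in>carrier C. s x \<oplus>\<^bsub>C\<^esub> p (i x)))"
      if h: "h \<in> Hom A C G" for h
    proof -
      have hs: "compose (carrier C) h s \<in> Hom A C G" and hpi: "compose (carrier C) h (compose (carrier C) p i) \<in> Hom A C G"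
        using Hom_comp[OF s h rC] Hom_comp[OF Hom_comp[OF i p rC] h rC] by auto
      have hpp: "compose (carrier G) h (compose (carrier G) p (\<pi> R)) \<in> carrier \<Gamma>" using Hom_comp[OF pp h rG] by simp
      have "\<phi> (compose (carrier C) h (\<lambda>x\<in>carrier C. s x \<oplus>\<^bsub>C\<^esub> p (i x))) =
        \<phi> (compose (carrier C) h s \<oplus>\<^bsub>H C\<^esub> compose (carrier C) h (compose (carrier C) p i))"
        unfolding comp_thru_step[OF h s i p] H_simps ..
      also have "\<dots> = \<phi> (compose (carrier C) h s) \<oplus>\<^bsub>V\<^esub> \<phi> (compose (carrier C) h (compose (carrier C) p i))"
        using Hom_add[OF \<phi>] hs hpi by simp
      also have "\<phi> (compose (carrier C) h (compose (carrier C) p i)) = d (?a h)"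
        unfolding Hom_H_middle[OF \<phi> R i p rC h] using Hom_act[OF d hpp y(1)] h y(2) by simp
      also have "\<phi> (compose (carrier C) h s) = d (\<psi> h)" using \<psi>(2) h by simp
      also have "d (\<psi> h) \<oplus>\<^bsub>V\<^esub> d (?a h) = d (\<psi> h \<oplus>\<^bsub>Q\<^esub> ?a h)"
        by (rule Hom_add[OF d, symmetric]) (use Hom_closed[OF \<psi>(1)] Hom_closed[OF a] h in simp_all)
      finally have "\<phi> (compose (carrier C) h (\<lambda>x\<in>carrier C. s x \<oplus>\<^bsub>C\<^esub> p (i x))) = d (\<psi> h \<oplus>\<^bsub>Q\<^esub> ?a h)" .
      moreover have "?\<psi> h = \<psi> h \<oplus>\<^bsub>Q\<^esub> ?a h" using h by simp
      ultimately show ?thesis by metis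
    qed
    then show ?case using Hom_plus[OF \<psi>(1) a rHC Q] by (intro bexI ballI)
  qed
  obtain \<psi> where \<psi>: "\<psi> \<in> Hom \<Gamma> (H C) Q"
    "\<forall>h\<in>Hom A C G. d (\<psi> h) = \<phi> (compose (carrier C) h (\<lambda>x\<in>carrier C. x))"
    using claim[OF C(2)[unfolded id_thru_def]] by blast
  have "d (\<psi> h) = \<phi> h" if "h \<in> Hom A C G" for h
    using bspec[OF \<psi>(2) that] comp_id_right[OF that] by simp
  then show ?thesis using \<psi>(1) by blast
qed

text \<open>
  For projective \<open>P\<close>, the functor \<open>Hom\<^sub>\<Gamma>(H -, P)\<close> preserves exactness of \<open>C'' \<rightarrow> C \<rightarrow> C'\<close> whenever this
  sequence is exact under all \<open>Hom(R, -)\<close> with \<open>R \<in> X\<close>. Decomposing the identity of \<open>P\<close> reduces this to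
  \<open>P = H R\<close>, where Yoneda's lemma turns \<open>Hom\<^sub>\<Gamma>(H C, H R)\<close> into \<open>Hom(R, C)\<close>.
\<close>

lemma projective_exact:
  assumes P: "\<Gamma>.fdmod P" "id_thru \<Gamma> (H ` X) P"
    and C: "fdmod C" "id_thru A X C" and C': "fdmod C'" "id_thru A X C'" and C'': "fdmod C''"
    and d: "d \<in> Hom A C C'" and d': "d' \<in> Hom A C'' C"
    and ex: "\<And>R g. \<lbrakk>R \<in> X; g \<in> Hom A R C; \<And>x. x \<in> carrier R \<Longrightarrow> d (g x) = \<zero>\<^bsub>C'\<^esub>\<rbrakk> \<Longrightarrow>
      \<exists>f\<in>Hom A R C''. \<forall>x\<in>carrier R. d' (f x) = g x"
    and \<phi>: "\<phi> \<in> Hom \<Gamma> (H C) P" and z: "\<And>h. h \<in> Hom A C' G \<Longrightarrow> \<phi> (compose (carrier C) h d) = \<zero>\<^bsub>P\<^esub>"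
  shows "\<exists>\<omega>\<in>Hom \<Gamma> (H C'') P. \<forall>h\<in>Hom A C G. \<phi> h = \<omega> (compose (carrier C'') h d')"
proof -
  note rP = \<Gamma>.fdmodD(1)[OF P(1)] and rC = fdmodD(1)[OF C(1)] and rC' = fdmodD(1)[OF C'(1)] and rC'' = fdmodD(1)[OF C'']
  interpret P: right_module \<Gamma> P by (rule rP)
  have claim: "\<exists>\<omega>\<in>Hom \<Gamma> (H C'') P. \<forall>h\<in>Hom A C G. s (\<phi> h) = \<omega> (compose (carrier C'') h d')"
    if "s \<in> thru \<Gamma> (H ` X) P P" for s
    using that
  proof induction
    case thru_zero
    have "(\<lambda>x\<in>carrier P. \<zero>\<^bsub>P\<^esub>) (\<phi> h) = (\<lambda>x\<in>carrier (H C''). \<zero>\<^bsub>P\<^esub>) (compose (carrier C'') h d')"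
      if h: "h \<in> Hom A C G" for h
      using Hom_closed[OF \<phi>] h Hom_comp[OF d' h rC''] by simp
    then show ?case using Hom_zero_map[OF right_module_H[OF rC''] rP] by (intro bexI ballI)
  next
    case (thru_step R' i p s)
    then obtain \<omega> where \<omega>: "\<omega> \<in> Hom \<Gamma> (H C'') P" "\<forall>h\<in>Hom A C G. s (\<phi> h) = \<omega> (compose (carrier C'') h d')"
      by blast
    obtain R where R: "R \<in> X" "R' = H R" using thru_step(1) by blast
    have i: "i \<in> Hom \<Gamma> P (H R)" and p: "p \<in> Hom \<Gamma> (H R) P" using thru_step(2,3) R by auto
    have i\<phi>: "compose (carrier (H C)) i \<phi> \<in> Hom \<Gamma> (H C) (H R)"
      by (rule Hom_comp[OF \<phi> i right_module_H[OF rC]])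
    obtain g where g: "g \<in> Hom A R C" "\<forall>h\<in>Hom A C G. compose (carrier (H C)) i \<phi> h = compose (carrier R) h g"
      using Hom_H_representable[OF C rX[OF R(1)] i\<phi>] by blast
    have ig: "i (\<phi> h) = compose (carrier R) h g" if "h \<in> Hom A C G" for h
      using bspec[OF g(2) that] that compose_eq[of h "carrier (H C)" i \<phi>] by simp
    \<comment> \<open>The vanishing of \<open>\<phi>\<close> on all \<open>h d\<close> says \<open>h d g = 0\<close> for all \<open>h : C' \<rightarrow> G\<close>.\<close>
    have "d (g x) = \<zero>\<^bsub>C'\<^esub>" if x: "x \<in> carrier R" for x
    proof (rule cogenerated[OF C'])
      show "d (g x) \<in> carrier C'" by (rule Hom_closed[OF d Hom_closed[OF g(1) x]])
      fix h assume h: "h \<in> Hom A C' G"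
      have hd: "compose (carrier C) h d \<in> Hom A C G" by (rule Hom_comp[OF d h rC])
      have "compose (carrier R) (compose (carrier C) h d) g = (\<lambda>x\<in>carrier R. \<zero>\<^bsub>G\<^esub>)"
        using ig[OF hd] z[OF h] Hom_zero[OF i rP right_module_H[OF rX[OF R(1)]]] by simp
      then have "compose (carrier R) (compose (carrier C) h d) g x = \<zero>\<^bsub>G\<^esub>" using x by simp
      then show "h (d (g x)) = \<zero>\<^bsub>G\<^esub>" using x Hom_closed[OF g(1) x] by (simp add: compose_eq)
    qed
    then obtain f where f: "f \<in> Hom A R C''" "\<forall>x\<in>carrier R. d' (f x) = g x"
      using ex[OF R(1) g(1)] by blast
    have gf: "compose (carrier R) d' f = g"
      by (rule Hom_eqI[OF Hom_comp[OF f(1) d' rX[OF R(1)]] g(1)]) (use f(2) in \<open>simp add: compose_eq\<close>)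
    note fs = Hom_precomp[OF f(1) rX[OF R(1)] rC'']
    let ?k = "compose (carrier (H C'')) p (\<lambda>h\<in>Hom A C'' G. compose (carrier R) h f)"
    have k: "?k \<in> Hom \<Gamma> (H C'') P" by (rule Hom_comp[OF fs p right_module_H[OF rC'']])
    let ?\<omega> = "\<lambda>h\<in>carrier (H C''). \<omega> h \<oplus>\<^bsub>P\<^esub> ?k h"
    have "(\<lambda>x\<in>carrier P. s x \<oplus>\<^bsub>P\<^esub> p (i x)) (\<phi> h) = ?\<omega> (compose (carrier C'') h d')"
      if h: "h \<in> Hom A C G" for h
    proof -
      have hd': "compose (carrier C'') h d' \<in> Hom A C'' G" by (rule Hom_comp[OF d' h rC''])
      have "?k (compose (carrier C'') h d') = p (compose (carrier R) (compose (carrier C'') h d') f)"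
        using hd' by (simp add: compose_eq)
      also have "compose (carrier R) (compose (carrier C'') h d') f = compose (carrier R) h g"
        using comp_assoc[OF f(1), of h d'] gf by simp
      finally have "?k (compose (carrier C'') h d') = p (i (\<phi> h))" unfolding ig[OF h] .
      then show ?thesis using \<omega>(2) h hd' Hom_closed[OF \<phi>, of h] by simp
    qed
    then show ?case using Hom_plus[OF \<omega>(1) k right_module_H[OF rC''] rP] by (intro bexI ballI)
  qed
  obtain \<omega> where \<omega>: "\<omega> \<in> Hom \<Gamma> (H C'') P"
    "\<forall>h\<in>Hom A C G. (\<lambda>x\<in>carrier P. x) (\<phi> h) = \<omega> (compose (carrier C'') h d')"
    using claim[OF P(2)[unfolded id_thru_def]] by blast
  have "\<phi> h = \<omega> (compose (carrier C'') h d')" if "h \<in> Hom A C G" for h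
    using bspec[OF \<omega>(2) that] Hom_closed[OF \<phi>, of h] that by simp
  then show ?thesis using \<omega>(1) by blast
qed

text \<open>
  Approximate \<open>P\<close> by the modules \<open>H R\<close>. The approximation is onto, since \<open>1\<close> is a sum of maps \<open>p i\<close> through
  members of \<open>X\<close> and \<open>v p i\<close> is the value at \<open>p\<close> of the homomorphism \<open>H R \<rightarrow> P\<close> with \<open>h \<mapsto> v (\<iota> i) (h \<pi>)\<close>. So
  it splits.
\<close>

lemma projective_imp_id_thru:
  assumes P: "projective \<Gamma> P"
  shows "id_thru \<Gamma> (H ` X) P"
proof -
  have fP: "\<Gamma>.fdmod P" using P unfolding projective_def \<Gamma>.fg_modules_iff by blast
  note rP = \<Gamma>.fdmodD(1)[OF fP]
  interpret P: right_module \<Gamma> P by (rule rP)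
  have fY: "\<Gamma>.fdmod R" if "R \<in> H ` X" for R using that fdX fdmod_H by blast
  obtain C :: "('k, 'g \<Rightarrow> 'g) rmod" and c where C: "\<Gamma>.fdmod C" "id_thru \<Gamma> (H ` X) C" "c \<in> Hom \<Gamma> C P"
    "\<forall>R\<in>H ` X. \<forall>h\<in>Hom \<Gamma> R P. \<exists>j\<in>Hom \<Gamma> R C. \<forall>x\<in>carrier R. c (j x) = h x"
    by (rule \<Gamma>.approximation[OF fP _ fY]) (use finX in auto)
  note rC = \<Gamma>.fdmodD(1)[OF C(1)]
  note sub = subm_image[OF C(3) rC rP]
  have claim: "s \<odot>\<^bsub>P\<^esub> v \<in> c ` carrier C" if "s \<in> thru A X G G" and v: "v \<in> carrier P" for s v
    using that(1)
  proof induction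
    case thru_zero
    have "(\<lambda>x\<in>carrier G. \<zero>\<^bsub>G\<^esub>) \<odot>\<^bsub>P\<^esub> v = \<zero>\<^bsub>P\<^esub>" using P.act_zero_ring[OF v] by simp
    moreover have "\<zero>\<^bsub>P\<^esub> \<in> c ` carrier C" using sub unfolding subm_def by blast
    ultimately show ?case by metis
  next
    case (thru_step R i p s)
    note s = thru_Hom[OF thru_step(4) rG rG] and R = thru_step(1) and i = thru_step(2) and p = thru_step(3)
    note ii = Hom_comp[OF i \<iota>[OF R] rG]
    let ?w = "compose (carrier G) (\<iota> R) i \<odot>\<^bsub>P\<^esub> v"
    have w: "?w \<in> carrier P" using P.act_closed[OF _ v] ii by simp
    let ?h = "\<lambda>h\<in>Hom A R G. compose (carrier G) h (\<pi> R) \<odot>\<^bsub>P\<^esub> ?w"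
    have h: "?h \<in> Hom \<Gamma> (H R) P" by (rule Hom_act_on[OF \<pi>[OF R] rX[OF R] rP w])
    have "\<exists>j\<in>Hom \<Gamma> (H R) C. \<forall>x\<in>carrier (H R). c (j x) = ?h x"
      using C(4) R h by blast
    then obtain j where j: "j \<in> Hom \<Gamma> (H R) C" "\<forall>x\<in>carrier (H R). c (j x) = ?h x" by blast
    have "?h p = c (j p)" using j(2) p by simp
    then have hp: "?h p \<in> c ` carrier C" using Hom_closed[OF j(1), of p] p by simp
    note pp = Hom_comp[OF \<pi>[OF R] p rG]
    have "compose (carrier G) p i = compose (carrier G) (\<iota> R) i \<otimes>\<^bsub>\<Gamma>\<^esub> compose (carrier G) p (\<pi> R)"
      unfolding \<Gamma>_simps by (rule ext) (simp add: compose_def Hom_closed[OF i] Hom_closed[OF \<iota>[OF R]] \<pi>\<iota>[OF R])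
    then have "compose (carrier G) p i \<odot>\<^bsub>P\<^esub> v = ?h p"
      using P.act_assoc[of "compose (carrier G) (\<iota> R) i" "compose (carrier G) p (\<pi> R)" v] ii pp v p by simp
    moreover have "(\<lambda>x\<in>carrier G. s x \<oplus>\<^bsub>G\<^esub> p (i x)) = s \<oplus>\<^bsub>\<Gamma>\<^esub> compose (carrier G) p i"
      unfolding \<Gamma>_simps by (rule restrict_ext) (simp add: compose_eq)
    ultimately have E: "(\<lambda>x\<in>carrier G. s x \<oplus>\<^bsub>G\<^esub> p (i x)) \<odot>\<^bsub>P\<^esub> v = s \<odot>\<^bsub>P\<^esub> v \<oplus>\<^bsub>P\<^esub> ?h p"
      using P.act_add_ring[of s "compose (carrier G) p i" v] s Hom_comp[OF i p rG] v by (metis \<Gamma>_simps(1))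
    have "s \<odot>\<^bsub>P\<^esub> v \<oplus>\<^bsub>P\<^esub> ?h p \<in> c ` carrier C"
      using sub thru_step.IH hp unfolding subm_def by blast
    then show ?case unfolding E .
  qed
  have "v \<in> c ` carrier C" if v: "v \<in> carrier P" for v
  proof -
    have "\<one>\<^bsub>\<Gamma>\<^esub> \<odot>\<^bsub>P\<^esub> v \<in> c ` carrier C"
      unfolding \<Gamma>_simps by (rule claim[OF G_thru[unfolded id_thru_def] v])
    then show ?thesis unfolding P.act_one[OF v] .
  qed
  then have surj: "c ` carrier C = carrier P" using Hom_closed[OF C(3)] by blast
  have "P \<in> fg_modules \<Gamma>" "C \<in> fg_modules \<Gamma>" using fP C(1) by (simp_all add: \<Gamma>.fg_modules_iff)
  then obtain j where j: "j \<in> Hom \<Gamma> P C" "compose (carrier P) c j = (\<lambda>x\<in>carrier P. x)"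
    using P C(3) surj Hom_id[OF rP] unfolding projective_def by blast
  show ?thesis
    by (rule id_thru_retract[OF C(2,3) j(1) _ rC rP \<Gamma>.fdmodD(1)[OF fY]])
      (use j(2) in \<open>metis compose_eq restrict_apply'\<close>)
qed

text \<open>
  By Yoneda's lemma an idempotent of \<open>H R\<close> is composition with an idempotent of \<open>R\<close>.
\<close>

lemma trivial_idem_H:
  assumes R: "R \<in> X" and triv: "trivial_idem A R"
  shows "trivial_idem \<Gamma> (H R)"
  unfolding trivial_idem_def
proof (intro ballI impI)
  fix e assume e: "e \<in> Hom \<Gamma> (H R) (H R)" and ee: "compose (carrier (H R)) e e = e"
  note rR = rX[OF R] and i = \<iota>[OF R] and p = \<pi>[OF R]
  note rH = right_module_H[OF rX[OF R]]
  have thR: "id_thru A X R"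
  proof -
    have "(\<lambda>x\<in>carrier R. (\<lambda>x\<in>carrier R. \<zero>\<^bsub>R\<^esub>) x \<oplus>\<^bsub>R\<^esub> (\<lambda>x\<in>carrier R. x) ((\<lambda>x\<in>carrier R. x) x)) \<in> thru A X R R"
      by (rule thru_step[OF R Hom_id[OF rR] Hom_id[OF rR] thru_zero])
    moreover interpret R: right_module A R by (rule rR)
    have "(\<lambda>x\<in>carrier R. (\<lambda>x\<in>carrier R. \<zero>\<^bsub>R\<^esub>) x \<oplus>\<^bsub>R\<^esub> (\<lambda>x\<in>carrier R. x) ((\<lambda>x\<in>carrier R. x) x)) = (\<lambda>x\<in>carrier R. x)"
      by (rule restrict_ext) simp
    ultimately show ?thesis unfolding id_thru_def by metis
  qed
  obtain u where u: "u \<in> Hom A R R" "\<forall>h\<in>Hom A R G. e h = compose (carrier R) h u"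
    using Hom_H_representable[OF fdX[OF R] thR rR e] by blast
  have eh: "e h = compose (carrier R) h u" if "h \<in> Hom A R G" for h using u(2) that by blast
  have "compose (carrier R) u u = u"
  proof (rule Hom_eqI[OF Hom_comp[OF u(1) u(1) rR] u(1)])
    fix x assume x: "x \<in> carrier R"
    have "e (e (\<iota> R)) = e (\<iota> R)" using ee i compose_eq[of "\<iota> R" "carrier (H R)" e e] by simp
    then have "compose (carrier R) (compose (carrier R) (\<iota> R) u) u = compose (carrier R) (\<iota> R) u"
      using eh[OF i] eh[OF Hom_comp[OF u(1) i rR]] by simp
    then have "\<iota> R (u (u x)) = \<iota> R (u x)" using x Hom_closed[OF u(1) x] by (metis compose_eq)
    then have "u (u x) = u x"
      using \<pi>\<iota>[OF R Hom_closed[OF u(1) Hom_closed[OF u(1) x]]] \<pi>\<iota>[OF R Hom_closed[OF u(1) x]] by metis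
    then show "compose (carrier R) u u x = u x" using x by (simp add: compose_eq)
  qed
  then consider "u = (\<lambda>x\<in>carrier R. \<zero>\<^bsub>R\<^esub>)" | "u = (\<lambda>x\<in>carrier R. x)"
    using triv u(1) unfolding trivial_idem_def by blast
  then show "e = (\<lambda>x\<in>carrier (H R). \<zero>\<^bsub>H R\<^esub>) \<or> e = (\<lambda>x\<in>carrier (H R). x)"
  proof cases
    case 1
    have "e = (\<lambda>x\<in>carrier (H R). \<zero>\<^bsub>H R\<^esub>)"
      by (rule Hom_eqI[OF e Hom_zero_map[OF rH rH]]) (use eh 1 comp_zero_right[OF _ rR rG] in simp)
    then show ?thesis by blast
  next
    case 2
    have "e = (\<lambda>x\<in>carrier (H R). x)"
      by (rule Hom_eqI[OF e Hom_id[OF rH]]) (use eh 2 comp_id_right in simp)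
    then show ?thesis by blast
  qed
qed

end

section \<open>Finite projective dimension over the endomorphism algebra\<close>

context add_generator
begin

text \<open>
  For a complex \<open>\<cdots> \<rightarrow> C 1 \<rightarrow> C 0\<close> in \<open>add X\<close> that is exact under \<open>Hom(R, -)\<close> in positive degrees, the complex
  \<open>Hom\<^sub>\<Gamma>(H (C k), V)\<close> is exact in degree \<open>n + 2\<close> if \<open>V\<close> has a projective resolution \<open>Q\<close> of length \<open>n\<close>. Let
  \<open>W j\<close> be the \<open>j\<close>-th syzygy of \<open>V\<close>. The short exact sequences \<open>0 \<rightarrow> W (j + 1) \<rightarrow> Q (j + 1) \<rightarrow> W j \<rightarrow> 0\<close> stay
  exact under \<open>Hom\<^sub>\<Gamma>(H (C k), -)\<close>, and the complexes for the projective middle terms are exact. So exactness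
  for \<open>W (j + 1)\<close> in one degree gives exactness for \<open>W j\<close> in the next. The shift starts from
  \<open>W (n + 1) = 0\<close> in degree \<open>1\<close>.
\<close>

lemma resolution_exact:
  fixes Q :: "nat \<Rightarrow> ('k, 'g \<Rightarrow> 'g) rmod" and C :: "nat \<Rightarrow> ('a, 'm) module"
  assumes V: "V \<in> fg_modules \<Gamma>" and res: "projective_resolution \<Gamma> V Q \<delta>"
    and vanish: "\<forall>j>n. zero_module (Q (Suc j))"
    and C: "\<And>k. fdmod (C k)" "\<And>k. id_thru A X (C k)"
    and D: "\<And>k. D k \<in> Hom A (C (Suc k)) (C k)"
    and DD: "\<And>k x. x \<in> carrier (C (Suc (Suc k))) \<Longrightarrow> D k (D (Suc k) x) = \<zero>\<^bsub>C k\<^esub>"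
    and ex: "\<And>k R g. \<lbrakk>R \<in> X; g \<in> Hom A R (C (Suc k)); \<And>x. x \<in> carrier R \<Longrightarrow> D k (g x) = \<zero>\<^bsub>C k\<^esub>\<rbrakk> \<Longrightarrow>
      \<exists>f\<in>Hom A R (C (Suc (Suc k))). \<forall>x\<in>carrier R. D (Suc k) (f x) = g x"
    and \<phi>: "\<phi> \<in> Hom \<Gamma> (H (C (Suc (Suc n)))) V"
    and z: "\<And>h. h \<in> Hom A (C (Suc n)) G \<Longrightarrow> \<phi> (compose (carrier (C (Suc (Suc n)))) h (D (Suc n))) = \<zero>\<^bsub>V\<^esub>"
  shows "\<exists>\<psi>\<in>Hom \<Gamma> (H (C (Suc (Suc (Suc n))))) V. \<forall>h\<in>Hom A (C (Suc (Suc n))) G.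
    \<phi> h = \<psi> (compose (carrier (C (Suc (Suc (Suc n))))) h (D (Suc (Suc n))))"
proof -
  note rC = fdmodD(1)[OF C(1)]
  have Q0: "Q 0 = V" and Qp: "\<And>j. projective \<Gamma> (Q (Suc j))" and \<delta>: "\<And>j. \<delta> j \<in> Hom \<Gamma> (Q (Suc j)) (Q j)"
    and \<delta>0: "\<delta> 0 ` carrier (Q 1) = carrier V"
    and \<delta>S: "\<And>j. \<delta> (Suc j) ` carrier (Q (Suc (Suc j))) = mker (Q (Suc j)) (Q j) (\<delta> j)"
    using res unfolding projective_resolution_def by blast+
  have fQ: "\<Gamma>.fdmod (Q j)" for j
    using V Qp Q0 by (cases j) (auto simp: \<Gamma>.fg_modules_iff projective_def)
  note rQ = \<Gamma>.fdmodD(1)[OF fQ]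
  define W where "W j = \<delta> j ` carrier (Q (Suc j))" for j
  have WS: "W (Suc j) = mker (Q (Suc j)) (Q j) (\<delta> j)" for j unfolding W_def by (rule \<delta>S)
  \<comment> \<open>Exactness in degree \<open>m + 1\<close> for \<open>W (n + 1 - m)\<close>; the assertion is the case \<open>m = n + 1\<close>, since \<open>W 0 = V\<close>.\<close>
  have claim: "\<forall>\<phi>\<in>Hom \<Gamma> (H (C (Suc m))) (Q (Suc n - m)).
      (\<forall>h\<in>Hom A (C (Suc m)) G. \<phi> h \<in> W (Suc n - m)) \<longrightarrow>
      (\<forall>h\<in>Hom A (C m) G. \<phi> (compose (carrier (C (Suc m))) h (D m)) = \<zero>\<^bsub>Q (Suc n - m)\<^esub>) \<longrightarrow>
      (\<exists>\<psi>\<in>Hom \<Gamma> (H (C (Suc (Suc m)))) (Q (Suc n - m)).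
        (\<forall>h\<in>Hom A (C (Suc (Suc m))) G. \<psi> h \<in> W (Suc n - m)) \<and>
        (\<forall>h\<in>Hom A (C (Suc m)) G. \<phi> h = \<psi> (compose (carrier (C (Suc (Suc m)))) h (D (Suc m)))))"
    if "m \<le> Suc n" for m
    using that
  proof (induction m)
    case 0
    have W0: "W (Suc n) = {\<zero>\<^bsub>Q (Suc n)\<^esub>}"
      using vanish[rule_format, of "Suc n"] Hom_zero[OF \<delta> rQ rQ, of "Suc n"] unfolding W_def by simp
    show ?case
    proof (intro ballI impI)
      fix \<phi> assume \<phi>: "\<phi> \<in> Hom \<Gamma> (H (C (Suc 0))) (Q (Suc n - 0))"
        and w: "\<forall>h\<in>Hom A (C (Suc 0)) G. \<phi> h \<in> W (Suc n - 0)"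
      let ?\<psi> = "\<lambda>h\<in>carrier (H (C (Suc (Suc 0)))). \<zero>\<^bsub>Q (Suc n - 0)\<^esub>"
      have "\<phi> h = ?\<psi> (compose (carrier (C (Suc (Suc 0)))) h (D (Suc 0)))" if h: "h \<in> Hom A (C (Suc 0)) G" for h
        using bspec[OF w h] W0 Hom_comp[OF D h rC] by simp
      then show "\<exists>\<psi>\<in>Hom \<Gamma> (H (C (Suc (Suc 0)))) (Q (Suc n - 0)).
        (\<forall>h\<in>Hom A (C (Suc (Suc 0))) G. \<psi> h \<in> W (Suc n - 0)) \<and>
        (\<forall>h\<in>Hom A (C (Suc 0)) G. \<phi> h = \<psi> (compose (carrier (C (Suc (Suc 0)))) h (D (Suc 0))))"
        using Hom_zero_map[OF right_module_H[OF rC] rQ] W0 by (intro bexI[of _ ?\<psi>] conjI ballI) simp_all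
    qed
  next
    case (Suc m)
    define j where "j = n - m"
    have jm: "Suc n - m = Suc j" "Suc n - Suc m = j" using Suc.prems by (auto simp: j_def)
    have IH: "\<exists>\<psi>\<in>Hom \<Gamma> (H (C (Suc (Suc m)))) (Q (Suc j)).
        (\<forall>h\<in>Hom A (C (Suc (Suc m))) G. \<psi> h \<in> W (Suc j)) \<and>
        (\<forall>h\<in>Hom A (C (Suc m)) G. \<phi> h = \<psi> (compose (carrier (C (Suc (Suc m)))) h (D (Suc m))))"
      if "\<phi> \<in> Hom \<Gamma> (H (C (Suc m))) (Q (Suc j))" "\<forall>h\<in>Hom A (C (Suc m)) G. \<phi> h \<in> W (Suc j)"
        "\<forall>h\<in>Hom A (C m) G. \<phi> (compose (carrier (C (Suc m))) h (D m)) = \<zero>\<^bsub>Q (Suc j)\<^esub>" for \<phi>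
      using Suc.IH[unfolded jm] Suc.prems that by simp
    show ?case unfolding jm
    proof (intro ballI impI)
      fix \<phi> assume \<phi>: "\<phi> \<in> Hom \<Gamma> (H (C (Suc (Suc m)))) (Q j)"
        and w: "\<forall>h\<in>Hom A (C (Suc (Suc m))) G. \<phi> h \<in> W j"
        and z: "\<forall>h\<in>Hom A (C (Suc m)) G. \<phi> (compose (carrier (C (Suc (Suc m)))) h (D (Suc m))) = \<zero>\<^bsub>Q j\<^esub>"
      interpret Qj: right_module \<Gamma> "Q j" by (rule rQ)
      interpret QS: right_module \<Gamma> "Q (Suc j)" by (rule rQ)
      let ?c2 = "carrier (C (Suc (Suc m)))" and ?c3 = "carrier (C (Suc (Suc (Suc m))))"
      \<comment> \<open>Diagram chase: lift \<open>\<phi>\<close> to \<open>\<phi>'\<close>. The boundary of \<open>\<phi>'\<close> is a cycle with values in the next syzygy,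
        so by induction it is the boundary of some \<open>\<psi>\<close> with values there. Then \<open>\<phi>' - \<psi>\<close> is a cycle, hence
        the boundary of some \<open>\<omega>\<close>, and \<open>\<delta> \<omega>\<close> has the boundary \<open>\<phi>\<close>.\<close>
      obtain \<phi>' where \<phi>': "\<phi>' \<in> Hom \<Gamma> (H (C (Suc (Suc m)))) (Q (Suc j))"
          "\<forall>h\<in>Hom A (C (Suc (Suc m))) G. \<delta> j (\<phi>' h) = \<phi> h"
        using H_lift[OF C rQ rQ \<delta> \<phi>] w unfolding W_def by blast
      note pre = Hom_precomp[OF D rC rC]
      let ?\<phi>'' = "compose (carrier (H (C (Suc m)))) \<phi>' (\<lambda>h\<in>Hom A (C (Suc m)) G. compose ?c2 h (D (Suc m)))"
      have \<phi>'': "?\<phi>'' \<in> Hom \<Gamma> (H (C (Suc m))) (Q (Suc j))"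
        by (rule Hom_comp[OF pre \<phi>'(1) right_module_H[OF rC]])
      have \<phi>''_app: "?\<phi>'' h = \<phi>' (compose ?c2 h (D (Suc m)))" if h: "h \<in> Hom A (C (Suc m)) G" for h
      proof -
        have "h \<in> carrier (H (C (Suc m)))" using h by simp
        then have "?\<phi>'' h = \<phi>' ((\<lambda>h\<in>Hom A (C (Suc m)) G. compose ?c2 h (D (Suc m))) h)" by (rule compose_eq)
        then show ?thesis unfolding restrict_apply'[OF h] .
      qed
      have hD: "compose ?c2 h (D (Suc m)) \<in> Hom A (C (Suc (Suc m))) G" if "h \<in> Hom A (C (Suc m)) G" for h
        by (rule Hom_comp[OF D that rC])
      have w'': "\<forall>h\<in>Hom A (C (Suc m)) G. ?\<phi>'' h \<in> W (Suc j)"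
      proof
        fix h assume h: "h \<in> Hom A (C (Suc m)) G"
        have "\<delta> j (\<phi>' (compose ?c2 h (D (Suc m)))) = \<zero>\<^bsub>Q j\<^esub>"
          using bspec[OF \<phi>'(2) hD[OF h]] bspec[OF z h] by simp
        moreover have "\<phi>' (compose ?c2 h (D (Suc m))) \<in> carrier (Q (Suc j))"
          using Hom_closed[OF \<phi>'(1)] hD[OF h] by simp
        ultimately show "?\<phi>'' h \<in> W (Suc j)" unfolding \<phi>''_app[OF h] WS mker_def by simp
      qed
      have z'': "\<forall>h\<in>Hom A (C m) G. ?\<phi>'' (compose (carrier (C (Suc m))) h (D m)) = \<zero>\<^bsub>Q (Suc j)\<^esub>"
      proof
        fix h assume h: "h \<in> Hom A (C m) G"
        have hDm: "compose (carrier (C (Suc m))) h (D m) \<in> Hom A (C (Suc m)) G" by (rule Hom_comp[OF D h rC])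
        have "compose ?c2 (compose (carrier (C (Suc m))) h (D m)) (D (Suc m)) = (\<lambda>x\<in>?c2. \<zero>\<^bsub>G\<^esub>)"
          by (rule ext) (simp add: compose_def DD Hom_closed[OF D] Hom_zero[OF h rC rG])
        then show "?\<phi>'' (compose (carrier (C (Suc m))) h (D m)) = \<zero>\<^bsub>Q (Suc j)\<^esub>"
          unfolding \<phi>''_app[OF hDm]
          using Hom_zero[OF \<phi>'(1) right_module_H[OF rC] rQ, unfolded H_simps] by metis
      qed
      obtain \<psi> where \<psi>: "\<psi> \<in> Hom \<Gamma> (H (C (Suc (Suc m)))) (Q (Suc j))"
        "\<forall>h\<in>Hom A (C (Suc (Suc m))) G. \<psi> h \<in> W (Suc j)"
        "\<forall>h\<in>Hom A (C (Suc m)) G. ?\<phi>'' h = \<psi> (compose ?c2 h (D (Suc m)))"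
        using IH[OF \<phi>'' w'' z''] by blast
      let ?\<chi> = "\<lambda>h\<in>carrier (H (C (Suc (Suc m)))). \<phi>' h \<ominus>\<^bsub>Q (Suc j)\<^esub> \<psi> h"
      have \<chi>: "?\<chi> \<in> Hom \<Gamma> (H (C (Suc (Suc m)))) (Q (Suc j))"
        by (rule Hom_diff[OF \<phi>'(1) \<psi>(1) right_module_H[OF rC] rQ])
      have \<chi>z: "?\<chi> (compose ?c2 h (D (Suc m))) = \<zero>\<^bsub>Q (Suc j)\<^esub>" if h: "h \<in> Hom A (C (Suc m)) G" for h
      proof -
        have "\<phi>' (compose ?c2 h (D (Suc m))) = \<psi> (compose ?c2 h (D (Suc m)))"
          using bspec[OF \<psi>(3) h] \<phi>''_app[OF h] by metis
        moreover have "\<psi> (compose ?c2 h (D (Suc m))) \<in> carrier (Q (Suc j))"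
          using Hom_closed[OF \<psi>(1)] hD[OF h] by simp
        ultimately show ?thesis using hD[OF h] by (simp add: a_minus_def QS.M.r_neg)
      qed
      obtain \<omega> where \<omega>: "\<omega> \<in> Hom \<Gamma> (H (C (Suc (Suc (Suc m))))) (Q (Suc j))"
        "\<forall>h\<in>Hom A (C (Suc (Suc m))) G. ?\<chi> h = \<omega> (compose ?c3 h (D (Suc (Suc m))))"
        using projective_exact[OF fQ projective_imp_id_thru[OF Qp] C C C(1) D D ex \<chi> \<chi>z] by blast
      let ?\<psi>' = "compose (carrier (H (C (Suc (Suc (Suc m)))))) (\<delta> j) \<omega>"
      have \<psi>': "?\<psi>' \<in> Hom \<Gamma> (H (C (Suc (Suc (Suc m))))) (Q j)"
        by (rule Hom_comp[OF \<omega>(1) \<delta> right_module_H[OF rC]])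
      have \<psi>'_app: "?\<psi>' h = \<delta> j (\<omega> h)" if "h \<in> Hom A (C (Suc (Suc (Suc m)))) G" for h
        using that by (simp add: compose_eq)
      have "?\<psi>' h \<in> W j" if h: "h \<in> Hom A (C (Suc (Suc (Suc m)))) G" for h
        unfolding \<psi>'_app[OF h] W_def by (rule imageI) (use Hom_closed[OF \<omega>(1)] h in simp)
      moreover have "\<phi> h = ?\<psi>' (compose ?c3 h (D (Suc (Suc m))))" if h: "h \<in> Hom A (C (Suc (Suc m))) G" for h
      proof -
        have c: "\<phi>' h \<in> carrier (Q (Suc j))" "\<psi> h \<in> carrier (Q (Suc j))"
          using Hom_closed[OF \<phi>'(1)] Hom_closed[OF \<psi>(1)] h by simp_all
        have \<psi>0: "\<delta> j (\<psi> h) = \<zero>\<^bsub>Q j\<^esub>" using bspec[OF \<psi>(2) h] unfolding WS mker_def by simp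
        have "?\<psi>' (compose ?c3 h (D (Suc (Suc m)))) = \<delta> j (?\<chi> h)"
          using \<psi>'_app[OF Hom_comp[OF D h rC]] bspec[OF \<omega>(2) h] by metis
        also have "?\<chi> h = \<phi>' h \<ominus>\<^bsub>Q (Suc j)\<^esub> \<psi> h" using h by simp
        also have "\<delta> j (\<phi>' h \<ominus>\<^bsub>Q (Suc j)\<^esub> \<psi> h) = \<delta> j (\<phi>' h) \<ominus>\<^bsub>Q j\<^esub> \<delta> j (\<psi> h)"
          by (rule Hom_sub[OF \<delta> rQ rQ c])
        also have "\<dots> = \<phi> h" using bspec[OF \<phi>'(2) h] \<psi>0 Hom_closed[OF \<delta> c(1)] by (simp add: a_minus_def)
        finally show ?thesis by metis
      qed
      ultimately show "\<exists>\<psi>\<in>Hom \<Gamma> (H (C (Suc (Suc (Suc m))))) (Q j).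
        (\<forall>h\<in>Hom A (C (Suc (Suc (Suc m)))) G. \<psi> h \<in> W j) \<and>
        (\<forall>h\<in>Hom A (C (Suc (Suc m))) G. \<phi> h = \<psi> (compose ?c3 h (D (Suc (Suc m)))))"
        using \<psi>' by (intro bexI[of _ ?\<psi>'] conjI ballI)
    qed
  qed
  have "W 0 = carrier V" unfolding W_def using \<delta>0 by simp
  then have "\<forall>h\<in>Hom A (C (Suc (Suc n))) G. \<phi> h \<in> W 0" using Hom_closed[OF \<phi>] by simp
  then show ?thesis
    using claim[OF order_refl, unfolded diff_self_eq_0 Q0, THEN bspec, OF \<phi>] z by blast
qed

text \<open>
  Let \<open>N = M (n + 3)\<close>, the kernel of \<open>C (n + 2) \<rightarrow> M (n + 2)\<close>. Restricting maps to \<open>N\<close> is a homomorphism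
  \<open>H (C (n + 2)) \<rightarrow> H N\<close> and a cycle, because the next differential vanishes on \<open>N\<close>. By exactness it
  factors through \<open>H (C (n + 3))\<close>, and by Yoneda's lemma the second factor is composition with a map
  \<open>f : N \<rightarrow> C (n + 3)\<close>. Then \<open>c f\<close> and the inclusion of \<open>N\<close> agree after every map to \<open>G\<close>, so \<open>f\<close> splits
  the approximation \<open>c\<close> of \<open>N\<close>.
\<close>

lemma syzygy_id_thru:
  fixes M C :: "nat \<Rightarrow> ('a, 'm) module"
  assumes bounded: "\<And>V. V \<in> fg_modules \<Gamma> \<Longrightarrow>
      \<exists>Q \<delta>. projective_resolution \<Gamma> V Q \<delta> \<and> (\<forall>j>n. zero_module (Q (Suc j)))"
    and M: "\<And>k. fdmod (M k)" and C: "\<And>k. fdmod (C k)" "\<And>k. id_thru A X (C k)"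
    and c: "\<And>k. c k \<in> Hom A (C k) (M k)"
    and lift: "\<And>k R h. \<lbrakk>R \<in> X; h \<in> Hom A R (M k)\<rbrakk> \<Longrightarrow> \<exists>j\<in>Hom A R (C k). \<forall>x\<in>carrier R. c k (j x) = h x"
    and MS: "\<And>k. M (Suc k) = (C k)\<lparr>carrier := mker (C k) (M k) (c k)\<rparr>"
  shows "id_thru A X (M (Suc (Suc (Suc n))))"
proof -
  note rM = fdmodD(1)[OF M] and rC = fdmodD(1)[OF C(1)]
  have MC: "carrier (M (Suc k)) = mker (C k) (M k) (c k)" "\<zero>\<^bsub>M (Suc k)\<^esub> = \<zero>\<^bsub>C k\<^esub>" for k
    by (simp_all add: MS)
  have D: "c (Suc k) \<in> Hom A (C (Suc k)) (C k)" for k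
    by (rule Hom_expand[OF c[of "Suc k", unfolded MS]]) (auto simp: mker_def)
  have DD: "c (Suc k) (c (Suc (Suc k)) x) = \<zero>\<^bsub>C k\<^esub>" if x: "x \<in> carrier (C (Suc (Suc k)))" for k x
    using Hom_closed[OF c x] unfolding MC(1) mker_def by (simp add: MC)
  have ex: "\<exists>f\<in>Hom A R (C (Suc (Suc k))). \<forall>x\<in>carrier R. c (Suc (Suc k)) (f x) = g x"
    if R: "R \<in> X" and g: "g \<in> Hom A R (C (Suc k))" and z: "\<And>x. x \<in> carrier R \<Longrightarrow> c (Suc k) (g x) = \<zero>\<^bsub>C k\<^esub>" for k R g
  proof (rule lift[OF R])
    show "g \<in> Hom A R (M (Suc (Suc k)))"
      unfolding MS[of "Suc k"] by (rule Hom_corestrict[OF g]) (use z Hom_closed[OF g] in \<open>auto simp: mker_def MC\<close>)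
  qed
  let ?N = "M (Suc (Suc (Suc n)))" and ?C2 = "C (Suc (Suc n))" and ?C3 = "C (Suc (Suc (Suc n)))"
  let ?i = "\<lambda>x\<in>carrier ?N. x"
  have i: "?i \<in> Hom A ?N ?C2"
    using Hom_inclusion[OF subm_mker[OF c rC rM, of "Suc (Suc n)"]] unfolding MS[of "Suc (Suc n)"] by simp
  obtain V :: "('k, 'g \<Rightarrow> 'g) rmod" and \<alpha> \<beta> where V: "\<Gamma>.fdmod V" "\<alpha> \<in> Hom \<Gamma> (H ?N) V" "\<beta> \<in> Hom \<Gamma> V (H ?N)"
    "\<forall>x\<in>carrier (H ?N). \<beta> (\<alpha> x) = x" "\<forall>y\<in>carrier V. \<alpha> (\<beta> y) = y" "isomorphic \<Gamma> (H ?N) V"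
    by (rule \<Gamma>.fg_representative_maps[OF fdmod_H[OF M]])
  note rV = \<Gamma>.fdmodD(1)[OF V(1)]
  have fV: "V \<in> fg_modules \<Gamma>" using V(1) by (simp add: \<Gamma>.fg_modules_iff)
  obtain Q \<delta> where Q: "projective_resolution \<Gamma> V Q \<delta>" "\<forall>j>n. zero_module (Q (Suc j))"
    using bounded[OF fV] by blast
  note pre = Hom_precomp[OF i rM rC]
  let ?\<phi> = "compose (carrier (H ?C2)) \<alpha> (\<lambda>h\<in>Hom A ?C2 G. compose (carrier ?N) h ?i)"
  have \<phi>: "?\<phi> \<in> Hom \<Gamma> (H ?C2) V" by (rule Hom_comp[OF pre V(2) right_module_H[OF rC]])
  have \<phi>_app: "?\<phi> h = \<alpha> (compose (carrier ?N) h ?i)" if h: "h \<in> Hom A ?C2 G" for h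
  proof -
    have "h \<in> carrier (H ?C2)" using h by simp
    then have "?\<phi> h = \<alpha> ((\<lambda>h\<in>Hom A ?C2 G. compose (carrier ?N) h ?i) h)" by (rule compose_eq)
    then show ?thesis unfolding restrict_apply'[OF h] .
  qed
  have z: "?\<phi> (compose (carrier ?C2) h (c (Suc (Suc n)))) = \<zero>\<^bsub>V\<^esub>" if h: "h \<in> Hom A (C (Suc n)) G" for h
  proof -
    have "compose (carrier ?N) (compose (carrier ?C2) h (c (Suc (Suc n)))) ?i = (\<lambda>x\<in>carrier ?N. \<zero>\<^bsub>G\<^esub>)"
      by (rule ext) (auto simp: compose_def MC mker_def Hom_zero[OF h rC rG])
    then show ?thesis unfolding \<phi>_app[OF Hom_comp[OF D h rC]]
      using Hom_zero[OF V(2) right_module_H[OF rM] rV, unfolded H_simps] by metis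
  qed
  obtain \<psi> where \<psi>: "\<psi> \<in> Hom \<Gamma> (H ?C3) V"
    "\<forall>h\<in>Hom A ?C2 G. ?\<phi> h = \<psi> (compose (carrier ?C3) h (c (Suc (Suc (Suc n)))))"
    using resolution_exact[where D = "\<lambda>k. c (Suc k)" and C = C, OF fV Q C D DD ex \<phi> z] by blast
  have "compose (carrier (H ?C3)) \<beta> \<psi> \<in> Hom \<Gamma> (H ?C3) (H ?N)"
    by (rule Hom_comp[OF \<psi>(1) V(3) right_module_H[OF rC]])
  then obtain f where f: "f \<in> Hom A ?N ?C3"
    "\<forall>h\<in>Hom A ?C3 G. compose (carrier (H ?C3)) \<beta> \<psi> h = compose (carrier ?N) h f"
    using Hom_H_representable[OF C rM] by blast
  have cf: "c (Suc (Suc (Suc n))) (f x) = x" if x: "x \<in> carrier ?N" for x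
  proof (rule cogenerated_eq[OF C(1)[of "Suc (Suc n)"] C(2)])
    show "c (Suc (Suc (Suc n))) (f x) \<in> carrier ?C2" by (rule Hom_closed[OF D Hom_closed[OF f(1) x]])
    show "x \<in> carrier ?C2" using x unfolding MC mker_def by simp
    fix h assume h: "h \<in> Hom A ?C2 G"
    let ?hD = "compose (carrier ?C3) h (c (Suc (Suc (Suc n))))"
    have hD: "?hD \<in> Hom A ?C3 G" by (rule Hom_comp[OF D h rC])
    have hi: "compose (carrier ?N) h ?i \<in> carrier (H ?N)" using Hom_comp[OF i h rM] by simp
    have "compose (carrier (H ?C3)) \<beta> \<psi> ?hD = \<beta> (\<psi> ?hD)" by (rule compose_eq) (use hD in simp)
    also have "\<psi> ?hD = \<alpha> (compose (carrier ?N) h ?i)" using bspec[OF \<psi>(2) h] \<phi>_app[OF h] by metis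
    also have "\<beta> (\<alpha> (compose (carrier ?N) h ?i)) = compose (carrier ?N) h ?i" by (rule bspec[OF V(4) hi])
    finally have "compose (carrier ?N) ?hD f = compose (carrier ?N) h ?i" using bspec[OF f(2) hD] by metis
    then have "compose (carrier ?N) ?hD f x = compose (carrier ?N) h ?i x" by (rule fun_cong)
    then have "?hD (f x) = h (?i x)" unfolding compose_eq[OF x] .
    then show "h (c (Suc (Suc (Suc n))) (f x)) = h x"
      using Hom_closed[OF f(1) x] x by (simp add: compose_eq)
  qed
  show ?thesis
    by (rule id_thru_retract[OF C(2)[of "Suc (Suc (Suc n))"] c f(1) cf rC rM rX])
qed

section \<open>Dimension vectors over the endomorphism algebra\<close>

definition idem :: "('a, 'x) module \<Rightarrow> 'g \<Rightarrow> 'g" where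
  "idem R = compose (carrier G) (\<iota> R) (\<pi> R)"

text \<open>
  The component \<open>V e\<^sub>R\<close> of a right \<open>\<Gamma>\<close>-module at the idempotent \<open>e\<^sub>R = \<iota> \<pi>\<close>.
\<close>

definition idem_part :: "('a, 'x) module \<Rightarrow> ('g \<Rightarrow> 'g, 'v) module \<Rightarrow> 'v set" where
  "idem_part R V = {v \<in> carrier V. idem R \<odot>\<^bsub>V\<^esub> v = v}"

definition dim_at :: "('a, 'x) module \<Rightarrow> ('g \<Rightarrow> 'g, 'v) module \<Rightarrow> nat" where
  "dim_at R V = vdim K ((underlying_space \<Gamma> V)\<lparr>carrier := idem_part R V\<rparr>)"

lemma idem_closed: "R \<in> X \<Longrightarrow> idem R \<in> carrier \<Gamma>"
  unfolding idem_def using Hom_comp[OF \<pi> \<iota> rG] by simp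

lemma idem_mult: "R \<in> X \<Longrightarrow> idem R \<otimes>\<^bsub>\<Gamma>\<^esub> idem R = idem R"
  unfolding idem_def \<Gamma>_simps by (rule ext) (simp add: compose_def Hom_closed[OF \<iota>] Hom_closed[OF \<pi>] \<pi>\<iota>)

lemma submodule_idem_part:
  assumes R: "R \<in> X" and V: "right_module \<Gamma> V"
  shows "submodule K (idem_part R V) (underlying_space \<Gamma> V)"
proof -
  interpret Vm: right_module \<Gamma> V by (rule V)
  have m: "Module.module K (underlying_space \<Gamma> V)" using \<Gamma>.vectorspace_US[OF V] by (simp add: vectorspace_def)
  show ?thesis
    unfolding submodule_def idem_part_def
    using m idem_closed[OF R] \<Gamma>.scalar_closed
    by (auto simp del: \<Gamma>_simps simp: Vm.act_add Vm.act_zero Vm.act_closed \<Gamma>.scalar_act_commute[OF V])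
qed

text \<open>
  \<open>V \<mapsto> V e\<^sub>R\<close> is exact: the kernel is taken inside \<open>V e\<^sub>R\<close>, and \<open>v e\<^sub>R\<close> is a preimage of \<open>f v\<close> if \<open>f v\<close> is
  fixed by \<open>e\<^sub>R\<close>.
\<close>

lemma dim_at_add:
  assumes R: "R \<in> X" and V: "\<Gamma>.fdmod V" and W: "right_module \<Gamma> W" and f: "f \<in> Hom \<Gamma> V W"
    and surj: "f ` carrier V = carrier W"
  shows "dim_at R V = dim_at R W + dim_at R (V\<lparr>carrier := mker V W f\<rparr>)"
proof -
  note rV = \<Gamma>.fdmodD(1)[OF V] and e = idem_closed[OF R]
  interpret Vm: right_module \<Gamma> V by (rule rV)
  let ?V = "(underlying_space \<Gamma> V)\<lparr>carrier := idem_part R V\<rparr>" and ?W = "(underlying_space \<Gamma> W)\<lparr>carrier := idem_part R W\<rparr>"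
  have fd: "fd_space K ?V" by (rule fd_subspace(1)[OF \<Gamma>.fdmodD(2)[OF V] submodule_idem_part[OF R rV]])
  have vs: "vectorspace K ?W" by (rule subspace_vectorspace[OF \<Gamma>.vectorspace_US[OF W] submodule_idem_part[OF R W]])
  have fpart: "f v \<in> idem_part R W" if "v \<in> idem_part R V" for v
  proof -
    have v: "v \<in> carrier V" "idem R \<odot>\<^bsub>V\<^esub> v = v" using that by (simp_all add: idem_part_def)
    then show ?thesis
      using Hom_act[OF f e v(1), unfolded v(2), symmetric] Hom_closed[OF f v(1)] unfolding idem_part_def by simp
  qed
  have lin: "klinear K ?V ?W f"
    using fpart \<Gamma>.klinear_Hom[OF f] unfolding klinear_def idem_part_def by auto
  have "f ` idem_part R V = idem_part R W"
  proof
    show "f ` idem_part R V \<subseteq> idem_part R W" using fpart by blast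
    show "idem_part R W \<subseteq> f ` idem_part R V"
    proof
      fix w assume w: "w \<in> idem_part R W"
      then have "w \<in> carrier W" by (simp add: idem_part_def)
      then have "w \<in> f ` carrier V" unfolding surj .
      then obtain v where v: "v \<in> carrier V" "w = f v" by blast
      have "idem R \<odot>\<^bsub>V\<^esub> v \<in> idem_part R V"
        unfolding idem_part_def using Vm.act_closed[OF e v(1)] Vm.act_assoc[OF e e v(1)] idem_mult[OF R] by simp
      moreover have "f (idem R \<odot>\<^bsub>V\<^esub> v) = w" using Hom_act[OF f e v(1)] w v(2) unfolding idem_part_def by simp
      ultimately show "w \<in> f ` idem_part R V" by blast
    qed
  qed
  then have "vdim K ?V = vdim K ?W + vdim K (?V\<lparr>carrier := {x \<in> carrier ?V. f x = \<zero>\<^bsub>?W\<^esub>}\<rparr>)"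
    by (intro rank_nullity_vdim(2)[OF fd vs lin]) simp
  moreover have "?V\<lparr>carrier := {x \<in> carrier ?V. f x = \<zero>\<^bsub>?W\<^esub>}\<rparr> =
    (underlying_space \<Gamma> (V\<lparr>carrier := mker V W f\<rparr>))\<lparr>carrier := idem_part R (V\<lparr>carrier := mker V W f\<rparr>)\<rparr>"
  proof -
    have "{x \<in> carrier ?V. f x = \<zero>\<^bsub>?W\<^esub>} = idem_part R (V\<lparr>carrier := mker V W f\<rparr>)"
      unfolding idem_part_def mker_def by auto
    then show ?thesis by simp
  qed
  ultimately show ?thesis unfolding dim_at_def by metis
qed

lemma dim_at_iso:
  assumes R: "R \<in> X" and V: "\<Gamma>.fdmod V" and W: "right_module \<Gamma> W" and i: "isomorphic \<Gamma> V W"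
  shows "dim_at R W = dim_at R V"
proof -
  note rV = \<Gamma>.fdmodD(1)[OF V] and e = idem_closed[OF R]
  obtain f where f: "f \<in> Hom \<Gamma> V W" and b: "bij_betw f (carrier V) (carrier W)"
    using i unfolding isomorphic_def by blast
  let ?V = "(underlying_space \<Gamma> V)\<lparr>carrier := idem_part R V\<rparr>" and ?W = "(underlying_space \<Gamma> W)\<lparr>carrier := idem_part R W\<rparr>"
  have fd: "fd_space K ?V" by (rule fd_subspace(1)[OF \<Gamma>.fdmodD(2)[OF V] submodule_idem_part[OF R rV]])
  have vs: "vectorspace K ?W" by (rule subspace_vectorspace[OF \<Gamma>.vectorspace_US[OF W] submodule_idem_part[OF R W]])
  interpret Vm: right_module \<Gamma> V by (rule rV)
  have fpart: "f v \<in> idem_part R W \<longleftrightarrow> v \<in> idem_part R V" if v: "v \<in> carrier V" for v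
    using Hom_act[OF f e v] Hom_closed[OF f v] inj_onD[OF bij_betw_imp_inj_on[OF b] _ Vm.act_closed[OF e v] v] v
    unfolding idem_part_def by auto
  have lin: "klinear K ?V ?W f"
    using fpart \<Gamma>.klinear_Hom[OF f] unfolding klinear_def idem_part_def by auto
  have "bij_betw f (idem_part R V) (idem_part R W)"
  proof (rule bij_betw_imageI)
    show "inj_on f (idem_part R V)"
      using bij_betw_imp_inj_on[OF b] by (rule inj_on_subset) (auto simp: idem_part_def)
    show "f ` idem_part R V = idem_part R W"
    proof
      show "f ` idem_part R V \<subseteq> idem_part R W" using fpart by (auto simp: idem_part_def)
      show "idem_part R W \<subseteq> f ` idem_part R V"
      proof
        fix w assume w: "w \<in> idem_part R W"
        then have "w \<in> f ` carrier V" unfolding bij_betw_imp_surj_on[OF b] by (simp add: idem_part_def)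
        then obtain v where v: "v \<in> carrier V" "w = f v" by blast
        then have "v \<in> idem_part R V" using fpart[OF v(1)] w by simp
        then show "w \<in> f ` idem_part R V" using v(2) by blast
      qed
    qed
  qed
  then show ?thesis using vdim_iso(2)[OF fd vs lin] unfolding dim_at_def by simp
qed

lemma dim_at_zero:
  assumes R: "R \<in> X" and V: "\<Gamma>.fdmod V" "zero_module V"
  shows "dim_at R V = 0"
proof -
  note rV = \<Gamma>.fdmodD(1)[OF V(1)]
  have "V\<lparr>carrier := mker V V (\<lambda>x\<in>carrier V. x)\<rparr> = V" using V(2) by (simp add: mker_def)
  then show ?thesis using dim_at_add[OF R V(1) rV Hom_id[OF rV]] by simp
qed

lemma idem_part_H:
  assumes R: "R \<in> X" and N: "right_module A N"
  shows "idem_part R (H N) = (\<lambda>f. compose (carrier N) (\<iota> R) f) ` Hom A N R"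
proof (intro equalityI subsetI)
  fix h assume "h \<in> idem_part R (H N)"
  then have h: "h \<in> Hom A N G" "compose (carrier N) (idem R) h = h" unfolding idem_part_def by auto
  have "compose (carrier N) (\<iota> R) (compose (carrier N) (\<pi> R) h) = h"
    using comp_assoc[OF h(1), of "\<iota> R" "\<pi> R"] h(2) unfolding idem_def by metis
  then show "h \<in> (\<lambda>f. compose (carrier N) (\<iota> R) f) ` Hom A N R"
    using Hom_comp[OF h(1) \<pi>[OF R] N] by (metis image_eqI)
next
  fix h assume "h \<in> (\<lambda>f. compose (carrier N) (\<iota> R) f) ` Hom A N R"
  then obtain f where f: "f \<in> Hom A N R" "h = compose (carrier N) (\<iota> R) f" by blast
  have "compose (carrier N) (idem R) h = h"
    unfolding f(2) idem_def
    by (rule ext) (simp add: compose_def Hom_closed[OF f(1)] Hom_closed[OF \<iota>[OF R]] \<pi>\<iota>[OF R])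
  then show "h \<in> idem_part R (H N)" using Hom_comp[OF f(1) \<iota>[OF R] N] f(2) by (simp add: idem_part_def)
qed

text \<open>
  The maps \<open>h : N \<rightarrow> G\<close> with \<open>e\<^sub>R h = h\<close> are the maps \<open>\<iota> f\<close> with \<open>f : N \<rightarrow> R\<close>.
\<close>

lemma dim_at_H:
  assumes R: "R \<in> X" and N: "fdmod N"
  shows "dim_at R (H N) = vdim K (hom_space A N R)"
proof -
  note rN = fdmodD(1)[OF N]
  interpret G: right_module A G by (rule rG)
  let ?W = "(underlying_space \<Gamma> (H N))\<lparr>carrier := idem_part R (H N)\<rparr>"
  let ?T = "\<lambda>f. compose (carrier N) (\<iota> R) f"
  have vs: "vectorspace K ?W"
    by (rule subspace_vectorspace[OF \<Gamma>.vectorspace_US[OF right_module_H[OF rN]] submodule_idem_part[OF R right_module_H[OF rN]]])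
  have lin: "klinear K (hom_space A N R) ?W ?T"
    unfolding klinear_def
  proof (intro conjI ballI)
    show "?T ` carrier (hom_space A N R) \<subseteq> carrier ?W" unfolding idem_part_H[OF R rN] by simp
    show "?T (x \<oplus>\<^bsub>hom_space A N R\<^esub> y) = ?T x \<oplus>\<^bsub>?W\<^esub> ?T y"
      if "x \<in> carrier (hom_space A N R)" "y \<in> carrier (hom_space A N R)" for x y
      using that comp_add_right[OF \<iota>[OF R]] by simp
    show "?T (k \<odot>\<^bsub>hom_space A N R\<^esub> x) = k \<odot>\<^bsub>?W\<^esub> ?T x"
      if "k \<in> carrier K" "x \<in> carrier (hom_space A N R)" for k x
    proof -
      have x: "x \<in> Hom A N R" using that by simp
      have "compose (carrier N) (\<iota> R) (\<lambda>y\<in>carrier N. (k \<odot>\<^bsub>A\<^esub> \<one>\<^bsub>A\<^esub>) \<odot>\<^bsub>R\<^esub> x y) =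
        compose (carrier N) (\<lambda>y\<in>carrier G. (k \<odot>\<^bsub>A\<^esub> \<one>\<^bsub>A\<^esub>) \<odot>\<^bsub>G\<^esub> (\<lambda>x\<in>carrier G. x) y) (compose (carrier N) (\<iota> R) x)"
        by (rule ext) (use that(1) in \<open>simp add: compose_def Hom_closed[OF x] Hom_closed[OF \<iota>[OF R]] Hom_act[OF \<iota>[OF R]]\<close>)
      then show ?thesis by simp
    qed
  qed
  have "bij_betw ?T (Hom A N R) (idem_part R (H N))"
  proof (rule bij_betw_imageI)
    show "inj_on ?T (Hom A N R)"
    proof (rule inj_onI)
      fix f g assume f: "f \<in> Hom A N R" and g: "g \<in> Hom A N R" and eq: "?T f = ?T g"
      show "f = g"
      proof (rule Hom_eqI[OF f g])
        fix x assume x: "x \<in> carrier N"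
        have "\<iota> R (f x) = \<iota> R (g x)" using eq x by (metis compose_eq)
        then show "f x = g x" using \<pi>\<iota>[OF R Hom_closed[OF f x]] \<pi>\<iota>[OF R Hom_closed[OF g x]] by metis
      qed
    qed
    show "?T ` Hom A N R = idem_part R (H N)" using idem_part_H[OF R rN] by simp
  qed
  then show ?thesis
    using vdim_iso(2)[OF fd_hom_space[OF N fdX[OF R]] vs lin] unfolding dim_at_def by simp
qed

subsection \<open>Additive functions that vanish on the projectives\<close>

context
  fixes n :: "('a, 'x) module \<Rightarrow> int"
  assumes triv: "\<And>R. R \<in> X \<Longrightarrow> trivial_idem A R"
    and rel: "\<And>R'. R' \<in> X \<Longrightarrow> (\<Sum>R\<in>X. n R * int (vdim K (hom_space A R' R))) = 0"
begin

definition weight :: "('g \<Rightarrow> 'g, 'v) module \<Rightarrow> int" where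
  "weight V = (\<Sum>R\<in>X. n R * int (dim_at R V))"

lemma weight_add:
  assumes "\<Gamma>.fdmod V" "right_module \<Gamma> W" "f \<in> Hom \<Gamma> V W" "f ` carrier V = carrier W"
  shows "weight V = weight W + weight (V\<lparr>carrier := mker V W f\<rparr>)"
  unfolding weight_def sum.distrib[symmetric]
  by (rule sum.cong) (simp_all add: dim_at_add[OF _ assms] algebra_simps)

lemma weight_iso: "\<lbrakk>\<Gamma>.fdmod V; right_module \<Gamma> W; isomorphic \<Gamma> V W\<rbrakk> \<Longrightarrow> weight W = weight V"
  unfolding weight_def by (rule sum.cong) (simp_all add: dim_at_iso)

lemma weight_H: "R' \<in> X \<Longrightarrow> weight (H R') = 0"
  unfolding weight_def using rel[of R'] by (simp add: dim_at_H[OF _ fdX])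

text \<open>
  A projective is assembled from copies of the \<open>H R\<close> by splittings.
\<close>

lemma weight_projective:
  assumes "projective \<Gamma> P"
  shows "weight P = 0"
proof -
  have fP: "\<Gamma>.fdmod P" using assms unfolding projective_def \<Gamma>.fg_modules_iff by blast
  show ?thesis
  proof (rule \<Gamma>.krull_schmidt_induct[OF fP projective_imp_id_thru[OF assms], where P = "\<lambda>M. weight M = 0"])
    show "right_module \<Gamma> R" if "R \<in> H ` X" for R using that right_module_H[OF rX] by blast
    show "trivial_idem \<Gamma> R" if "R \<in> H ` X" for R using that trivial_idem_H triv by blast
    show "weight M = 0" if "\<Gamma>.fdmod M" "zero_module M" for M :: "('g \<Rightarrow> 'g, nat \<Rightarrow> 'k) module"
      unfolding weight_def by (simp add: dim_at_zero[OF _ that])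
    show "weight M = 0" if M: "\<Gamma>.fdmod M" "e \<in> Hom \<Gamma> M M" "compose (carrier M) e e = e"
      "weight (M\<lparr>carrier := mker M M e\<rparr>) = 0" "weight (M\<lparr>carrier := e ` carrier M\<rparr>) = 0"
      for M :: "('g \<Rightarrow> 'g, nat \<Rightarrow> 'k) module" and e
    proof -
      note rM = \<Gamma>.fdmodD(1)[OF M(1)]
      have "weight M = weight (M\<lparr>carrier := e ` carrier M\<rparr>) + weight (M\<lparr>carrier := mker M (M\<lparr>carrier := e ` carrier M\<rparr>) e\<rparr>)"
        by (rule weight_add[OF M(1) right_module_sub[OF rM subm_image[OF M(2) rM rM]] Hom_corestrict[OF M(2)]]) simp_all
      then show ?thesis using M(4,5) by (simp add: mker_def)
    qed
    show "weight M = 0" if M: "\<Gamma>.fdmod M" "R \<in> H ` X" "isomorphic \<Gamma> M R"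
      for M :: "('g \<Rightarrow> 'g, nat \<Rightarrow> 'k) module" and R
      using weight_iso[OF M(1) _ M(3)] weight_H M(2) right_module_H[OF rX] by auto
  qed
qed

text \<open>
  Additivity on the sequences \<open>0 \<rightarrow> B (j + 1) \<rightarrow> Q (j + 1) \<rightarrow> B j \<rightarrow> 0\<close> of syzygies, from the zero end of the
  resolution down to \<open>B 0 = V\<close>.
\<close>

lemma weight_finite_resolution:
  assumes V: "V \<in> fg_modules \<Gamma>" and res: "projective_resolution \<Gamma> V Q \<delta>"
    and vanish: "\<forall>j>m. zero_module (Q (Suc j))"
  shows "weight V = 0"
proof -
  have Q0: "Q 0 = V" and Qp: "\<And>j. projective \<Gamma> (Q (Suc j))" and \<delta>: "\<And>j. \<delta> j \<in> Hom \<Gamma> (Q (Suc j)) (Q j)"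
    and \<delta>0: "\<delta> 0 ` carrier (Q 1) = carrier V"
    and \<delta>S: "\<And>j. \<delta> (Suc j) ` carrier (Q (Suc (Suc j))) = mker (Q (Suc j)) (Q j) (\<delta> j)"
    using res unfolding projective_resolution_def by blast+
  have fQ: "\<Gamma>.fdmod (Q j)" for j
    using V Qp Q0 by (cases j) (auto simp: \<Gamma>.fg_modules_iff projective_def)
  note rQ = \<Gamma>.fdmodD(1)[OF fQ]
  define B where "B j = (Q j)\<lparr>carrier := \<delta> j ` carrier (Q (Suc j))\<rparr>" for j
  have fB: "\<Gamma>.fdmod (B j)" for j unfolding B_def by (rule \<Gamma>.fdmod_sub[OF fQ subm_image[OF \<delta> rQ rQ]])
  have step: "weight (B j) + weight (B (Suc j)) = 0" for j
  proof -
    have "weight (Q (Suc j)) = weight (B j) + weight ((Q (Suc j))\<lparr>carrier := mker (Q (Suc j)) (B j) (\<delta> j)\<rparr>)"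
      by (rule weight_add[OF fQ \<Gamma>.fdmodD(1)[OF fB]]) (simp_all add: B_def Hom_corestrict[OF \<delta>])
    moreover have "(Q (Suc j))\<lparr>carrier := mker (Q (Suc j)) (B j) (\<delta> j)\<rparr> = B (Suc j)"
      unfolding B_def \<delta>S by (simp add: mker_def)
    ultimately show ?thesis using weight_projective[OF Qp] by simp
  qed
  have "zero_module (B (Suc m))"
    using vanish[rule_format, of "Suc m"] Hom_zero[OF \<delta> rQ rQ, of "Suc m"] by (simp add: B_def)
  then have last: "weight (B (Suc m)) = 0" unfolding weight_def by (simp add: dim_at_zero[OF _ fB])
  have "weight (B (Suc m - k)) = 0" if "k \<le> Suc m" for k
    using that
  proof (induction k)
    case (Suc k)
    then have "Suc m - k = Suc (Suc m - Suc k)" by simp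
    then show ?case using Suc step[of "Suc m - Suc k"] by simp
  qed (use last in simp)
  from this[of "Suc m"] have "weight (B 0) = 0" by simp
  moreover have "B 0 = V" using \<delta>0 Q0 by (simp add: B_def)
  ultimately show ?thesis by simp
qed

text \<open>
  The maps \<open>S \<rightarrow> G\<close> that are not split injective form a submodule of \<open>H S\<close>, because
  \<open>End S\<close> is local. For \<open>R \<noteq> S\<close> it contains all maps that come from \<open>S \<rightarrow> R\<close>, as \<open>S\<close> is not a summand of \<open>R\<close>,
  but it does not contain \<open>\<iota> S\<close>. Both modules have weight \<open>0\<close>, and in the difference only the term of \<open>S\<close> is left.
\<close>

lemma coefficients_vanish:
  assumes bounded: "\<And>V. V \<in> fg_modules \<Gamma> \<Longrightarrow>
      \<exists>Q \<delta>. projective_resolution \<Gamma> V Q \<delta> \<and> (\<forall>j>m. zero_module (Q (Suc j)))"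
    and noniso: "\<And>R R'. \<lbrakk>R \<in> X; R' \<in> X; isomorphic A R R'\<rbrakk> \<Longrightarrow> R = R'"
    and S: "S \<in> X" "\<not> zero_module S"
  shows "n S = 0"
proof -
  note rS = rX[OF S(1)] and rHS = right_module_H[OF rX[OF S(1)]]
  interpret Sm: right_module A S by (rule rS)
  interpret HS: right_module \<Gamma> "H S" by (rule rHS)
  let ?rad = "{h \<in> Hom A S G. \<forall>g\<in>Hom A G S. \<not> bij_betw (compose (carrier S) g h) (carrier S) (carrier S)}"
  let ?Rad = "(H S)\<lparr>carrier := ?rad\<rparr>"
  have sub: "subm \<Gamma> (H S) ?rad"
    unfolding subm_def
  proof (intro conjI ballI)
    show "?rad \<subseteq> carrier (H S)" by auto
    have "\<not> bij_betw (\<lambda>x\<in>carrier S. \<zero>\<^bsub>S\<^esub>) (carrier S) (carrier S)"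
    proof
      assume "bij_betw (\<lambda>x\<in>carrier S. \<zero>\<^bsub>S\<^esub>) (carrier S) (carrier S)"
      then have "carrier S = (\<lambda>x\<in>carrier S. \<zero>\<^bsub>S\<^esub>) ` carrier S" by (simp add: bij_betw_def)
      then have "carrier S = {\<zero>\<^bsub>S\<^esub>}" using Sm.M.zero_closed by auto
      then show False using S(2) by blast
    qed
    then have "\<not> bij_betw (compose (carrier S) g (\<lambda>x\<in>carrier S. \<zero>\<^bsub>G\<^esub>)) (carrier S) (carrier S)"
      if "g \<in> Hom A G S" for g
      unfolding comp_zero_right[OF that rG rS] .
    then have "(\<lambda>x\<in>carrier S. \<zero>\<^bsub>G\<^esub>) \<in> ?rad"
      using Hom_zero_map[OF rS rG] by blast
    then show "\<zero>\<^bsub>H S\<^esub> \<in> ?rad" by simp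
    show "h \<oplus>\<^bsub>H S\<^esub> h' \<in> ?rad" if h: "h \<in> ?rad" and h': "h' \<in> ?rad" for h h'
    proof (intro CollectI conjI ballI notI)
      have hh: "h \<in> Hom A S G" "h' \<in> Hom A S G" using h h' by auto
      show "h \<oplus>\<^bsub>H S\<^esub> h' \<in> Hom A S G" using Hom_plus[OF hh rS rG] by simp
      fix g assume g: "g \<in> Hom A G S" and b: "bij_betw (compose (carrier S) g (h \<oplus>\<^bsub>H S\<^esub> h')) (carrier S) (carrier S)"
      have "bij_betw (\<lambda>x\<in>carrier S. compose (carrier S) g h x \<oplus>\<^bsub>S\<^esub> compose (carrier S) g h' x) (carrier S) (carrier S)"
        using b unfolding H_simps comp_add_right[OF g hh] .
      then have "bij_betw (compose (carrier S) g h) (carrier S) (carrier S) \<or> bij_betw (compose (carrier S) g h') (carrier S) (carrier S)"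
        by (rule local_End[OF fdX[OF S(1)] triv[OF S(1)] Hom_comp[OF hh(1) g rS] Hom_comp[OF hh(2) g rS]])
      then show False using h h' g by blast
    qed
    show "a \<odot>\<^bsub>H S\<^esub> h \<in> ?rad" if a: "a \<in> carrier \<Gamma>" and h: "h \<in> ?rad" for a h
    proof (intro CollectI conjI ballI)
      have hh: "h \<in> Hom A S G" and aa: "a \<in> Hom A G G" using a h by auto
      show "a \<odot>\<^bsub>H S\<^esub> h \<in> Hom A S G" using Hom_comp[OF hh aa rS] by simp
      fix g assume g: "g \<in> Hom A G S"
      have "compose (carrier S) g (a \<odot>\<^bsub>H S\<^esub> h) = compose (carrier S) (compose (carrier G) g a) h"
        using comp_assoc[OF hh] by simp
      then show "\<not> bij_betw (compose (carrier S) g (a \<odot>\<^bsub>H S\<^esub> h)) (carrier S) (carrier S)"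
        using h Hom_comp[OF aa g rG] by auto
    qed
  qed
  have fRad: "\<Gamma>.fdmod ?Rad" by (rule \<Gamma>.fdmod_sub[OF fdmod_H[OF fdX[OF S(1)]] sub])
  obtain V :: "('k, 'g \<Rightarrow> 'g) rmod" where V: "V \<in> fg_modules \<Gamma>" "isomorphic \<Gamma> ?Rad V"
    by (rule \<Gamma>.fg_representative[OF fRad])
  obtain Q \<delta> where "projective_resolution \<Gamma> V Q \<delta>" "\<forall>j>m. zero_module (Q (Suc j))"
    using bounded[OF V(1)] by blast
  then have "weight V = 0" by (rule weight_finite_resolution[OF V(1)])
  moreover have rV: "right_module \<Gamma> V"
    by (rule \<Gamma>.fdmodD(1)[OF V(1)[unfolded \<Gamma>.fg_modules_iff]])
  ultimately have weightRad: "weight ?Rad = 0" using weight_iso[OF fRad rV V(2)] by simp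
  have ps: "idem_part R ?Rad = idem_part R (H S) \<inter> ?rad" for R unfolding idem_part_def by auto
  have d: "dim_at R ?Rad = vdim K ((underlying_space \<Gamma> (H S))\<lparr>carrier := idem_part R (H S) \<inter> ?rad\<rparr>)" for R
    unfolding dim_at_def ps by simp
  have other: "dim_at R ?Rad = dim_at R (H S)" if R: "R \<in> X" "R \<noteq> S" for R
  proof -
    have "h \<in> ?rad" if "h \<in> idem_part R (H S)" for h
    proof (intro CollectI conjI ballI notI)
      have "h \<in> (\<lambda>f. compose (carrier S) (\<iota> R) f) ` Hom A S R"
        using that unfolding idem_part_H[OF R(1) rS] .
      then obtain f where f: "h = compose (carrier S) (\<iota> R) f" "f \<in> Hom A S R" by (rule imageE)
      show h: "h \<in> Hom A S G" unfolding f(1) by (rule Hom_comp[OF f(2) \<iota>[OF R(1)] rS])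
      fix g assume g: "g \<in> Hom A G S" and b: "bij_betw (compose (carrier S) g h) (carrier S) (carrier S)"
      have "compose (carrier S) g h = compose (carrier S) (compose (carrier R) g (\<iota> R)) f"
        unfolding f(1) by (rule comp_assoc[OF f(2)])
      then have "bij_betw f (carrier S) (carrier R)"
        using summand_of_trivial_idem_iso[OF rS S(2) rX[OF R(1)] triv[OF R(1)] f(2) Hom_comp[OF \<iota>[OF R(1)] g rX[OF R(1)]]] b
        by simp
      then have "isomorphic A S R" using f(2) unfolding isomorphic_def by blast
      then show False using noniso[OF S(1) R(1)] R(2) by blast
    qed
    then have "idem_part R (H S) \<inter> ?rad = idem_part R (H S)" by blast
    then show ?thesis unfolding d unfolding dim_at_def by simp
  qed
  have self: "dim_at S ?Rad < dim_at S (H S)"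
  proof -
    let ?U = "(underlying_space \<Gamma> (H S))\<lparr>carrier := idem_part S (H S)\<rparr>"
    have fdU: "fd_space K ?U"
      by (rule fd_subspace(1)[OF \<Gamma>.fdmodD(2)[OF fdmod_H[OF fdX[OF S(1)]]] submodule_idem_part[OF S(1) rHS]])
    have "submodule K (idem_part S (H S) \<inter> ?rad) (underlying_space \<Gamma> (H S))"
      by (rule submodule_Int[OF submodule_idem_part[OF S(1) rHS] \<Gamma>.submodule_US[OF rHS sub]])
    moreover have "Module.module K ?U" using fdU by (simp add: fd_space_def vectorspace_def)
    ultimately have sm: "submodule K (idem_part S (H S) \<inter> ?rad) ?U"
      unfolding submodule_def by auto
    have "\<iota> S \<in> idem_part S (H S)"
    proof -
      have "compose (carrier S) (idem S) (\<iota> S) = \<iota> S"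
        by (rule Hom_eqI[OF Hom_comp[OF \<iota>[OF S(1)] idem_closed[OF S(1), unfolded \<Gamma>_simps] rS] \<iota>[OF S(1)]])
          (simp add: compose_eq idem_def Hom_closed[OF \<iota>[OF S(1)]] \<pi>\<iota>[OF S(1)])
      then show ?thesis using \<iota>[OF S(1)] by (simp add: idem_part_def)
    qed
    moreover have "\<iota> S \<notin> ?rad"
    proof
      assume "\<iota> S \<in> ?rad"
      then have "\<not> bij_betw (compose (carrier S) (\<pi> S) (\<iota> S)) (carrier S) (carrier S)" using \<pi>[OF S(1)] by blast
      moreover have "bij_betw (compose (carrier S) (\<pi> S) (\<iota> S)) (carrier S) (carrier S)"
        by (rule bij_betw_byWitness[where f' = "\<lambda>x. x"]) (auto simp: compose_eq \<pi>\<iota>[OF S(1)])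
      ultimately show False by blast
    qed
    ultimately have "idem_part S (H S) \<inter> ?rad \<noteq> carrier ?U" by auto
    then have "vdim K (?U\<lparr>carrier := idem_part S (H S) \<inter> ?rad\<rparr>) \<noteq> vdim K ?U"
      using fd_subspace(3)[OF fdU sm] by blast
    moreover have "vdim K (?U\<lparr>carrier := idem_part S (H S) \<inter> ?rad\<rparr>) \<le> vdim K ?U"
      by (rule fd_subspace(2)[OF fdU sm])
    ultimately show ?thesis unfolding d unfolding dim_at_def by simp
  qed
  have "0 = weight (H S) - weight ?Rad" using weightRad weight_H[OF S(1)] by simp
  also have "\<dots> = (\<Sum>R\<in>X. n R * (int (dim_at R (H S)) - int (dim_at R ?Rad)))"
    unfolding weight_def sum_subtractf[symmetric] by (simp only: right_diff_distrib)
  also have "\<dots> = (\<Sum>R\<in>X. if R = S then n S * (int (dim_at S (H S)) - int (dim_at S ?Rad)) else 0)"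
    by (rule sum.cong) (use other in auto)
  also have "\<dots> = n S * (int (dim_at S (H S)) - int (dim_at S ?Rad))" using finX S(1) by simp
  finally show ?thesis using self by simp
qed

end

end

section \<open>Grothendieck groups\<close>

lemma iso_class_cong:
  assumes "fd_algebra K A" "M \<in> fg_modules A" "N \<in> fg_modules A" "isomorphic A M N"
  shows "iso_class A M = iso_class A N"
proof -
  have r: "right_module A L" if "L \<in> fg_modules A" for L using that by (simp add: fg_modules_def)
  show ?thesis unfolding iso_class_def
    using isomorphic_trans[OF assms(4)] isomorphic_trans[OF isomorphic_sym[OF assms(4)]] r assms(2,3) by blast
qed

context fd_algebra
begin

abbreviation cls :: "('k, 'a) rmod \<Rightarrow> ('k, 'a) rmod set \<Rightarrow>\<^sub>0 int" where
  "cls M \<equiv> frag_of (iso_class A M)"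

lemma cls_cong: "\<lbrakk>M \<in> fg_modules A; N \<in> fg_modules A; isomorphic A M N\<rbrakk> \<Longrightarrow> cls M = cls N"
  using iso_class_cong fd_algebra_axioms by metis

lemma iso_class_in: "M \<in> fg_modules A \<Longrightarrow> iso_class A M \<in> iso_classes A"
  by (simp add: iso_classes_def)

subsection \<open>Relatively exact sequences\<close>

lemma klinear_postcomp:
  assumes k: "k \<in> Hom A N L" and R: "right_module A R"
  shows "klinear K (hom_space A R N) (hom_space A R L) (\<lambda>h. compose (carrier R) k h)"
  unfolding klinear_def
proof (intro conjI ballI)
  show "(\<lambda>h. compose (carrier R) k h) ` carrier (hom_space A R N) \<subseteq> carrier (hom_space A R L)"
    using Hom_comp[OF _ k R] by auto
  show "compose (carrier R) k (x \<oplus>\<^bsub>hom_space A R N\<^esub> y) =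
    compose (carrier R) k x \<oplus>\<^bsub>hom_space A R L\<^esub> compose (carrier R) k y"
    if "x \<in> carrier (hom_space A R N)" "y \<in> carrier (hom_space A R N)" for x y
    using that comp_add_right[OF k] by simp
  fix c x assume c: "c \<in> carrier K" and x: "x \<in> carrier (hom_space A R N)"
  then have x': "x \<in> Hom A R N" by simp
  show "compose (carrier R) k (c \<odot>\<^bsub>hom_space A R N\<^esub> x) = c \<odot>\<^bsub>hom_space A R L\<^esub> compose (carrier R) k x"
    unfolding hom_space_simps
    by (rule ext) (simp add: compose_def Hom_closed[OF x'] Hom_act[OF k scalar_closed[OF c]])
qed

text \<open>
  \<open>Hom(R, -)\<close> is left exact, and exact on the given sequence by the choice of \<open>R\<close>.
\<close>

lemma rel_exact_vdim:
  assumes ex: "rel_exact A Y M N L f g" and R: "R \<in> Y" "fdmod R"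
  shows "vdim K (hom_space A R N) = vdim K (hom_space A R M) + vdim K (hom_space A R L)"
proof -
  have fM: "fdmod M" and fN: "fdmod N" and fL: "fdmod L" and f: "f \<in> Hom A M N" and g: "g \<in> Hom A N L"
    and inj: "inj_on f (carrier M)" and im: "f ` carrier M = mker N L g"
    and onto: "(\<lambda>h. compose (carrier R) g h) ` Hom A R N = Hom A R L"
    using ex R(1) unfolding rel_exact_def fg_modules_iff by blast+
  note rM = fdmodD(1)[OF fM] and rN = fdmodD(1)[OF fN] and rL = fdmodD(1)[OF fL] and rR = fdmodD(1)[OF R(2)]
  interpret N: right_module A N by (rule rN)
  interpret M: right_module A M by (rule rM)
  note lin = klinear_postcomp[OF _ rR]
  let ?T = "\<lambda>h. compose (carrier R) g h" and ?S = "\<lambda>h. compose (carrier R) f h"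
  note fdN = fd_hom_space[OF R(2) fN] and fdM = fd_hom_space[OF R(2) fM]
  note vL = vectorspace_hom_space[OF rR rL] and vN = vectorspace_hom_space[OF rR rN]
  let ?ker = "{h \<in> carrier (hom_space A R N). ?T h = \<zero>\<^bsub>hom_space A R L\<^esub>}"
  have "vdim K (hom_space A R N) = vdim K (hom_space A R L) + vdim K ((hom_space A R N)\<lparr>carrier := ?ker\<rparr>)"
    by (rule rank_nullity_vdim(2)[OF fdN vL lin[OF g]]) (use onto in simp)
  moreover have "vdim K ((hom_space A R N)\<lparr>carrier := ?ker\<rparr>) = vdim K (hom_space A R M)"
  proof (rule vdim_iso(2)[OF fdM])
    show "vectorspace K ((hom_space A R N)\<lparr>carrier := ?ker\<rparr>)"
      by (rule subspace_vectorspace[OF vN kernel_submodule[OF vN vL lin[OF g]]])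
    have gf: "g (f x) = \<zero>\<^bsub>L\<^esub>" if "x \<in> carrier M" for x
      using im that unfolding mker_def by blast
    have ker: "?S ` Hom A R M = ?ker"
    proof (intro equalityI subsetI)
      fix k assume "k \<in> ?S ` Hom A R M"
      then obtain h where h: "h \<in> Hom A R M" "k = ?S h" by blast
      have "?T (?S h) = (\<lambda>x\<in>carrier R. \<zero>\<^bsub>L\<^esub>)"
        by (rule ext) (simp add: compose_def gf Hom_closed[OF h(1)])
      then show "k \<in> ?ker" using Hom_comp[OF h(1) f rR] h(2) by simp
    next
      fix k assume "k \<in> ?ker"
      then have k: "k \<in> Hom A R N" and z: "?T k = (\<lambda>x\<in>carrier R. \<zero>\<^bsub>L\<^esub>)" by simp_all
      have "k x \<in> f ` carrier M" if x: "x \<in> carrier R" for x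
      proof -
        have "g (k x) = \<zero>\<^bsub>L\<^esub>" using fun_cong[OF z, of x] x by (simp add: compose_eq)
        then show ?thesis unfolding im mker_def using Hom_closed[OF k x] by simp
      qed
      then have k': "k \<in> Hom A R (N\<lparr>carrier := f ` carrier M\<rparr>)"
        by (intro Hom_corestrict[OF k]) blast
      have f': "f \<in> Hom A M (N\<lparr>carrier := f ` carrier M\<rparr>)" by (rule Hom_corestrict[OF f order_refl])
      have r': "right_module A (N\<lparr>carrier := f ` carrier M\<rparr>)"
        by (rule right_module_sub[OF rN subm_image[OF f rM rN]])
      have "bij_betw f (carrier M) (carrier (N\<lparr>carrier := f ` carrier M\<rparr>))" using inj by (simp add: bij_betw_def)
      then obtain f1 where f1: "f1 \<in> Hom A (N\<lparr>carrier := f ` carrier M\<rparr>) M"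
        "bij_betw f1 (carrier (N\<lparr>carrier := f ` carrier M\<rparr>)) (carrier M)"
        "\<forall>x\<in>carrier M. f1 (f x) = x" "\<forall>y\<in>carrier (N\<lparr>carrier := f ` carrier M\<rparr>). f (f1 y) = y"
        by (rule Hom_inverse[OF f' rM r'])
      have "?S (compose (carrier R) f1 k) = k"
      proof (rule Hom_eqI[OF Hom_comp[OF Hom_comp[OF k' f1(1) rR] f rR] k])
        fix x assume x: "x \<in> carrier R"
        show "?S (compose (carrier R) f1 k) x = k x"
          unfolding compose_eq[OF x] by (rule bspec[OF f1(4) Hom_closed[OF k' x]])
      qed
      then show "k \<in> ?S ` Hom A R M" using Hom_comp[OF k' f1(1) rR] by (metis image_eqI)
    qed
    show "klinear K (hom_space A R M) ((hom_space A R N)\<lparr>carrier := ?ker\<rparr>) ?S"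
      using lin[OF f] ker unfolding klinear_def by auto
    have "inj_on ?S (Hom A R M)"
    proof (rule inj_onI)
      fix h k assume h: "h \<in> Hom A R M" and k: "k \<in> Hom A R M" and eq: "?S h = ?S k"
      show "h = k"
      proof (rule Hom_eqI[OF h k])
        fix x assume x: "x \<in> carrier R"
        have "f (h x) = f (k x)" using fun_cong[OF eq, of x] unfolding compose_eq[OF x] .
        then show "h x = k x" using inj_onD[OF inj] Hom_closed[OF h x] Hom_closed[OF k x] by blast
      qed
    qed
    then show "bij_betw ?S (carrier (hom_space A R M)) (carrier ((hom_space A R N)\<lparr>carrier := ?ker\<rparr>))"
      unfolding bij_betw_def using ker by simp
  qed
  ultimately show ?thesis by simp
qed

lemma vdim_hom_iso:
  assumes i: "isomorphic A M N" and f: "fdmod M" "fdmod N" "fdmod R"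
  shows "vdim K (hom_space A R M) = vdim K (hom_space A R N)"
proof -
  note rM = fdmodD(1)[OF f(1)] and rN = fdmodD(1)[OF f(2)] and rR = fdmodD(1)[OF f(3)]
  obtain \<phi> where \<phi>: "\<phi> \<in> Hom A M N" "bij_betw \<phi> (carrier M) (carrier N)"
    using i unfolding isomorphic_def by blast
  obtain \<psi> where \<psi>: "\<psi> \<in> Hom A N M" "bij_betw \<psi> (carrier N) (carrier M)"
      "\<forall>x\<in>carrier M. \<psi> (\<phi> x) = x" "\<forall>y\<in>carrier N. \<phi> (\<psi> y) = y"
    by (rule Hom_inverse[OF \<phi>(1) rM rN \<phi>(2)])
  let ?T = "\<lambda>h. compose (carrier R) \<phi> h"
  have "klinear K (hom_space A R M) (hom_space A R N) ?T" by (rule klinear_postcomp[OF \<phi>(1) rR])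
  moreover have "bij_betw ?T (Hom A R M) (Hom A R N)"
  proof (rule bij_betw_byWitness[where f' = "\<lambda>h. compose (carrier R) \<psi> h"])
    show "\<forall>h\<in>Hom A R M. compose (carrier R) \<psi> (?T h) = h"
    proof
      fix h assume h: "h \<in> Hom A R M"
      show "compose (carrier R) \<psi> (?T h) = h"
        by (rule Hom_eqI[OF Hom_comp[OF Hom_comp[OF h \<phi>(1) rR] \<psi>(1) rR] h])
          (use \<psi>(3) Hom_closed[OF h] in \<open>simp add: compose_eq\<close>)
    qed
    show "\<forall>h\<in>Hom A R N. ?T (compose (carrier R) \<psi> h) = h"
    proof
      fix h assume h: "h \<in> Hom A R N"
      show "?T (compose (carrier R) \<psi> h) = h"
        by (rule Hom_eqI[OF Hom_comp[OF Hom_comp[OF h \<psi>(1) rR] \<phi>(1) rR] h])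
          (use \<psi>(4) Hom_closed[OF h] in \<open>simp add: compose_eq\<close>)
    qed
  qed (use Hom_comp[OF _ \<phi>(1) rR] Hom_comp[OF _ \<psi>(1) rR] in auto)
  ultimately show ?thesis
    using vdim_iso(2)[OF fd_hom_space[OF f(3,1)] vectorspace_hom_space[OF rR rN]] by simp
qed

lemma rel_exact_kernel:
  assumes C: "fdmod C" and M: "fdmod M" and c: "c \<in> Hom A C M" and surj: "c ` carrier C = carrier M"
    and lift: "\<And>R h. \<lbrakk>R \<in> Y; h \<in> Hom A R M\<rbrakk> \<Longrightarrow> \<exists>j\<in>Hom A R C. \<forall>x\<in>carrier R. c (j x) = h x"
    and Y: "\<And>R. R \<in> Y \<Longrightarrow> fdmod R"
  shows "rel_exact A Y (C\<lparr>carrier := mker C M c\<rparr>) C M (\<lambda>x\<in>mker C M c. x) c"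
proof -
  note rC = fdmodD(1)[OF C] and rM = fdmodD(1)[OF M]
  note k = subm_mker[OF c rC rM]
  have "(\<lambda>h. compose (carrier R) c h) ` Hom A R C = Hom A R M" if R: "R \<in> Y" for R
  proof (intro equalityI subsetI)
    note rR = fdmodD(1)[OF Y[OF R]]
    fix h assume "h \<in> (\<lambda>h. compose (carrier R) c h) ` Hom A R C"
    then show "h \<in> Hom A R M" using Hom_comp[OF _ c rR] by auto
  next
    note rR = fdmodD(1)[OF Y[OF R]]
    fix h assume h: "h \<in> Hom A R M"
    obtain j where j: "j \<in> Hom A R C" "\<forall>x\<in>carrier R. c (j x) = h x" using lift[OF R h] by blast
    have "compose (carrier R) c j = h"
      by (rule Hom_eqI[OF Hom_comp[OF j(1) c rR] h]) (use j(2) in \<open>simp add: compose_eq\<close>)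
    then show "h \<in> (\<lambda>h. compose (carrier R) c h) ` Hom A R C" using j(1) by blast
  qed
  then show ?thesis
    unfolding rel_exact_def fg_modules_iff
    using C M fdmod_sub[OF C k] Hom_inclusion[OF k] c surj by (simp add: inj_on_def)
qed

text \<open>
  A split sequence is relatively exact, so the relations \<open>[M \<oplus> N] = [M] + [N]\<close> hold in \<open>K\<^sub>0(A, Y)\<close>.
\<close>

lemma rel_exact_dsum:
  assumes D: "D \<in> fg_modules A" and M: "M \<in> fg_modules A" and N: "N \<in> fg_modules A"
    and i: "isomorphic A D (dsum M N)" and Y: "\<And>R. R \<in> Y \<Longrightarrow> fdmod R"
  shows "\<exists>f g. rel_exact A Y M D N f g"
proof -
  note fD = D[unfolded fg_modules_iff] and fM = M[unfolded fg_modules_iff] and fN = N[unfolded fg_modules_iff]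
  note rD = fdmodD(1)[OF fD] and rM = fdmodD(1)[OF fM] and rN = fdmodD(1)[OF fN]
  note rS = right_module_dsum[OF rM rN] and ip = Hom_dsum[OF rM rN]
  let ?S = "dsum M N"
  obtain \<phi> where \<phi>: "\<phi> \<in> Hom A D ?S" "bij_betw \<phi> (carrier D) (carrier ?S)"
    using i unfolding isomorphic_def by blast
  obtain \<psi> where \<psi>: "\<psi> \<in> Hom A ?S D" "bij_betw \<psi> (carrier ?S) (carrier D)"
      "\<forall>x\<in>carrier D. \<psi> (\<phi> x) = x" "\<forall>y\<in>carrier ?S. \<phi> (\<psi> y) = y"
    by (rule Hom_inverse[OF \<phi>(1) rD rS \<phi>(2)])
  interpret M: right_module A M by (rule rM)
  interpret N: right_module A N by (rule rN)
  let ?f = "compose (carrier M) \<psi> (\<lambda>x\<in>carrier M. (x, \<zero>\<^bsub>N\<^esub>))"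
  let ?g = "compose (carrier D) (\<lambda>z\<in>carrier ?S. snd z) \<phi>"
  have f: "?f \<in> Hom A M D" and g: "?g \<in> Hom A D N"
    by (rule Hom_comp[OF ip(1) \<psi>(1) rM], rule Hom_comp[OF \<phi>(1) ip(4) rD])
  have f_app: "?f x = \<psi> (x, \<zero>\<^bsub>N\<^esub>)" if "x \<in> carrier M" for x using that by (simp add: compose_eq)
  have g_app: "?g z = snd (\<phi> z)" if "z \<in> carrier D" for z
    using that Hom_closed[OF \<phi>(1) that] by (simp add: compose_eq)
  have \<phi>f: "\<phi> (?f x) = (x, \<zero>\<^bsub>N\<^esub>)" if "x \<in> carrier M" for x
    unfolding f_app[OF that] using \<psi>(4) that by simp
  have "inj_on ?f (carrier M)" by (rule inj_onI) (metis \<phi>f prod.inject)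
  moreover have "?f ` carrier M = mker D N ?g"
  proof (intro equalityI subsetI)
    fix z assume "z \<in> ?f ` carrier M"
    then obtain x where x: "x \<in> carrier M" "z = ?f x" by blast
    have "?g z = \<zero>\<^bsub>N\<^esub>" unfolding x(2) g_app[OF Hom_closed[OF f x(1)]] \<phi>f[OF x(1)] by simp
    then show "z \<in> mker D N ?g" unfolding mker_def using Hom_closed[OF f x(1)] x(2) by simp
  next
    fix z assume "z \<in> mker D N ?g"
    then have z: "z \<in> carrier D" "snd (\<phi> z) = \<zero>\<^bsub>N\<^esub>" unfolding mker_def using g_app by auto
    have c: "fst (\<phi> z) \<in> carrier M" using Hom_closed[OF \<phi>(1) z(1)] by auto
    have "(fst (\<phi> z), \<zero>\<^bsub>N\<^esub>) = \<phi> z" using z(2) by (metis prod.collapse)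
    then have "?f (fst (\<phi> z)) = \<psi> (\<phi> z)" using f_app[OF c] by simp
    then have "?f (fst (\<phi> z)) = z" using \<psi>(3) z(1) by simp
    then show "z \<in> ?f ` carrier M" using c by (metis image_eqI)
  qed
  moreover have lift: "\<exists>j\<in>Hom A R D. compose (carrier R) ?g j = h" if R: "right_module A R" and h: "h \<in> Hom A R N"
    for h and R :: "('k, 'a) rmod"
  proof -
    let ?j = "compose (carrier R) \<psi> (compose (carrier R) (\<lambda>y\<in>carrier N. (\<zero>\<^bsub>M\<^esub>, y)) h)"
    have j: "?j \<in> Hom A R D" by (rule Hom_comp[OF Hom_comp[OF h ip(2) R] \<psi>(1) R])
    have "compose (carrier R) ?g ?j = h"
    proof (rule Hom_eqI[OF Hom_comp[OF j g R] h])
      fix x assume x: "x \<in> carrier R"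
      have "?j x = \<psi> (\<zero>\<^bsub>M\<^esub>, h x)" using x Hom_closed[OF h x] by (simp add: compose_eq)
      moreover have "\<phi> (\<psi> (\<zero>\<^bsub>M\<^esub>, h x)) = (\<zero>\<^bsub>M\<^esub>, h x)" using \<psi>(4) Hom_closed[OF h x] by simp
      ultimately have "\<phi> (?j x) = (\<zero>\<^bsub>M\<^esub>, h x)" by metis
      then show "compose (carrier R) ?g ?j x = h x"
        unfolding compose_eq[OF x, of ?g ?j] g_app[OF Hom_closed[OF j x]] by simp
    qed
    then show ?thesis using j by blast
  qed
  moreover have "?g ` carrier D = carrier N"
  proof (intro equalityI subsetI)
    fix y assume y: "y \<in> carrier N"
    have s: "(\<zero>\<^bsub>M\<^esub>, y) \<in> carrier ?S" using y by simp
    have "?g (\<psi> (\<zero>\<^bsub>M\<^esub>, y)) = y" unfolding g_app[OF Hom_closed[OF \<psi>(1) s]] using \<psi>(4) s by simp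
    then show "y \<in> ?g ` carrier D" using Hom_closed[OF \<psi>(1) s] by (metis image_eqI)
  qed (use Hom_closed[OF g] in blast)
  moreover have "(\<lambda>h. compose (carrier R) ?g h) ` Hom A R D = Hom A R N" if R: "R \<in> Y" for R
  proof (intro equalityI subsetI)
    fix h assume "h \<in> Hom A R N"
    then show "h \<in> (\<lambda>h. compose (carrier R) ?g h) ` Hom A R D"
      using lift[OF fdmodD(1)[OF Y[OF R]]] by (metis image_eqI)
  next
    fix h assume "h \<in> (\<lambda>h. compose (carrier R) ?g h) ` Hom A R D"
    then show "h \<in> Hom A R N" using Hom_comp[OF _ g fdmodD(1)[OF Y[OF R]]] by auto
  qed
  ultimately have "rel_exact A Y M D N ?f ?g" unfolding rel_exact_def using D M N f g by simp
  then show ?thesis by blast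
qed

subsection \<open>The subgroup of relations\<close>

lemma group_free_K0: "group (free_K0 A)"
  unfolding free_K0_def by simp

lemma rel_subgroup_is_subgroup: "subgroup (rel_subgroup A Y) (free_K0 A)"
  unfolding rel_subgroup_def
proof (rule group.generate_is_subgroup[OF group_free_K0], safe)
  fix M N L f g assume "rel_exact A Y M N L f g"
  then have "M \<in> fg_modules A" "N \<in> fg_modules A" "L \<in> fg_modules A" by (simp_all add: rel_exact_def)
  then show "cls M - cls N + cls L \<in> carrier (free_K0 A)"
    unfolding free_K0_def carrier_free_Abelian_group_iff
    using keys_add[of "cls M - cls N" "cls L"] keys_diff[of "cls M" "cls N"] iso_class_in by auto
qed

lemma rel_subgroup_carrier: "x \<in> rel_subgroup A Y \<Longrightarrow> Poly_Mapping.keys x \<subseteq> iso_classes A"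
  using subsetD[OF subgroup.subset[OF rel_subgroup_is_subgroup[of Y]], of x] by (simp add: free_K0_def)

lemma rel_subgroup_0: "0 \<in> rel_subgroup A Y"
  using subgroup.one_closed[OF rel_subgroup_is_subgroup[of Y]] by (simp add: free_K0_def)

lemma rel_subgroup_add: "\<lbrakk>x \<in> rel_subgroup A Y; y \<in> rel_subgroup A Y\<rbrakk> \<Longrightarrow> x + y \<in> rel_subgroup A Y"
  using subgroup.m_closed[OF rel_subgroup_is_subgroup[of Y]] by (simp add: free_K0_def)

lemma rel_subgroup_minus: "x \<in> rel_subgroup A Y \<Longrightarrow> - x \<in> rel_subgroup A Y"
  using subgroup.m_inv_closed[OF rel_subgroup_is_subgroup[of Y], of x] rel_subgroup_carrier[of x Y]
  by (simp add: free_K0_def)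

lemma rel_subgroup_diff: "\<lbrakk>x \<in> rel_subgroup A Y; y \<in> rel_subgroup A Y\<rbrakk> \<Longrightarrow> x - y \<in> rel_subgroup A Y"
  using rel_subgroup_add[OF _ rel_subgroup_minus] by (metis diff_conv_add_uminus)

lemma rel_subgroup_gen: "rel_exact A Y M N L f g \<Longrightarrow> cls M - cls N + cls L \<in> rel_subgroup A Y"
  unfolding rel_subgroup_def by (rule generate.incl) blast

lemma split_subgroup_subset:
  assumes Y: "\<And>R. R \<in> Y \<Longrightarrow> fdmod R"
  shows "split_subgroup A \<subseteq> rel_subgroup A Y"
  unfolding split_subgroup_def
proof (rule group.generate_subgroup_incl[OF group_free_K0 _ rel_subgroup_is_subgroup], safe)
  fix D M N assume D: "D \<in> fg_modules A" "M \<in> fg_modules A" "N \<in> fg_modules A" "isomorphic A D (dsum M N)"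
  obtain f g where "rel_exact A Y M D N f g" using rel_exact_dsum[OF D Y] by blast
  then have "- (cls M - cls D + cls N) \<in> rel_subgroup A Y" using rel_subgroup_gen rel_subgroup_minus by blast
  then show "cls D - (cls M + cls N) \<in> rel_subgroup A Y" by (simp add: algebra_simps)
qed

lemma split_subgroup_is_subgroup: "subgroup (split_subgroup A) (free_K0 A)"
  unfolding split_subgroup_def
proof (rule group.generate_is_subgroup[OF group_free_K0], safe)
  fix D M N assume "D \<in> fg_modules A" "M \<in> fg_modules A" "N \<in> fg_modules A"
  then show "cls D - (cls M + cls N) \<in> carrier (free_K0 A)"
    unfolding free_K0_def carrier_free_Abelian_group_iff
    using keys_diff[of "cls D" "cls M + cls N"] keys_add[of "cls M" "cls N"] iso_class_in by auto
qed

subsection \<open>Dimensions of homomorphism spaces\<close>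

text \<open>
  The coordinate at \<open>R\<close> of \<open>dim_hom_free\<close>, for arbitrary \<open>R\<close>.
\<close>

definition hdim :: "('k, 'a) rmod \<Rightarrow> (('k, 'a) rmod set \<Rightarrow>\<^sub>0 int) \<Rightarrow> int" where
  "hdim R x = (\<Sum>c\<in>Poly_Mapping.keys x. Poly_Mapping.lookup x c * int (vdim K (hom_space A R (SOME M. M \<in> c))))"

lemma hdim_superset:
  assumes "finite S" "Poly_Mapping.keys x \<subseteq> S"
  shows "hdim R x = (\<Sum>c\<in>S. Poly_Mapping.lookup x c * int (vdim K (hom_space A R (SOME M. M \<in> c))))"
  unfolding hdim_def by (rule sum.mono_neutral_left[OF assms]) (simp add: in_keys_iff)

lemma hdim_add: "hdim R (x + y) = hdim R x + hdim R y"
proof -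
  let ?S = "Poly_Mapping.keys x \<union> Poly_Mapping.keys y"
  have "finite ?S" by simp
  note s = hdim_superset[OF this]
  show ?thesis
    unfolding s[OF keys_add] s[OF Un_upper1] s[OF Un_upper2] sum.distrib[symmetric]
    by (rule sum.cong) (simp_all add: lookup_add algebra_simps)
qed

lemma hdim_0: "hdim R 0 = 0"
  by (simp add: hdim_def)

lemma hdim_minus: "hdim R (- x) = - hdim R x"
  using hdim_add[of R x "- x"] by (simp add: hdim_0)

lemma hdim_diff: "hdim R (x - y) = hdim R x - hdim R y"
  using hdim_add[of R x "- y"] by (simp add: hdim_minus)

lemma hdim_sum: "hdim R (sum f S) = (\<Sum>i\<in>S. hdim R (f i))"
  by (induction S rule: infinite_finite_induct) (simp_all add: hdim_0 hdim_add)

lemma hdim_cmul: "hdim R (frag_cmul k x) = k * hdim R x"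
  unfolding hdim_superset[OF finite_keys keys_cmul[of k x]] unfolding hdim_def sum_distrib_left
  by (rule sum.cong) simp_all

lemma hdim_cls:
  assumes "M \<in> fg_modules A" "fdmod R"
  shows "hdim R (cls M) = int (vdim K (hom_space A R M))"
proof -
  have fM: "fdmod M" using assms(1) by (simp add: fg_modules_iff)
  have "M \<in> iso_class A M" using assms(1) isomorphic_refl[OF fdmodD(1)[OF fM]] by (simp add: iso_class_def)
  then have "(SOME N. N \<in> iso_class A M) \<in> iso_class A M" by (rule someI)
  then have i: "isomorphic A M (SOME N. N \<in> iso_class A M)" and f: "fdmod (SOME N. N \<in> iso_class A M)"
    unfolding iso_class_def fg_modules_iff by blast+
  show ?thesis unfolding hdim_def by (simp add: vdim_hom_iso[OF i fM f assms(2)])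
qed

lemma hdim_rel_subgroup:
  assumes x: "x \<in> rel_subgroup A Y" and Y: "\<And>R. R \<in> Y \<Longrightarrow> fdmod R" and R: "R \<in> Y"
  shows "hdim R x = 0"
proof -
  let ?gens = "{cls M - cls N + cls L | M N L. \<exists>f g. rel_exact A Y M N L f g}"
  have gens: "hdim R h = 0 \<and> Poly_Mapping.keys h \<subseteq> iso_classes A" if h: "h \<in> ?gens" for h
  proof -
    obtain M N L f g where h: "h = cls M - cls N + cls L" and ex: "rel_exact A Y M N L f g" using h by blast
    have fg: "M \<in> fg_modules A" "N \<in> fg_modules A" "L \<in> fg_modules A" using ex by (simp_all add: rel_exact_def)
    have "hdim R h = 0" unfolding h
      using rel_exact_vdim[OF ex R Y[OF R]] by (simp add: hdim_add hdim_diff hdim_cls[OF _ Y[OF R]] fg)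
    moreover have "h \<in> rel_subgroup A Y" unfolding h by (rule rel_subgroup_gen[OF ex])
    ultimately show ?thesis using rel_subgroup_carrier by blast
  qed
  show ?thesis using x unfolding rel_subgroup_def
  proof (induction rule: generate.induct)
    case one
    then show ?case by (simp add: free_K0_def hdim_0)
  next
    case (incl h)
    then show ?case using gens by blast
  next
    case (inv h)
    then have "hdim R h = 0" "Poly_Mapping.keys h \<subseteq> iso_classes A" using gens by blast+
    then show ?case by (simp add: free_K0_def hdim_minus)
  next
    case (eng h1 h2)
    then show ?case by (simp add: free_K0_def hdim_add)
  qed
qed

end

section \<open>The two invariants\<close>

context fd_algebra
begin

text \<open>
  The class of \<open>y\<close> in \<open>K\<^sub>0(A, Y)\<close> is an integral combination of the classes of the members of \<open>Y\<close>.
\<close>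

definition in_span :: "('k, 'a) rmod set \<Rightarrow> (('k, 'a) rmod set \<Rightarrow>\<^sub>0 int) \<Rightarrow> bool" where
  "in_span Y y \<longleftrightarrow> (\<exists>n. y - (\<Sum>R\<in>Y. frag_cmul (n R) (cls R)) \<in> rel_subgroup A Y)"

lemma in_span_rel: "y \<in> rel_subgroup A Y \<Longrightarrow> in_span Y y"
  unfolding in_span_def by (rule exI[of _ "\<lambda>_. 0"]) simp

lemma in_span_diff:
  assumes "in_span Y y" "in_span Y z"
  shows "in_span Y (y - z)"
proof -
  obtain n m where n: "y - (\<Sum>R\<in>Y. frag_cmul (n R) (cls R)) \<in> rel_subgroup A Y"
    and m: "z - (\<Sum>R\<in>Y. frag_cmul (m R) (cls R)) \<in> rel_subgroup A Y"
    using assms unfolding in_span_def by blast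
  have "(y - z) - (\<Sum>R\<in>Y. frag_cmul (n R - m R) (cls R)) =
    (y - (\<Sum>R\<in>Y. frag_cmul (n R) (cls R))) - (z - (\<Sum>R\<in>Y. frag_cmul (m R) (cls R)))"
    unfolding frag_cmul_diff_distrib sum_subtractf by simp
  then show ?thesis unfolding in_span_def using rel_subgroup_diff[OF n m] by metis
qed

lemma in_span_add:
  assumes "in_span Y y" "in_span Y z"
  shows "in_span Y (y + z)"
proof -
  have "in_span Y (0 - z)" by (rule in_span_diff[OF in_span_rel[OF rel_subgroup_0] assms(2)])
  then have "in_span Y (y - (0 - z))" by (rule in_span_diff[OF assms(1)])
  then show ?thesis by simp
qed

lemma in_span_cls:
  assumes "finite Y" "R \<in> Y"
  shows "in_span Y (cls R)"
proof -
  have "(\<Sum>R'\<in>Y. frag_cmul (if R' = R then 1 else 0) (cls R')) = (\<Sum>R'\<in>Y. if R' = R then cls R else 0)"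
    by (rule sum.cong) simp_all
  also have "\<dots> = cls R" using assms by simp
  finally have "cls R - (\<Sum>R'\<in>Y. frag_cmul (if R' = R then 1 else 0) (cls R')) \<in> rel_subgroup A Y"
    using rel_subgroup_0 by simp
  then show ?thesis unfolding in_span_def by (rule exI[of _ "\<lambda>R'. if R' = R then 1 else 0"])
qed

text \<open>
  A splitting \<open>M = ker e \<oplus> im e\<close> is a relation, so the claim passes from the summands to \<open>M\<close>.
\<close>

lemma in_span_id_thru:
  assumes Y: "finite Y" "\<And>R. R \<in> Y \<Longrightarrow> fdmod R" "\<And>R. R \<in> Y \<Longrightarrow> trivial_idem A R"
    and N: "fdmod N" "id_thru A Y N"
  shows "in_span Y (cls N)"
proof (rule krull_schmidt_induct[OF N, where P = "\<lambda>N. in_span Y (cls N)"])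
  show "right_module A R" if "R \<in> Y" for R by (rule fdmodD(1)[OF Y(2)[OF that]])
  show "trivial_idem A R" if "R \<in> Y" for R by (rule Y(3)[OF that])
  show "in_span Y (cls M)" if M: "fdmod M" "e \<in> Hom A M M" "compose (carrier M) e e = e"
    "in_span Y (cls (M\<lparr>carrier := mker M M e\<rparr>))" "in_span Y (cls (M\<lparr>carrier := e ` carrier M\<rparr>))" for M e
  proof -
    note rM = fdmodD(1)[OF M(1)]
    note ip = idempotent_kernel_projection[OF rM M(2,3)]
    let ?I = "M\<lparr>carrier := e ` carrier M\<rparr>"
    note sI = subm_image[OF M(2) rM rM]
    have fI: "fdmod ?I" by (rule fdmod_sub[OF M(1) sI])
    have eI: "e \<in> Hom A M ?I" by (rule Hom_corestrict[OF M(2)]) simp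
    have "\<exists>j\<in>Hom A R M. \<forall>x\<in>carrier R. e (j x) = h x" if "h \<in> Hom A R ?I" for R :: "('k, 'a) rmod" and h
    proof (rule bexI)
      show "h \<in> Hom A R M" by (rule Hom_expand[OF that]) (use sI in \<open>simp add: subm_def\<close>)
      show "\<forall>x\<in>carrier R. e (h x) = h x"
      proof
        fix x assume "x \<in> carrier R"
        then have "h x \<in> e ` carrier M" using Hom_closed[OF that] by simp
        then show "e (h x) = h x" by (rule ip(3))
      qed
    qed
    then have "rel_exact A Y (M\<lparr>carrier := mker M ?I e\<rparr>) M ?I (\<lambda>x\<in>mker M ?I e. x) e"
      by (intro rel_exact_kernel[OF M(1) fI eI _ _ Y(2)]) simp_all
    then have "cls (M\<lparr>carrier := mker M ?I e\<rparr>) - cls M + cls ?I \<in> rel_subgroup A Y" by (rule rel_subgroup_gen)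
    moreover have "mker M ?I e = mker M M e" by (simp add: mker_def)
    ultimately have r: "in_span Y (cls (M\<lparr>carrier := mker M M e\<rparr>) - cls M + cls ?I)" using in_span_rel by simp
    have "in_span Y ((cls (M\<lparr>carrier := mker M M e\<rparr>) + cls ?I) - (cls (M\<lparr>carrier := mker M M e\<rparr>) - cls M + cls ?I))"
      by (rule in_span_diff[OF in_span_add[OF M(4,5)] r])
    then show ?thesis by simp
  qed
  show "in_span Y (cls M)" if M: "fdmod M" "zero_module M" for M
  proof -
    note rM = fdmodD(1)[OF M(1)]
    \<comment> \<open>The sequence \<open>0 \<rightarrow> M \<rightarrow> M \<rightarrow> M \<rightarrow> 0\<close> of zero modules gives the relation \<open>[M] - [M] + [M] = [M]\<close>.\<close>
    have "rel_exact A Y (M\<lparr>carrier := mker M M (\<lambda>x\<in>carrier M. x)\<rparr>) M M (\<lambda>x\<in>mker M M (\<lambda>x\<in>carrier M. x). x) (\<lambda>x\<in>carrier M. x)"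
    proof (rule rel_exact_kernel[OF M(1) M(1) Hom_id[OF rM] _ _ Y(2)])
      show "(\<lambda>x\<in>carrier M. x) ` carrier M = carrier M" by simp
      show "\<exists>j\<in>Hom A R M. \<forall>x\<in>carrier R. (\<lambda>x\<in>carrier M. x) (j x) = h x" if "h \<in> Hom A R M" for R :: "('k, 'a) rmod" and h
        by (rule bexI[OF _ that]) (simp add: Hom_closed[OF that])
    qed
    moreover have "M\<lparr>carrier := mker M M (\<lambda>x\<in>carrier M. x)\<rparr> = M" using M(2) by (simp add: mker_def)
    ultimately have "rel_exact A Y M M M (\<lambda>x\<in>mker M M (\<lambda>x\<in>carrier M. x). x) (\<lambda>x\<in>carrier M. x)" by simp
    then have "cls M - cls M + cls M \<in> rel_subgroup A Y" by (rule rel_subgroup_gen)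
    then show ?thesis using in_span_rel by simp
  qed
  show "in_span Y (cls M)" if M: "fdmod M" "R \<in> Y" "isomorphic A M R" for M R
    using in_span_cls[OF Y(1) M(2)] cls_cong[OF _ _ M(3)] M(1) Y(2)[OF M(2)] by (simp add: fg_modules_iff)
qed

end

text \<open>
  The identity of a direct sum is the sum of the maps (inclusion)(projection).
\<close>

lemma add_generator_dsum_fam:
  fixes K :: "'k ring" and A :: "('k, 'a) module" and X :: "('a, 'x) module set"
  assumes "fd_algebra K A" "finite X" "\<And>R. R \<in> X \<Longrightarrow> fd_algebra.fdmod K A R"
  shows "add_generator K A X (dsum_fam X (\<lambda>R. R))
    (\<lambda>R. \<lambda>x\<in>carrier R. (\<lambda>i\<in>X. if i = R then x else \<zero>\<^bsub>i\<^esub>)) (\<lambda>R. \<lambda>x\<in>carrier (dsum_fam X (\<lambda>R. R)). x R)"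
proof -
  interpret fd_algebra K A by fact
  let ?G = "dsum_fam X (\<lambda>R. R)"
  let ?i = "\<lambda>R. \<lambda>x\<in>carrier R. (\<lambda>i\<in>X. if i = R then x else \<zero>\<^bsub>i\<^esub>)" and ?p = "\<lambda>R. \<lambda>x\<in>carrier ?G. x R"
  have rX: "right_module A R" if "R \<in> X" for R by (rule fdmodD(1)[OF assms(3)[OF that]])
  have ag: "abelian_group R" if "R \<in> X" for R using rX[OF that] by (simp add: right_module_def)
  note am = abelian_group.axioms(1)[OF ag]
  have fG: "fdmod ?G" by (rule fdmod_dsum_fam[OF assms(2,3)])
  have p: "?p R \<in> Hom A ?G R" and i: "?i R \<in> Hom A R ?G" if "R \<in> X" for R
    using Hom_dsum_fam[of A X "\<lambda>R. R" R, OF A.ring_axioms rX that] by blast+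
  have "(\<lambda>x\<in>carrier ?G. (\<lambda>i\<in>X. if i \<in> S then x i else \<zero>\<^bsub>i\<^esub>)) \<in> thru A X ?G ?G" if "S \<subseteq> X" for S
    using finite_subset[OF that assms(2)] that
  proof (induction S rule: finite_induct)
    case empty
    have "(\<lambda>x\<in>carrier ?G. (\<lambda>i\<in>X. if i \<in> {} then x i else \<zero>\<^bsub>i\<^esub>)) = (\<lambda>x\<in>carrier ?G. \<zero>\<^bsub>?G\<^esub>)" by simp
    then show ?case using thru_zero[of ?G ?G A X] by metis
  next
    case (insert R S)
    have R: "R \<in> X" using insert.prems by blast
    let ?s = "\<lambda>x\<in>carrier ?G. (\<lambda>i\<in>X. if i \<in> S then x i else \<zero>\<^bsub>i\<^esub>)"
    have "(\<lambda>x\<in>carrier ?G. ?s x \<oplus>\<^bsub>?G\<^esub> ?i R (?p R x)) \<in> thru A X ?G ?G"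
      by (rule thru_step[OF R p[OF R] i[OF R] insert.IH]) (use insert.prems in blast)
    moreover have "(\<lambda>x\<in>carrier ?G. ?s x \<oplus>\<^bsub>?G\<^esub> ?i R (?p R x)) =
      (\<lambda>x\<in>carrier ?G. (\<lambda>i\<in>X. if i \<in> insert R S then x i else \<zero>\<^bsub>i\<^esub>))"
    proof (rule restrict_ext)
      fix x assume x: "x \<in> carrier ?G"
      then have xc: "x i \<in> carrier i" if "i \<in> X" for i using that by auto
      have pr: "?p R x = x R" by (rule restrict_apply'[OF x])
      have s: "?s x = (\<lambda>i\<in>X. if i \<in> S then x i else \<zero>\<^bsub>i\<^esub>)" by (rule restrict_apply'[OF x])
      have ir: "?i R (x R) = (\<lambda>i\<in>X. if i = R then x R else \<zero>\<^bsub>i\<^esub>)" by (rule restrict_apply'[OF xc[OF R]])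
      show "?s x \<oplus>\<^bsub>?G\<^esub> ?i R (?p R x) = (\<lambda>i\<in>X. if i \<in> insert R S then x i else \<zero>\<^bsub>i\<^esub>)"
        unfolding pr s ir dsum_fam_simps(3)
        by (rule restrict_ext)
          (use insert.hyps xc in \<open>auto simp: abelian_monoid.l_zero[OF am] abelian_monoid.r_zero[OF am] abelian_monoid.zero_closed[OF am]\<close>)
    qed
    ultimately show ?case by metis
  qed
  from this[OF order_refl] have t: "(\<lambda>x\<in>carrier ?G. (\<lambda>i\<in>X. if i \<in> X then x i else \<zero>\<^bsub>i\<^esub>)) \<in> thru A X ?G ?G" .
  have "(\<lambda>x\<in>carrier ?G. (\<lambda>i\<in>X. if i \<in> X then x i else \<zero>\<^bsub>i\<^esub>)) = (\<lambda>x\<in>carrier ?G. x)"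
  proof (rule restrict_ext)
    fix x assume "x \<in> carrier ?G"
    then have "restrict x X = x" by (auto simp: PiE_def extensional_restrict)
    then show "(\<lambda>i\<in>X. if i \<in> X then x i else \<zero>\<^bsub>i\<^esub>) = x" by (simp cong: restrict_cong)
  qed
  then have "id_thru A X ?G" using t unfolding id_thru_def by metis
  moreover have "?p R (?i R x) = x" if "R \<in> X" "x \<in> carrier R" for R x
    using Hom_closed[OF i[OF that(1)] that(2)] that by simp
  ultimately show ?thesis
    unfolding add_generator_def add_generator_axioms_def
    using assms(1,2,3) fG p i by simp
qed

text \<open>
  The infimum that defines the projective dimension is attained, and a resolution of length \<open>m \<le> n\<close>
  also has zero terms beyond \<open>n\<close>.
\<close>

lemma gl_dim_finite_bound:
  assumes "gl_dim A < \<infinity>"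
  obtains n where "\<And>V. V \<in> fg_modules A \<Longrightarrow>
    \<exists>Q \<delta>. projective_resolution A V Q \<delta> \<and> (\<forall>j>n. zero_module (Q (Suc j)))"
proof -
  obtain n where n: "gl_dim A = enat n" using assms by (cases "gl_dim A") auto
  have "\<exists>Q \<delta>. projective_resolution A V Q \<delta> \<and> (\<forall>j>n. zero_module (Q (Suc j)))" if V: "V \<in> fg_modules A" for V
  proof -
    let ?S = "{enat m | m. \<exists>Q \<delta>. projective_resolution A V Q \<delta> \<and> (\<forall>j>m. zero_module (Q (Suc j)))}"
    have "proj_dim A V \<le> enat n" using V n unfolding gl_dim_def by (metis SUP_upper)
    then have le: "Inf ?S \<le> enat n" unfolding proj_dim_def .
    have "?S \<noteq> {}"
    proof
      assume "?S = {}"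
      then have "Inf ?S = \<infinity>" by (metis Inf_empty top_enat_def)
      then show False using le by simp
    qed
    moreover have "Inf S \<in> S" if "S \<noteq> {}" for S :: "enat set"
      using that LeastI_ex[of "\<lambda>k. k \<in> S"] unfolding Inf_enat_def by auto
    ultimately have "Inf ?S \<in> ?S" by iprover
    then obtain m Q \<delta> where m: "Inf ?S = enat m" "projective_resolution A V Q \<delta>" "\<forall>j>m. zero_module (Q (Suc j))"
      by auto
    have "m \<le> n" using le m(1) by simp
    then show ?thesis using m(2,3) by (meson le_less_trans)
  qed
  then show thesis using that by blast
qed

text \<open>
  Resolve \<open>M\<close> by approximations in \<open>add X\<close>. The kernel \<open>Ms (n + 3)\<close> lies in \<open>add X\<close>, so its class is a
  combination of the \<open>[R]\<close>. The relations \<open>[Ms (k + 1)] - [C k] + [Ms k]\<close> carry this down to \<open>Ms 0 = M\<close>.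
\<close>

lemma in_span_cls_of_finite_gl_dim:
  fixes K :: "'k ring" and A :: "('k, 'a) module" and X :: "('k, 'a) rmod set"
  assumes "fd_algebra K A" and bas: "basic A" and "finite X" and ind: "\<And>R. R \<in> X \<Longrightarrow> indecomposable A R"
    and proj: "\<And>P. \<lbrakk>indecomposable A P; projective A P\<rbrakk> \<Longrightarrow> \<exists>R\<in>X. isomorphic A P R"
    and gl: "gl_dim (op_algebra (End_algebra A (dsum_fam X (\<lambda>R. R)))) < \<infinity>"
    and M: "M \<in> fg_modules A"
  shows "fd_algebra.in_span A X (frag_of (iso_class A M))"
proof -
  interpret fd_algebra K A by fact
  have fX: "fdmod R" if "R \<in> X" for R using ind[OF that] by (simp add: indecomposable_def fg_modules_iff)
  have tX: "trivial_idem A R" if "R \<in> X" for R by (rule indecomposable_imp_trivial_idem[OF ind[OF that]])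
  interpret G: add_generator K A X "dsum_fam X (\<lambda>R. R)"
    "\<lambda>R. \<lambda>x\<in>carrier R. (\<lambda>i\<in>X. if i = R then x else \<zero>\<^bsub>i\<^esub>)" "\<lambda>R. \<lambda>x\<in>carrier (dsum_fam X (\<lambda>R. R)). x R"
    by (rule add_generator_dsum_fam[OF assms(1,3) fX])
  obtain n where bounded: "\<And>V. V \<in> fg_modules (op_algebra (End_algebra A (dsum_fam X (\<lambda>R. R)))) \<Longrightarrow>
    \<exists>Q \<delta>. projective_resolution (op_algebra (End_algebra A (dsum_fam X (\<lambda>R. R)))) V Q \<delta> \<and> (\<forall>j>n. zero_module (Q (Suc j)))"
    by (rule gl_dim_finite_bound[OF gl]) (rule that)
  let ?ap = "\<lambda>(M :: ('k, 'a) rmod) (C :: ('k, 'a) rmod) c. fdmod C \<and> id_thru A X C \<and> c \<in> Hom A C M \<and>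
    (\<forall>R\<in>X. \<forall>h\<in>Hom A R M. \<exists>j\<in>Hom A R C. \<forall>x\<in>carrier R. c (j x) = h x)"
  have "\<exists>C c. ?ap N C c" if N: "fdmod N" for N :: "('k, 'a) rmod"
  proof -
    obtain C :: "('k, 'a) rmod" and c where "fdmod C" "id_thru A X C" "c \<in> Hom A C N"
      "\<forall>R\<in>X. \<forall>h\<in>Hom A R N. \<exists>j\<in>Hom A R C. \<forall>x\<in>carrier R. c (j x) = h x"
      by (rule approximation[OF N assms(3) fX])
    then have "?ap N C c" by (intro conjI)
    then show ?thesis by (rule exI[of _ c, THEN exI[of _ C]])
  qed
  then obtain Cf cf where ap: "\<And>N. fdmod N \<Longrightarrow> ?ap N (Cf N) (cf N)" by metis
  define Ms where "Ms = rec_nat M (\<lambda>_ N. (Cf N)\<lparr>carrier := mker (Cf N) N (cf N)\<rparr>)"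
  have Ms0: "Ms 0 = M" and MsS: "Ms (Suc k) = (Cf (Ms k))\<lparr>carrier := mker (Cf (Ms k)) (Ms k) (cf (Ms k))\<rparr>" for k
    by (simp_all add: Ms_def)
  have fMs: "fdmod (Ms k)" for k
  proof (induction k)
    case 0
    then show ?case using M by (simp add: Ms0 fg_modules_iff)
  next
    case (Suc k)
    have a: "fdmod (Cf (Ms k))" "cf (Ms k) \<in> Hom A (Cf (Ms k)) (Ms k)" using ap[OF Suc] by simp_all
    show ?case unfolding MsS
      by (rule fdmod_sub[OF a(1) subm_mker[OF a(2) fdmodD(1)[OF a(1)] fdmodD(1)[OF Suc]]])
  qed
  define C where "C k = Cf (Ms k)" for k
  define c where "c k = cf (Ms k)" for k
  have C: "fdmod (C k)" "id_thru A X (C k)" and c: "c k \<in> Hom A (C k) (Ms k)" for k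
    using ap[OF fMs[of k]] by (simp_all add: C_def c_def)
  have lift: "\<exists>j\<in>Hom A R (C k). \<forall>x\<in>carrier R. c k (j x) = h x" if "R \<in> X" "h \<in> Hom A R (Ms k)" for k R h
    using ap[OF fMs[of k]] that unfolding C_def c_def by blast
  have MS: "Ms (Suc k) = (C k)\<lparr>carrier := mker (C k) (Ms k) (c k)\<rparr>" for k unfolding C_def c_def by (rule MsS)
  have last: "in_span X (cls (Ms (Suc (Suc (Suc n)))))"
    by (rule in_span_id_thru[OF assms(3) fX tX fMs G.syzygy_id_thru[where M = Ms and C = C and c = c, OF bounded fMs C c lift MS]])
  have surj: "c k ` carrier (C k) = carrier (Ms k)" for k
    by (rule approximation_surj[OF bas proj fX fMs C(1) c]) (use lift in blast)+
  have step: "in_span X (cls (Ms k))" if s: "in_span X (cls (Ms (Suc k)))" for k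
  proof -
    have "rel_exact A X (Ms (Suc k)) (C k) (Ms k) (\<lambda>x\<in>mker (C k) (Ms k) (c k). x) (c k)"
      unfolding MS by (rule rel_exact_kernel[OF C(1) fMs c surj lift fX])
    then have r: "in_span X (cls (Ms (Suc k)) - cls (C k) + cls (Ms k))"
      by (intro in_span_rel rel_subgroup_gen)
    have "in_span X ((cls (Ms (Suc k)) - cls (C k) + cls (Ms k)) - (cls (Ms (Suc k)) - cls (C k)))"
      by (rule in_span_diff[OF r in_span_diff[OF s in_span_id_thru[OF assms(3) fX tX C]]])
    then show ?thesis by simp
  qed
  have "in_span X (cls (Ms (Suc (Suc (Suc n)) - k)))" if "k \<le> Suc (Suc (Suc n))" for k
    using that
  proof (induction k)
    case 0
    then show ?case using last by simp
  next
    case (Suc k)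
    have "Suc (Suc (Suc n)) - k = Suc (Suc (Suc (Suc n)) - Suc k)" using Suc.prems by simp
    then show ?case using Suc step by simp
  qed
  from this[OF order_refl] show ?thesis by (simp add: Ms0)
qed

text \<open>
  Modulo relations \<open>x\<close> is a combination \<open>\<Sum> n\<^sub>R [R]\<close>. If all \<open>hdim\<close> vanish on \<open>x\<close>, the coefficients \<open>n\<^sub>R\<close> solve
  the homogeneous system with the nonsingular matrix \<open>dim Hom(R', R)\<close>.
\<close>

lemma rel_subgroup_eq_hdim_zero:
  fixes K :: "'k ring" and A :: "('k, 'a) module" and X :: "('k, 'a) rmod set"
  assumes "fd_algebra K A" and bas: "basic A" and "finite X" and ind: "\<And>R. R \<in> X \<Longrightarrow> indecomposable A R"
    and pw: "pairwise_nonisomorphic A X"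
    and proj: "\<And>P. \<lbrakk>indecomposable A P; projective A P\<rbrakk> \<Longrightarrow> \<exists>R\<in>X. isomorphic A P R"
    and gl: "gl_dim (op_algebra (End_algebra A (dsum_fam X (\<lambda>R. R)))) < \<infinity>"
    and x: "Poly_Mapping.keys x \<subseteq> iso_classes A"
  shows "x \<in> rel_subgroup A X \<longleftrightarrow> (\<forall>R\<in>X. fd_algebra.hdim K A R x = 0)"
proof
  interpret fd_algebra K A by fact
  have fgX: "R \<in> fg_modules A" if "R \<in> X" for R using ind[OF that] by (simp add: indecomposable_def)
  have fX: "fdmod R" if "R \<in> X" for R using fgX[OF that] by (simp add: fg_modules_iff)
  {
    assume "x \<in> rel_subgroup A X"
    then show "\<forall>R\<in>X. hdim R x = 0" using hdim_rel_subgroup[OF _ fX] by blast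
  }
  assume z: "\<forall>R\<in>X. hdim R x = 0"
  have "in_span X x"
    using x
  proof (induction x rule: frag_induction)
    case zero
    then show ?case by (rule in_span_rel[OF rel_subgroup_0])
  next
    case (diff y z)
    then show ?case by (rule in_span_diff)
  next
    case (one a)
    then obtain M where "M \<in> fg_modules A" "a = iso_class A M" unfolding iso_classes_def by blast
    then show ?case using in_span_cls_of_finite_gl_dim[OF assms(1,2,3) ind proj gl] by simp
  qed
  then obtain n where n: "x - (\<Sum>R\<in>X. frag_cmul (n R) (cls R)) \<in> rel_subgroup A X"
    unfolding in_span_def by blast
  interpret G: add_generator K A X "dsum_fam X (\<lambda>R. R)"
    "\<lambda>R. \<lambda>x\<in>carrier R. (\<lambda>i\<in>X. if i = R then x else \<zero>\<^bsub>i\<^esub>)" "\<lambda>R. \<lambda>x\<in>carrier (dsum_fam X (\<lambda>R. R)). x R"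
    by (rule add_generator_dsum_fam[OF assms(1,3) fX])
  have rel: "(\<Sum>R\<in>X. n R * int (vdim K (hom_space A R' R))) = 0" if R': "R' \<in> X" for R'
  proof -
    have "hdim R' (\<Sum>R\<in>X. frag_cmul (n R) (cls R)) = 0"
      using hdim_rel_subgroup[OF n fX R'] z R' by (simp add: hdim_diff)
    then show ?thesis by (simp add: hdim_sum hdim_cmul hdim_cls[OF fgX fX[OF R']])
  qed
  obtain m where bounded: "\<And>V. V \<in> fg_modules (op_algebra (End_algebra A (dsum_fam X (\<lambda>R. R)))) \<Longrightarrow>
    \<exists>Q \<delta>. projective_resolution (op_algebra (End_algebra A (dsum_fam X (\<lambda>R. R)))) V Q \<delta> \<and> (\<forall>j>m. zero_module (Q (Suc j)))"
    by (rule gl_dim_finite_bound[OF gl]) (rule that)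
  have "n S = 0" if S: "S \<in> X" for S
  proof (rule G.coefficients_vanish[OF _ rel bounded _ S])
    show "trivial_idem A R" if "R \<in> X" for R by (rule indecomposable_imp_trivial_idem[OF ind[OF that]])
    show "R = R'" if "R \<in> X" "R' \<in> X" "isomorphic A R R'" for R R'
      using pw that unfolding pairwise_nonisomorphic_def by blast
    show "\<not> zero_module S" using ind[OF S] unfolding indecomposable_def by blast
  qed
  then have "(\<Sum>R\<in>X. frag_cmul (n R) (cls R)) = 0" by (intro sum.neutral) simp
  then show "x \<in> rel_subgroup A X" using n by simp
qed

text \<open>
  The canonical map \<open>G / T \<rightarrow> G / S\<close> for \<open>T \<subseteq> S\<close>, which is computed on a coset by \<open>the_elem\<close>.
\<close>

lemma (in group) factor_coset_value:
  assumes T: "subgroup T G" and S: "subgroup S G" and "T \<subseteq> S" and x: "x \<in> carrier G"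
  shows "the_elem ((\<lambda>y. S #> y) ` (T #> x)) = S #> x"
proof (rule the_elem_image_unique)
  show "T #> x \<noteq> {}" using subgroup.one_closed[OF T] by (auto simp: r_coset_def)
  fix y assume "y \<in> T #> x"
  then obtain t where t: "t \<in> T" "y = t \<otimes> x" by (auto simp: r_coset_def)
  have tG: "t \<in> carrier G" using subgroup.mem_carrier[OF T t(1)] .
  have "S #> y = (S #> t) #> x"
    unfolding t(2) by (rule coset_mult_assoc[OF subgroup.subset[OF S] tG x, symmetric])
  also have "S #> t = S" using coset_join2[OF tG S] t(1) assms(3) by blast
  finally show "S #> y = S #> x" .
qed

theorem theorem1p1:
  fixes K :: "'k ring"
    and \<Lambda> :: "('k, 'a) module"
    and X :: "('k, 'a) rmod set"
  assumes "fd_algebra K \<Lambda>"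
    and "basic \<Lambda>"
    and "\<And>S. simple_module \<Lambda> S \<Longrightarrow> vdim K (underlying_space \<Lambda> S) = 1"
    and "finite X"
    and "\<And>R. R \<in> X \<Longrightarrow> indecomposable \<Lambda> R"
    and "pairwise_nonisomorphic \<Lambda> X"
    and "\<And>P. \<lbrakk>indecomposable \<Lambda> P; projective \<Lambda> P\<rbrakk> \<Longrightarrow> \<exists>R\<in>X. isomorphic \<Lambda> P R"
    and "gl_dim (op_algebra (End_algebra \<Lambda> (dsum_fam X (\<lambda>R. R)))) < \<infinity>"
  shows "kernel (K0_split \<Lambda>) (K0_rel \<Lambda> X) (homological_invariant \<Lambda> X) =
    kernel (K0_split \<Lambda>) (product_group X (\<lambda>_. integer_group)) (dim_hom_invariant K \<Lambda> X)"
proof -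
  interpret A: fd_algebra K \<Lambda> by fact
  interpret F: group "free_K0 \<Lambda>" by (rule A.group_free_K0)
  have fX: "A.fdmod R" if "R \<in> X" for R using assms(5)[OF that] by (simp add: indecomposable_def A.fg_modules_iff)
  let ?T = "split_subgroup \<Lambda>" and ?S = "rel_subgroup \<Lambda> X"
  note T = A.split_subgroup_is_subgroup and S = A.rel_subgroup_is_subgroup[of X]
  have TS: "?T \<subseteq> ?S" by (rule A.split_subgroup_subset[OF fX])
  have dh: "dim_hom_free K \<Lambda> X x = (\<lambda>R\<in>X. A.hdim R x)" for x
    by (simp add: dim_hom_free_def A.hdim_def)
  have "homological_invariant \<Lambda> X C = \<one>\<^bsub>K0_rel \<Lambda> X\<^esub> \<longleftrightarrow>
      dim_hom_invariant K \<Lambda> X C = \<one>\<^bsub>product_group X (\<lambda>_. integer_group)\<^esub>"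
    if "C \<in> carrier (K0_split \<Lambda>)" for C
  proof -
    have "\<exists>x\<in>carrier (free_K0 \<Lambda>). C = ?T #>\<^bsub>free_K0 \<Lambda>\<^esub> x"
      using that unfolding K0_split_def FactGroup_def RCOSETS_def by simp
    then obtain x where x: "x \<in> carrier (free_K0 \<Lambda>)" "C = ?T #>\<^bsub>free_K0 \<Lambda>\<^esub> x"
      by (rule bexE)
    have kx: "Poly_Mapping.keys x \<subseteq> iso_classes \<Lambda>" using x(1) by (simp add: free_K0_def)
    have "homological_invariant \<Lambda> X C = ?S #>\<^bsub>free_K0 \<Lambda>\<^esub> x"
      unfolding homological_invariant_def x(2) by (rule F.factor_coset_value[OF T S TS x(1)])
    then have "homological_invariant \<Lambda> X C = \<one>\<^bsub>K0_rel \<Lambda> X\<^esub> \<longleftrightarrow> ?S #>\<^bsub>free_K0 \<Lambda>\<^esub> x = ?S"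
      by (simp add: K0_rel_def FactGroup_def)
    also have "\<dots> \<longleftrightarrow> x \<in> ?S"
      using F.coset_join1[OF _ x(1) S] F.coset_join2[OF x(1) S] by blast
    also have "\<dots> \<longleftrightarrow> (\<forall>R\<in>X. A.hdim R x = 0)"
      by (rule rel_subgroup_eq_hdim_zero[OF assms(1,2,4,5,6,7,8) kx])
    also have "\<dots> \<longleftrightarrow> (\<lambda>R\<in>X. A.hdim R x) = (\<lambda>R\<in>X. 0)"
      by (metis (mono_tags, lifting) restrict_apply' restrict_ext)
    also have "(\<lambda>R\<in>X. A.hdim R x) = dim_hom_invariant K \<Lambda> X C"
      unfolding dim_hom_invariant_def
    proof (rule the_elem_image_unique[symmetric])
      show "C \<noteq> {}" using subgroup.one_closed[OF T] unfolding x(2) by (auto simp: r_coset_def)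
      fix y assume "y \<in> C"
      then obtain t where t: "t \<in> ?T" "y = t + x" unfolding x(2) by (auto simp: r_coset_def free_K0_def)
      show "dim_hom_free K \<Lambda> X y = (\<lambda>R\<in>X. A.hdim R x)"
        unfolding dh t(2) A.hdim_add
        by (rule restrict_ext) (use A.hdim_rel_subgroup[OF subsetD[OF TS t(1)] fX] in simp)
    qed
    finally show ?thesis unfolding one_product_group one_integer_group .
  qed
  then show ?thesis unfolding kernel_def by blast
qed

end
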